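(* Let $0\le k<n$ be integers, let $D\in\mathcal{Y}_k$ be a Young diagram with $k$ boxes, and let $\sigma_D$ be the irreducible representation of $S_k$ attached to $D$. Consider $S_k\times S_{n-k}\subset S_n$, where $S_k$ is the subgroup fixing the last $n-k$ letters and $S_{n-k}$ is the symmetric group on these last $n-k$ letters. Let $\mathbf{1}_{n-k}$ be the trivial representation of $S_{n-k}$ and set $$I_{\sigma_D}=\mathrm{Ind}_{S_k\times S_{n-k}}^{S_n}(\sigma_D\otimes\mathbf{1}_{n-k}).$$ Then $I_{\sigma_D}$ is multiplicity-free. It consists of one copy of each representation $\sigma_E$ of $S_n$, for the diagrams $E\in\mathcal{Y}_n$ such that (1) $D\subset E$; and (2) $E-D$ is a horizontal $(n-k)$-strip.
   Context: All representations are finite-dimensional and complex. $\mathcal{Y}_m$ is the set of Young diagrams (partitions) $D=(d_1\ge\dots\ge d_r)$ with $d_1+\dots+d_r=m$ (trailing zeros are ignored); $D^t$ is the transpose diagram. For $D=(d_1\ge\dots\ge d_r)\in\mathcal{Y}_m$, $S_D\cong S_{d_1}\times\dots\times S_{d_r}\subset S_m$ is the subgroup preserving each of the blocks $\{1,\dots,d_1\},\{d_1+1,\dots,d_1+d_2\},\dots$. The Young module is $Y_D=\mathrm{Ind}_{S_D}^{S_m}(\mathbf{1})$ and the twisted Young module is $Y_D(sgn)=\mathrm{Ind}_{S_D}^{S_m}(sgn|_{S_D})$, where $sgn$ is the sign representation. $\sigma_D$ denotes the unique irreducible representation of $S_m$ occurring in both $Y_{D^t}(sgn)$ and $Y_D$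 (these two representations have a one-dimensional space of intertwiners). For $E\in\mathcal{Y}_n$, $D\in\mathcal{Y}_k$, $D\subset E$ means each row of $E$ is at least as long as the corresponding row of $D$; then $E-D$ is the configuration of boxes of $E$ not in $D$. $E-D$ is a horizontal $m$-strip if each column of $E$ is at most one box longer than the corresponding column of $D$, and $E-D$ has $m$ boxes. *)

theory Defs
  imports Complex_Main "HOL-Algebra.Sym_Groups" "HOL-Library.Function_Algebras"
begin

section \<open>Finite-dimensional complex representations\<close>

text \<open>
  Vector spaces are realised as linear subspaces of the space of all functions
  \<^typ>\<open>'x \<Rightarrow> complex\<close> on some type. Every finite-dimensional complex vector space has
  such a realisation, and tensor products, induced modules and direct sums of
  function spaces are again function spaces.
\<close>

definition cscale :: "complex \<Rightarrow> ('x \<Rightarrow> complex) \<Rightarrow> 'x \<Rightarrow> complex"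
  where "cscale c v = (\<lambda>x. c * v x)"

global_interpretation cfun: vector_space "cscale :: complex \<Rightarrow> ('x \<Rightarrow> complex) \<Rightarrow> 'x \<Rightarrow> complex"
  by standard (simp_all add: cscale_def fun_eq_iff algebra_simps)

record ('g, 'x) crep =
  space :: "('x \<Rightarrow> complex) set"
  act :: "'g \<Rightarrow> ('x \<Rightarrow> complex) \<Rightarrow> 'x \<Rightarrow> complex"

definition linear_on :: "('x \<Rightarrow> complex) set \<Rightarrow> (('x \<Rightarrow> complex) \<Rightarrow> 'y \<Rightarrow> complex) \<Rightarrow> bool"
  where "linear_on V T \<longleftrightarrow>
    (\<forall>u\<in>V. \<forall>v\<in>V. T (u + v) = T u + T v) \<and> (\<forall>c. \<forall>v\<in>V. T (cscale c v) = cscale c (T v))"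

text \<open>Only the values of \<^term>\<open>act R g v\<close> for \<open>g\<close> in the group and \<open>v\<close> in the space matter.\<close>

definition representation :: "('g, 'm) monoid_scheme \<Rightarrow> ('g, 'x) crep \<Rightarrow> bool"
  where "representation G R \<longleftrightarrow>
    group G \<and>
    cfun.subspace (space R) \<and> (\<exists>B. finite B \<and> cfun.span B = space R) \<and>
    (\<forall>g\<in>carrier G. act R g ` space R \<subseteq> space R \<and> linear_on (space R) (act R g)) \<and>
    (\<forall>v\<in>space R. act R \<one>\<^bsub>G\<^esub> v = v) \<and>
    (\<forall>g\<in>carrier G. \<forall>h\<in>carrier G. \<forall>v\<in>space R. act R (g \<otimes>\<^bsub>G\<^esub> h) v = act R g (act R h v))"

definition invariant_subspace :: "('g, 'm) monoid_scheme \<Rightarrow> ('g, 'x) crep \<Rightarrow> ('x \<Rightarrow> complex) set \<Rightarrow> bool"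
  where "invariant_subspace G R U \<longleftrightarrow>
    cfun.subspace U \<and> U \<subseteq> space R \<and> (\<forall>g\<in>carrier G. act R g ` U \<subseteq> U)"

definition subrep :: "('g, 'x) crep \<Rightarrow> ('x \<Rightarrow> complex) set \<Rightarrow> ('g, 'x) crep"
  where "subrep R U = R\<lparr>space := U\<rparr>"

definition irreducible_rep :: "('g, 'm) monoid_scheme \<Rightarrow> ('g, 'x) crep \<Rightarrow> bool"
  where "irreducible_rep G R \<longleftrightarrow>
    representation G R \<and> space R \<noteq> {0} \<and>
    (\<forall>U. invariant_subspace G R U \<longrightarrow> U = {0} \<or> U = space R)"

definition rep_iso :: "('g, 'm) monoid_scheme \<Rightarrow> ('g, 'x) crep \<Rightarrow> ('g, 'y) crep \<Rightarrow> bool"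
  where "rep_iso G R R' \<longleftrightarrow>
    representation G R \<and> representation G R' \<and>
    (\<exists>T. linear_on (space R) T \<and> bij_betw T (space R) (space R') \<and>
      (\<forall>g\<in>carrier G. \<forall>v\<in>space R. T (act R g v) = act R' g (T v)))"

definition occurs_in :: "('g, 'm) monoid_scheme \<Rightarrow> ('g, 'x) crep \<Rightarrow> ('g, 'y) crep \<Rightarrow> bool"
  where "occurs_in G W R \<longleftrightarrow> (\<exists>U. invariant_subspace G R U \<and> rep_iso G W (subrep R U))"

definition direct_sum :: "'i set \<Rightarrow> ('i \<Rightarrow> ('g, 'x) crep) \<Rightarrow> ('g, 'i \<times> 'x) crep"
  where "direct_sum I R = \<lparr>
    space = {F. (\<forall>i\<in>I. (\<lambda>x. F (i, x)) \<in> space (R i)) \<and> (\<forall>i. i \<notin> I \<longrightarrow> (\<forall>x. F (i, x) = 0))},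
    act = (\<lambda>g F (i, x). if i \<in> I then act (R i) g (\<lambda>y. F (i, y)) x else 0)\<rparr>"

text \<open>Multiplicity-free: a direct sum of pairwise non-isomorphic irreducible representations.\<close>

definition multiplicity_free :: "('g, 'm) monoid_scheme \<Rightarrow> ('g, 'x) crep \<Rightarrow> bool"
  where "multiplicity_free G R \<longleftrightarrow>
    (\<exists>\<W>. finite \<W> \<and>
      (\<forall>U\<in>\<W>. invariant_subspace G R U \<and> irreducible_rep G (subrep R U)) \<and>
      (\<forall>U\<in>\<W>. \<forall>U'\<in>\<W>. rep_iso G (subrep R U) (subrep R U') \<longrightarrow> U = U') \<and>
      rep_iso G R (direct_sum \<W> (subrep R)))"

text \<open>
  The outer tensor product, a representation of \<open>G \<times>\<times> H\<close>. The pure tensor of \<open>v\<close> and \<open>w\<close> is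
  the function \<open>(x, y) \<mapsto> v x * w y\<close>. If \<open>F\<close> is in the span of the pure tensors, then each
  slice \<open>x \<mapsto> F (x, y)\<close> lies in the first space, and applying \<open>g\<close> to these slices and then
  \<open>h\<close> to the slices in the other variable gives the linear map sending \<open>v \<otimes> w\<close> to
  \<open>g v \<otimes> h w\<close>.
\<close>

definition outer_tensor :: "('g, 'x) crep \<Rightarrow> ('h, 'y) crep \<Rightarrow> ('g \<times> 'h, 'x \<times> 'y) crep"
  where "outer_tensor R S = \<lparr>
    space = cfun.span {\<lambda>(x, y). v x * w y | v w. v \<in> space R \<and> w \<in> space S},
    act = (\<lambda>(g, h) F (x, y). act S h (\<lambda>y'. act R g (\<lambda>x'. F (x', y')) x) y)\<rparr>"

text \<open>
  Induction of a representation \<open>R\<close> of \<open>H\<close> to \<open>G\<close> along an injective homomorphism \<open>\<phi>\<close> from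
  \<open>H\<close> to \<open>G\<close>, which identifies \<open>H\<close> with a subgroup of \<open>G\<close> (for an actual subgroup, \<open>\<phi>\<close> is the
  identity). The space consists of the functions \<open>f\<close> from \<open>G\<close> to the space of \<open>R\<close> with
  \<open>f (\<phi> h g) = h (f g)\<close>, written uncurried and extended by \<open>0\<close> outside \<open>G\<close>; the group acts
  by right translation.
\<close>

definition induced :: "('g, 'm) monoid_scheme \<Rightarrow> ('h, 'n) monoid_scheme \<Rightarrow> ('h \<Rightarrow> 'g) \<Rightarrow>
    ('h, 'x) crep \<Rightarrow> ('g, 'g \<times> 'x) crep"
  where "induced G H \<phi> R = \<lparr>
    space = {F.
      (\<forall>g\<in>carrier G. (\<lambda>x. F (g, x)) \<in> space R) \<and>
      (\<forall>g. g \<notin> carrier G \<longrightarrow> (\<forall>x. F (g, x) = 0)) \<and>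
      (\<forall>h\<in>carrier H. \<forall>g\<in>carrier G.
        (\<lambda>x. F (\<phi> h \<otimes>\<^bsub>G\<^esub> g, x)) = act R h (\<lambda>x. F (g, x)))},
    act = (\<lambda>g F (a, x). if a \<in> carrier G then F (a \<otimes>\<^bsub>G\<^esub> g, x) else 0)\<rparr>"

definition trivial_rep :: "('g, unit) crep"
  where "trivial_rep = \<lparr>space = UNIV, act = (\<lambda>g v. v)\<rparr>"

definition sign_rep :: "(nat \<Rightarrow> nat, unit) crep"
  where "sign_rep = \<lparr>space = UNIV, act = (\<lambda>p. cscale (of_int (sign p)))\<rparr>"


section \<open>Young diagrams\<close>

text \<open>A diagram is the list of its positive row lengths; rows and columns are numbered from \<open>0\<close>.\<close>

definition young_diagrams :: "nat \<Rightarrow> nat list set"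
  where "young_diagrams m = {D. sorted_wrt (\<ge>) D \<and> 0 \<notin> set D \<and> sum_list D = m}"

definition row_length :: "nat list \<Rightarrow> nat \<Rightarrow> nat"
  where "row_length D i = (if i < length D then D ! i else 0)"

definition boxes :: "nat list \<Rightarrow> (nat \<times> nat) set"
  where "boxes D = {(i, j). j < row_length D i}"

definition col_length :: "nat list \<Rightarrow> nat \<Rightarrow> nat"
  where "col_length D j = card {i. (i, j) \<in> boxes D}"

definition transpose_diagram :: "nat list \<Rightarrow> nat list"
  where "transpose_diagram D = map (col_length D) [0..<row_length D 0]"

definition diagram_contained :: "nat list \<Rightarrow> nat list \<Rightarrow> bool"
  where "diagram_contained D E \<longleftrightarrow> (\<forall>i. row_length D i \<le> row_length E i)"

definition horizontal_strip :: "nat \<Rightarrow> nat list \<Rightarrow> nat list \<Rightarrow> bool"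
  where "horizontal_strip m E D \<longleftrightarrow>
    (\<forall>j. col_length E j \<le> col_length D j + 1) \<and> card (boxes E - boxes D) = m"


section \<open>Representations of symmetric groups\<close>

definition young_subgroup :: "nat list \<Rightarrow> (nat \<Rightarrow> nat) set"
  where "young_subgroup D = {p. p permutes {1..sum_list D} \<and>
    (\<forall>i<length D.
      p ` {sum_list (take i D) + 1..sum_list (take (Suc i) D)} =
        {sum_list (take i D) + 1..sum_list (take (Suc i) D)})}"

definition induced_from_young ::
    "nat list \<Rightarrow> (nat \<Rightarrow> nat, 'x) crep \<Rightarrow> (nat \<Rightarrow> nat, (nat \<Rightarrow> nat) \<times> 'x) crep"
  where "induced_from_young D R =
    (let G = sym_group (sum_list D) in induced G (G\<lparr>carrier := young_subgroup D\<rparr>) id R)"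

definition young_module :: "nat list \<Rightarrow> (nat \<Rightarrow> nat, (nat \<Rightarrow> nat) \<times> unit) crep"
  where "young_module D = induced_from_young D trivial_rep"

definition twisted_young_module :: "nat list \<Rightarrow> (nat \<Rightarrow> nat, (nat \<Rightarrow> nat) \<times> unit) crep"
  where "twisted_young_module D = induced_from_young D sign_rep"

definition is_sigma :: "nat list \<Rightarrow> (nat \<Rightarrow> nat, 'x) crep \<Rightarrow> bool"
  where "is_sigma D R \<longleftrightarrow>
    irreducible_rep (sym_group (sum_list D)) R \<and>
    occurs_in (sym_group (sum_list D)) R (twisted_young_module (transpose_diagram D)) \<and>
    occurs_in (sym_group (sum_list D)) R (young_module D)"

text \<open>
  For a diagram \<open>D\<close>, \<^const>\<open>is_sigma\<close> determines a representation up to isomorphism; \<open>sigma D\<close>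
  is a representative realised in the function space underlying \<^term>\<open>young_module D\<close>.
\<close>

definition sigma :: "nat list \<Rightarrow> (nat \<Rightarrow> nat, (nat \<Rightarrow> nat) \<times> unit) crep"
  where "sigma D = (SOME R. is_sigma D R)"

text \<open>The symmetric group on the letters \<open>k + 1, \<dots>, n\<close>.\<close>

definition sym_group_last :: "nat \<Rightarrow> nat \<Rightarrow> (nat \<Rightarrow> nat) monoid"
  where "sym_group_last k n = \<lparr>carrier = {p. p permutes {k + 1..n}}, mult = (\<circ>), one = id\<rparr>"

text \<open>
  \<open>S\<^sub>k \<times> S\<^sub>n\<^sub>-\<^sub>k\<close> is embedded in \<open>S\<^sub>n\<close> by composing the two permutations, which move disjoint
  sets of letters.
\<close>

definition induced_trivial ::
    "nat \<Rightarrow> nat \<Rightarrow> (nat \<Rightarrow> nat, 'x) crep \<Rightarrow> (nat \<Rightarrow> nat, (nat \<Rightarrow> nat) \<times> 'x \<times> unit) crep"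
  where "induced_trivial k n R =
    induced (sym_group n) (sym_group k \<times>\<times> sym_group_last k n) (\<lambda>(p, q). p \<circ> q)
      (outer_tensor R trivial_rep)"

end

theory Submission
  imports Defs
begin

text \<open>
  Let \<open>T\<close> be the functor inducing \<open>R \<otimes> \<one>\<close> from \<open>S\<^sub>k \<times> S\<^sub>n\<^sub>-\<^sub>k\<close> to \<open>S\<^sub>n\<close>. It sends the Young module of a
  composition \<open>\<mu>\<close> of \<open>k\<close> to the Young module of \<open>\<mu>\<close> followed by \<open>n - k\<close>. If the multiplicity of
  \<open>\<sigma>\<^sub>E\<close> in a Young module is a number of semistandard tableaux (Young's rule), then the expected
  answer holds for \<open>T\<close> of every Young module, and inverting the unitriangular matrix of these
  multiplicities gives it for \<open>T \<sigma>\<^sub>D\<close>.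

  Young's rule is proved without constructing the \<open>\<sigma>\<^sub>E\<close>. The matrix of multiplicities and the matrix of
  tableau numbers are both unitriangular, and they have the same Gram matrix: the dimension of
  the space of intertwiners between two Young modules is a number of double cosets, that is, of
  nonnegative integer matrices with given margins, and the local rule for adding and removing
  horizontal strips shows that the tableau numbers have the same scalar products. A Gram matrix
  determines its unitriangular factor; comparing the norms also shows that the Young modules
  have no other constituents. Unitriangularity is with respect to the statistic
  \<open>\<Sum>i. i * \<mu> i\<close>, which is strictly decreasing for the dominance order and easier to handle.
\<close>

section \<open>Finite-dimensional spaces of functions\<close>

text \<open>The scalar product of two representations is the dimension of the space of intertwiners;
  orthogonality enters as additivity in each argument together with Schur's lemma. All that is known
  about \<open>sigma D\<close> is that it is irreducible and occurs in a Young module and in a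
  twisted Young module. The twisted module supplies the triangularity on the side of
  representations: its intertwiners to \<open>young_module D\<close> form a line, and those to
  another Young module vanish unless the statistic of the latter is larger or its row lengths are
  those of \<open>D\<close>. Inverting the matrix is an induction on the statistic, since the
  equation for a diagram contains that diagram with coefficient one and otherwise only diagrams of
  smaller statistic. Such an equation expands the intertwiners out of a Young module over its
  constituents, so these must already be known to be of the form \<open>sigma E\<close>; for this
  reason the comparison of norms is interleaved with the induction.\<close>

global_interpretation cfun_pair: vector_space_pair
  "cscale :: complex \<Rightarrow> ('x \<Rightarrow> complex) \<Rightarrow> 'x \<Rightarrow> complex"
  "cscale :: complex \<Rightarrow> ('y \<Rightarrow> complex) \<Rightarrow> 'y \<Rightarrow> complex"
  by standard

definition fin_dim :: "('x \<Rightarrow> complex) set \<Rightarrow> bool"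
  where "fin_dim V \<longleftrightarrow> cfun.subspace V \<and> (\<exists>B. finite B \<and> cfun.span B = V)"

lemma fin_dim_subspace: "fin_dim V \<Longrightarrow> cfun.subspace V"
  by (simp add: fin_dim_def)

lemma fin_dim_basis:
  assumes "fin_dim V"
  obtains B where "finite B" "cfun.independent B" "cfun.span B = V" "card B = cfun.dim V" "B \<subseteq> V"
proof -
  obtain B0 where B0: "finite B0" "cfun.span B0 = V" using assms by (auto simp: fin_dim_def)
  obtain B where B: "B \<subseteq> V" "cfun.independent B" "V \<subseteq> cfun.span B" "card B = cfun.dim V"
    by (rule cfun.basis_exists[of V])
  have "finite B" using cfun.independent_span_bound[OF B0(1) B(2)] B(1) B0(2) by auto
  moreover have "cfun.span B = V"
    using B(1,3) assms by (metis fin_dim_def cfun.span_minimal subset_antisym)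
  ultimately show ?thesis using that B by blast
qed

lemma fin_dim_subset:
  assumes "cfun.subspace A" "A \<subseteq> V" "fin_dim V"
  shows "fin_dim A" and "cfun.dim A \<le> cfun.dim V"
proof -
  obtain C where C: "finite C" "cfun.independent C" "cfun.span C = V" "card C = cfun.dim V" "C \<subseteq> V"
    by (rule fin_dim_basis[OF assms(3)])
  obtain B where B: "B \<subseteq> A" "cfun.independent B" "A \<subseteq> cfun.span B" "card B = cfun.dim A"
    by (rule cfun.basis_exists[of A])
  have f: "finite B \<and> card B \<le> card C"
    using cfun.independent_span_bound[OF C(1) B(2)] B(1) C(3) assms(2) by auto
  have "cfun.span B = A" using B(1,3) assms(1) by (metis cfun.span_minimal subset_antisym)
  then show "fin_dim A" unfolding fin_dim_def using assms(1) f by blast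
  show "cfun.dim A \<le> cfun.dim V" using f B(4) C(4) by simp
qed

lemma dim_eq_subset:
  assumes "cfun.subspace A" "A \<subseteq> V" "fin_dim V" "cfun.dim A = cfun.dim V"
  shows "A = V"
proof (rule ccontr)
  assume "A \<noteq> V"
  then obtain v where v: "v \<in> V" "v \<notin> A" using assms(2) by blast
  obtain B where B: "finite B" "cfun.independent B" "cfun.span B = A" "card B = cfun.dim A" "B \<subseteq> A"
    by (rule fin_dim_basis[OF fin_dim_subset(1)[OF assms(1-3)]])
  obtain C where C: "finite C" "cfun.independent C" "cfun.span C = V" "card C = cfun.dim V" "C \<subseteq> V"
    by (rule fin_dim_basis[OF assms(3)])
  have "v \<notin> cfun.span B" using B(3) v(2) by simp
  then have "cfun.independent (insert v B)" using B(2) by (rule cfun.independent_insertI)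
  moreover have "insert v B \<subseteq> cfun.span C" using v B(5) assms(2) C(3) by auto
  ultimately have "card (insert v B) \<le> card C"
    using cfun.independent_span_bound[OF C(1)] by (metis (no_types))
  moreover have "v \<notin> B" using v(2) B(5) by blast
  ultimately show False using B(1,4) C(4) assms(4) by simp
qed

lemma dim_zero_iff:
  assumes "fin_dim V"
  shows "cfun.dim V = 0 \<longleftrightarrow> V = {0}"
proof
  assume "cfun.dim V = 0"
  then obtain B where "cfun.span B = V" "finite B" "card B = 0" using fin_dim_basis[OF assms] by metis
  then show "V = {0}" by simp
next
  assume "V = {0}"
  then have "V = cfun.span {}" by simp
  then have "cfun.dim V = card ({} :: ('a \<Rightarrow> complex) set)"
    using cfun.dim_span_eq_card_independent[OF cfun.independent_empty] by metis
  then show "cfun.dim V = 0" by simp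
qed

lemma fin_dim_zero: "fin_dim {0}"
  unfolding fin_dim_def using cfun.subspace_single_0 cfun.span_empty by blast

lemma dim_one:
  assumes "fin_dim V" "v \<in> V" "v \<noteq> 0" "\<And>w. w \<in> V \<Longrightarrow> \<exists>c. w = cscale c v"
  shows "cfun.dim V = 1"
proof -
  have "cfun.span {v} = V"
  proof
    show "cfun.span {v} \<subseteq> V" using assms(1,2) by (simp add: cfun.span_minimal fin_dim_def)
    show "V \<subseteq> cfun.span {v}"
      using assms(4) by (metis cfun.span_base cfun.span_scale insertI1 subsetI)
  qed
  then show ?thesis using cfun.dim_span_eq_card_independent[of "{v}"] assms(3) by simp
qed

section \<open>Linear maps defined on a subspace\<close>

lemma linear_on_add: "linear_on V T \<Longrightarrow> u \<in> V \<Longrightarrow> v \<in> V \<Longrightarrow> T (u + v) = T u + T v"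
  and linear_on_scale: "linear_on V T \<Longrightarrow> v \<in> V \<Longrightarrow> T (cscale c v) = cscale c (T v)"
  by (simp_all add: linear_on_def)

lemma linear_on_zero:
  assumes "linear_on V T" "cfun.subspace V"
  shows "T 0 = 0"
  using linear_on_scale[OF assms(1) cfun.subspace_0[OF assms(2)], of 0] by simp

lemma linear_on_diff:
  assumes "linear_on V T" "cfun.subspace V" "u \<in> V" "v \<in> V"
  shows "T (u - v) = T u - T v"
proof -
  have "T u = T ((u - v) + v)" by simp
  also have "\<dots> = T (u - v) + T v"
    using assms by (intro linear_on_add[OF assms(1)]) (auto intro: cfun.subspace_diff)
  finally show ?thesis by simp
qed

lemma linear_on_sum:
  assumes "linear_on V T" "cfun.subspace V" "\<And>i. i \<in> I \<Longrightarrow> f i \<in> V"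
  shows "T (\<Sum>i\<in>I. f i) = (\<Sum>i\<in>I. T (f i))"
  using assms(3)
proof (induction I rule: infinite_finite_induct)
  case (insert i I)
  have s: "(\<Sum>j\<in>I. f j) \<in> V" using insert.prems by (auto intro: cfun.subspace_sum[OF assms(2)])
  have "T (f i + (\<Sum>j\<in>I. f j)) = T (f i) + T (\<Sum>j\<in>I. f j)"
    using linear_on_add[OF assms(1) _ s] insert.prems by blast
  also have "\<dots> = T (f i) + (\<Sum>j\<in>I. T (f j))" using insert by simp
  finally show ?case using insert.hyps by (simp only: sum.insert not_False_eq_True)
qed (use linear_on_zero[OF assms(1,2)] in auto)

lemma linear_on_subset: "linear_on V T \<Longrightarrow> U \<subseteq> V \<Longrightarrow> linear_on U T"
  unfolding linear_on_def by blast

lemma linear_on_inj_iff: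
  assumes "linear_on V T" "cfun.subspace V"
  shows "inj_on T V \<longleftrightarrow> (\<forall>v\<in>V. T v = 0 \<longrightarrow> v = 0)"
proof
  assume "inj_on T V"
  then show "\<forall>v\<in>V. T v = 0 \<longrightarrow> v = 0"
    using linear_on_zero[OF assms] cfun.subspace_0[OF assms(2)] by (metis inj_onD)
next
  assume *: "\<forall>v\<in>V. T v = 0 \<longrightarrow> v = 0"
  show "inj_on T V"
  proof (rule inj_onI)
    fix u v assume uv: "u \<in> V" "v \<in> V" "T u = T v"
    then have "T (u - v) = 0" using linear_on_diff[OF assms] by simp
    then show "u = v" using * uv cfun.subspace_diff[OF assms(2)] by (metis eq_iff_diff_eq_0)
  qed
qed

lemma linear_on_subspace_image:
  assumes "linear_on V T" "cfun.subspace V"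
  shows "cfun.subspace (T ` V)"
  unfolding cfun.subspace_def
proof (intro conjI ballI allI)
  show "0 \<in> T ` V" using linear_on_zero[OF assms] cfun.subspace_0[OF assms(2)] by force
  show "x + y \<in> T ` V" if xy: "x \<in> T ` V" "y \<in> T ` V" for x y
  proof -
    obtain a b where ab: "a \<in> V" "b \<in> V" "x = T a" "y = T b" using xy by blast
    then show ?thesis
      using linear_on_add[OF assms(1) ab(1,2)] cfun.subspace_add[OF assms(2) ab(1,2)] by (metis imageI)
  qed
  show "cscale c x \<in> T ` V" if x: "x \<in> T ` V" for c x
  proof -
    obtain a where a: "a \<in> V" "x = T a" using x by blast
    then show ?thesis
      using linear_on_scale[OF assms(1) a(1)] cfun.subspace_scale[OF assms(2) a(1)] by (metis imageI)
  qed
qed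

lemma linear_on_kernel:
  assumes "linear_on V T" "cfun.subspace V"
  shows "cfun.subspace {v \<in> V. T v = 0}"
  using assms linear_on_zero[OF assms]
  by (auto simp: cfun.subspace_def linear_on_add linear_on_scale)

lemma linear_on_inv_into:
  assumes "linear_on V T" "cfun.subspace V" "bij_betw T V W"
  shows "linear_on W (inv_into V T)"
proof -
  have i: "inv_into V T w \<in> V" "T (inv_into V T w) = w" if "w \<in> W" for w
    using assms(3) that by (auto simp: bij_betw_def inv_into_into f_inv_into_f)
  have j: "inv_into V T (T v) = v" if "v \<in> V" for v
    using assms(3) that by (auto simp: bij_betw_def)
  show ?thesis unfolding linear_on_def
  proof (intro conjI ballI allI)
    fix u v assume "u \<in> W" "v \<in> W"
    then show "inv_into V T (u + v) = inv_into V T u + inv_into V T v"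
      using j[of "inv_into V T u + inv_into V T v"] i linear_on_add[OF assms(1)]
        cfun.subspace_add[OF assms(2)] by simp
  next
    fix c v assume "v \<in> W"
    then show "inv_into V T (cscale c v) = cscale c (inv_into V T v)"
      using j[of "cscale c (inv_into V T v)"] i linear_on_scale[OF assms(1)]
        cfun.subspace_scale[OF assms(2)] by simp
  qed
qed

text \<open>Passes from a map that is linear only on \<open>V\<close> to a globally linear one,
  along which spans and independent sets can be transported: \<open>construct\<close> prescribes the
  values of \<open>T\<close> on a basis of \<open>V\<close>, and agreement on the basis spreads to
  its span.\<close>

lemma linear_on_extend:
  fixes T :: "('x \<Rightarrow> complex) \<Rightarrow> 'y \<Rightarrow> complex"
  assumes "linear_on V T" "cfun.subspace V"
  shows "\<exists>g. Vector_Spaces.linear cscale cscale g \<and> (\<forall>v\<in>V. g v = T v)"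
proof -
  obtain B where B: "B \<subseteq> V" "cfun.independent B" "V \<subseteq> cfun.span B" "card B = cfun.dim V"
    by (rule cfun.basis_exists[of V])
  define g where "g = cfun_pair.construct B T"
  have lin: "Vector_Spaces.linear cscale cscale g"
    unfolding g_def by (rule cfun_pair.linear_construct[OF B(2)])
  have gadd: "g (u + v) = g u + g v" for u v by (rule cfun_pair.linear_add[OF lin])
  have gscale: "g (cscale c v) = cscale c (g v)" for c v by (rule cfun_pair.linear_scale[OF lin])
  have gzero: "g 0 = 0" by (rule cfun_pair.linear_0[OF lin])
  have "cfun.span B \<subseteq> {v \<in> V. g v = T v}"
  proof (rule cfun.span_minimal)
    show "B \<subseteq> {v \<in> V. g v = T v}"
      using B(1,2) cfun_pair.construct_basis[OF B(2)] by (auto simp: g_def)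
    show "cfun.subspace {v \<in> V. g v = T v}"
      using assms linear_on_zero[OF assms] gzero
      by (auto simp: cfun.subspace_def gadd gscale linear_on_add linear_on_scale)
  qed
  then have gT: "g v = T v" if "v \<in> V" for v using that B(3) by blast
  show ?thesis using lin gT by auto
qed

lemma fin_dim_image:
  fixes T :: "('x \<Rightarrow> complex) \<Rightarrow> 'y \<Rightarrow> complex"
  assumes "fin_dim V" "linear_on V T"
  shows "fin_dim (T ` V)" and "inj_on T V \<Longrightarrow> cfun.dim (T ` V) = cfun.dim V"
proof -
  obtain B where B: "finite B" "cfun.independent B" "cfun.span B = V" "card B = cfun.dim V" "B \<subseteq> V"
    by (rule fin_dim_basis[OF assms(1)])
  obtain g where g: "Vector_Spaces.linear cscale cscale g" "\<forall>v\<in>V. g v = T v"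
    using linear_on_extend[OF assms(2) fin_dim_subspace[OF assms(1)]] by metis
  have im: "T ` V = g ` V" "T ` B = g ` B" using g(2) B(5) by force+
  have sp: "g ` V = cfun.span (g ` B)"
    using cfun_pair.linear_span_image[OF g(1), of B] B(3) by simp
  show "fin_dim (T ` V)"
    unfolding fin_dim_def im sp using B(1) by (auto intro: cfun.subspace_span)
  assume inj: "inj_on T V"
  then have injg: "inj_on g (cfun.span B)" using g(2) B(3) by (simp add: inj_on_def)
  have ind: "cfun.independent (g ` B)"
    using cfun_pair.linear_independent_injective_image[OF g(1) B(2) injg] .
  have "card (g ` B) = card B"
    by (intro card_image inj_on_subset[OF injg] cfun.span_superset)
  then show "cfun.dim (T ` V) = cfun.dim V"
    unfolding im sp using cfun.dim_span_eq_card_independent[OF ind] B(4) by simp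
qed

text \<open>\<open>V\<close> is recovered from its image by the inverse of \<open>T\<close>. The
  finiteness of spaces of intertwiners and the comparison of two such spaces rest on this.\<close>

lemma fin_dim_inj:
  assumes "cfun.subspace V" "linear_on V T" "inj_on T V" "T ` V \<subseteq> W" "fin_dim W"
  shows "fin_dim V" and "cfun.dim V \<le> cfun.dim W"
proof -
  have s: "cfun.subspace (T ` V)" using linear_on_subspace_image[OF assms(2,1)] .
  have f: "fin_dim (T ` V)" and d: "cfun.dim (T ` V) \<le> cfun.dim W"
    using fin_dim_subset[OF s assms(4,5)] by auto
  have b: "bij_betw T V (T ` V)" using assms(3) by (simp add: bij_betw_def)
  have "inv_into V T ` T ` V = V" using assms(3) by (simp add: inv_into_image_cancel)
  then show fV: "fin_dim V"
    using fin_dim_image(1)[OF f linear_on_inv_into[OF assms(2,1) b]] by simp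
  show "cfun.dim V \<le> cfun.dim W" using fin_dim_image(2)[OF fV assms(2,3)] d by simp
qed

lemma dim_bij:
  assumes "fin_dim V" "linear_on V T" "bij_betw T V W"
  shows "cfun.dim V = cfun.dim W"
  using fin_dim_image(2)[OF assms(1,2)] assms(3) by (simp add: bij_betw_def)

definition internal_sum :: "('x \<Rightarrow> complex) set \<Rightarrow> ('x \<Rightarrow> complex) set \<Rightarrow> ('x \<Rightarrow> complex) set \<Rightarrow> bool"
  where "internal_sum V A B \<longleftrightarrow> A \<inter> B = {0} \<and> V = {a + b | a b. a \<in> A \<and> b \<in> B}"

text \<open>The union of a basis of \<open>A\<close> and a basis of \<open>B\<close> is a basis of
  \<open>V\<close>: in a vanishing combination the part from \<open>A\<close> lies in
  \<open>A \<inter> B\<close> and hence vanishes.\<close>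

lemma internal_sum_dim:
  assumes "internal_sum V A B" "fin_dim A" "fin_dim B"
  shows "cfun.dim V = cfun.dim A + cfun.dim B"
proof -
  obtain S where S: "finite S" "cfun.independent S" "cfun.span S = A" "card S = cfun.dim A" "S \<subseteq> A"
    by (rule fin_dim_basis[OF assms(2)])
  obtain R where R: "finite R" "cfun.independent R" "cfun.span R = B" "card R = cfun.dim B" "R \<subseteq> B"
    by (rule fin_dim_basis[OF assms(3)])
  have AB: "A \<inter> B = {0}" "V = {a + b | a b. a \<in> A \<and> b \<in> B}"
    using assms(1) by (auto simp: internal_sum_def)
  have "cfun.span (S \<union> R) = V"
    using AB(2) S(3) R(3) by (simp add: cfun.span_Un)
  moreover have disj: "S \<inter> R = {}"
  proof -
    have "S \<inter> R \<subseteq> {0}" using S(5) R(5) AB(1) by blast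
    moreover have "0 \<notin> S" using S(2) cfun.dependent_zero by blast
    ultimately show ?thesis by blast
  qed
  moreover have "cfun.independent (S \<union> R)"
  proof (subst cfun.independent_explicit_finite_subsets, intro allI impI ballI)
    fix T u v assume T: "T \<subseteq> S \<union> R" "finite T" and z: "(\<Sum>w\<in>T. cscale (u w) w) = 0" and v: "v \<in> T"
    have TT: "T = (T \<inter> S) \<union> (T \<inter> R)" using T(1) by blast
    let ?a = "\<Sum>w\<in>T \<inter> S. cscale (u w) w" and ?b = "\<Sum>w\<in>T \<inter> R. cscale (u w) w"
    have "(\<Sum>w\<in>T. cscale (u w) w) = ?a + ?b"
      by (subst TT, rule sum.union_disjoint) (use T(2) disj in auto)
    then have ab: "?a = - ?b" using z by (simp add: eq_neg_iff_add_eq_0)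
    have aA: "?a \<in> A"
      using S(5) by (auto intro!: cfun.subspace_sum[OF fin_dim_subspace[OF assms(2)]] cfun.subspace_scale[OF fin_dim_subspace[OF assms(2)]])
    have bB: "?b \<in> B"
      using R(5) by (auto intro!: cfun.subspace_sum[OF fin_dim_subspace[OF assms(3)]] cfun.subspace_scale[OF fin_dim_subspace[OF assms(3)]])
    have "?a \<in> B" using bB ab cfun.subspace_neg[OF fin_dim_subspace[OF assms(3)]] by simp
    then have a0: "?a = 0" using aA AB(1) by blast
    then have b0: "?b = 0" using ab by simp
    from v T(1) have "v \<in> S \<or> v \<in> R" by blast
    then show "u v = 0"
    proof
      assume "v \<in> S"
      then show ?thesis
        using cfun.independentD[OF S(2) _ _ a0] T(2) v by blast
    next
      assume "v \<in> R"
      then show ?thesis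
        using cfun.independentD[OF R(2) _ _ b0] T(2) v by blast
    qed
  qed
  ultimately have "cfun.dim V = card (S \<union> R)"
    using cfun.dim_span_eq_card_independent by metis
  then show ?thesis using card_Un_disjoint[OF S(1) R(1) disj] S(4) R(4) by simp
qed

lemma sum_apply: "(\<Sum>i\<in>I. f i) x = (\<Sum>i\<in>I. f i x)"
  for f :: "'i \<Rightarrow> 'x \<Rightarrow> 'b::comm_monoid_add"
  by (induction I rule: infinite_finite_induct) simp_all

text \<open>The space is a product of copies of \<open>V\<close>, and \<open>e a v\<close> is
  \<open>v\<close> placed in the copy at \<open>a\<close>. It contains the induced modules, with the
  group as \<open>A\<close>, and the spaces of intertwiners restricted to a basis of the source,
  with this basis as \<open>A\<close>.\<close>

lemma fin_dim_slices:
  fixes V :: "('x \<Rightarrow> complex) set" and A :: "'a set"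
  assumes "finite A" "fin_dim V"
  shows "fin_dim {F. (\<forall>a\<in>A. (\<lambda>x. F (a, x)) \<in> V) \<and> (\<forall>a. a \<notin> A \<longrightarrow> (\<forall>x. F (a, x) = 0))}"
    (is "fin_dim ?S")
proof -
  have sV: "cfun.subspace V" using assms(2) by (simp add: fin_dim_def)
  obtain B where B: "finite B" "cfun.span B = V" using assms(2) by (auto simp: fin_dim_def)
  define e :: "'a \<Rightarrow> ('x \<Rightarrow> complex) \<Rightarrow> 'a \<times> 'x \<Rightarrow> complex"
    where "e a v = (\<lambda>(a', x). if a' = a then v x else 0)" for a v
  have sub: "cfun.subspace ?S"
    using cfun.subspace_0[OF sV] cfun.subspace_add[OF sV] cfun.subspace_scale[OF sV]
    by (auto simp: cfun.subspace_def cscale_def zero_fun_def plus_fun_def)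
  have in_span: "e a v \<in> cfun.span (\<Union>a\<in>A. e a ` B)" if "a \<in> A" "v \<in> V" for a v
  proof -
    have lin: "linear_on UNIV (e a)"
      by (auto simp: linear_on_def e_def cscale_def plus_fun_def fun_eq_iff)
    have "cfun.span B \<subseteq> {v. e a v \<in> cfun.span (\<Union>a\<in>A. e a ` B)}"
    proof (rule cfun.span_minimal)
      show "B \<subseteq> {v. e a v \<in> cfun.span (\<Union>a\<in>A. e a ` B)}"
        using that(1) by (auto intro!: cfun.span_base)
      show "cfun.subspace {v. e a v \<in> cfun.span (\<Union>a\<in>A. e a ` B)}"
        using linear_on_zero[OF lin cfun.subspace_UNIV] linear_on_add[OF lin] linear_on_scale[OF lin]
        by (auto simp: cfun.subspace_def intro: cfun.span_add cfun.span_scale cfun.span_zero)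
    qed
    then show ?thesis using that(2) B(2) by blast
  qed
  have "cfun.span (\<Union>a\<in>A. e a ` B) = ?S"
  proof
    have "e a b \<in> ?S" if "a \<in> A" "b \<in> B" for a b
    proof -
      have "b \<in> V" using that B(2) cfun.span_base by blast
      moreover have "(\<lambda>x. 0) \<in> V" using cfun.subspace_0[OF sV] by (simp add: zero_fun_def)
      moreover have "(\<lambda>x. e a b (a', x)) = (if a' = a then b else (\<lambda>x. 0))" for a'
        by (simp add: e_def)
      ultimately show ?thesis using that(1) by (auto simp: e_def)
    qed
    then show "cfun.span (\<Union>a\<in>A. e a ` B) \<subseteq> ?S"
      by (intro cfun.span_minimal sub) blast
    show "?S \<subseteq> cfun.span (\<Union>a\<in>A. e a ` B)"
    proof
      fix F assume F: "F \<in> ?S"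
      have "F = (\<Sum>a\<in>A. e a (\<lambda>x. F (a, x)))"
      proof (rule ext, clarify)
        fix a x
        have "(\<Sum>a\<in>A. e a (\<lambda>x. F (a, x))) (a, x) = (\<Sum>a'\<in>A. if a = a' then F (a', x) else 0)"
          by (simp add: e_def sum_apply)
        also have "\<dots> = F (a, x)" using F assms(1) by simp
        finally show "F (a, x) = (\<Sum>a\<in>A. e a (\<lambda>x. F (a, x))) (a, x)" by simp
      qed
      moreover have "\<dots> \<in> cfun.span (\<Union>a\<in>A. e a ` B)"
        by (rule cfun.span_sum, rule in_span) (use F in auto)
      ultimately show "F \<in> cfun.span (\<Union>a\<in>A. e a ` B)" by simp
    qed
  qed
  moreover have "finite (\<Union>a\<in>A. e a ` B)" using assms(1) B(1) by blast
  ultimately show ?thesis unfolding fin_dim_def using sub by blast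
qed

section \<open>Representations of finite groups\<close>

lemma representation_alt:
  "representation G R \<longleftrightarrow> group G \<and> fin_dim (space R) \<and>
    (\<forall>g\<in>carrier G. act R g ` space R \<subseteq> space R \<and> linear_on (space R) (act R g)) \<and>
    (\<forall>v\<in>space R. act R \<one>\<^bsub>G\<^esub> v = v) \<and>
    (\<forall>g\<in>carrier G. \<forall>h\<in>carrier G. \<forall>v\<in>space R. act R (g \<otimes>\<^bsub>G\<^esub> h) v = act R g (act R h v))"
  unfolding representation_def fin_dim_def by blast

lemma rep_fin_dim: "representation G R \<Longrightarrow> fin_dim (space R)"
  and rep_group: "representation G R \<Longrightarrow> group G"
  and rep_subspace: "representation G R \<Longrightarrow> cfun.subspace (space R)"
  and rep_closed: "representation G R \<Longrightarrow> g \<in> carrier G \<Longrightarrow> v \<in> space R \<Longrightarrow> act R g v \<in> space R"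
  and rep_linear: "representation G R \<Longrightarrow> g \<in> carrier G \<Longrightarrow> linear_on (space R) (act R g)"
  and rep_one: "representation G R \<Longrightarrow> v \<in> space R \<Longrightarrow> act R \<one>\<^bsub>G\<^esub> v = v"
  and rep_mult: "representation G R \<Longrightarrow> g \<in> carrier G \<Longrightarrow> h \<in> carrier G \<Longrightarrow> v \<in> space R \<Longrightarrow>
    act R (g \<otimes>\<^bsub>G\<^esub> h) v = act R g (act R h v)"
  by (auto simp: representation_alt fin_dim_def)

lemma rep_inv:
  assumes "representation G R" "g \<in> carrier G" "v \<in> space R"
  shows "act R (inv\<^bsub>G\<^esub> g) (act R g v) = v" and "act R g (act R (inv\<^bsub>G\<^esub> g) v) = v"
proof -
  interpret group G using rep_group[OF assms(1)] .
  show "act R (inv\<^bsub>G\<^esub> g) (act R g v) = v"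
    using rep_mult[OF assms(1) inv_closed[OF assms(2)] assms(2,3)] rep_one[OF assms(1,3)] assms(2) by simp
  show "act R g (act R (inv\<^bsub>G\<^esub> g) v) = v"
    using rep_mult[OF assms(1,2) inv_closed[OF assms(2)] assms(3)] rep_one[OF assms(1,3)] assms(2) by simp
qed

lemma subrep_simps [simp]:
  "space (subrep R U) = U" "act (subrep R U) = act R" "subrep (subrep R U) W = subrep R W"
  "subrep R (space R) = R"
  by (simp_all add: subrep_def)

lemma invariant_subspaceD:
  assumes "invariant_subspace G R U"
  shows "cfun.subspace U" "U \<subseteq> space R" "g \<in> carrier G \<Longrightarrow> u \<in> U \<Longrightarrow> act R g u \<in> U"
  using assms by (auto simp: invariant_subspace_def)

lemma invariant_subspace_space: "representation G R \<Longrightarrow> invariant_subspace G R (space R)"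
  by (auto simp: invariant_subspace_def representation_alt fin_dim_def)

lemma invariant_subspace_zero:
  assumes "representation G R"
  shows "invariant_subspace G R {0}"
  unfolding invariant_subspace_def
  using cfun.subspace_single_0 cfun.subspace_0[OF rep_subspace[OF assms]]
    linear_on_zero[OF rep_linear[OF assms] rep_subspace[OF assms]]
  by auto

lemma invariant_subspace_subrep:
  assumes "invariant_subspace G R U"
  shows "invariant_subspace G (subrep R U) W \<longleftrightarrow> invariant_subspace G R W \<and> W \<subseteq> U"
  using assms by (auto simp: invariant_subspace_def)

lemma representation_subrep:
  assumes "representation G R" "invariant_subspace G R U"
  shows "representation G (subrep R U)"
proof -
  note U = invariant_subspaceD[OF assms(2)]
  have "linear_on U (act R g)" if "g \<in> carrier G" for g
    using linear_on_subset[OF rep_linear[OF assms(1) that] U(2)] .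
  then show ?thesis
    unfolding representation_alt subrep_simps
    using rep_group[OF assms(1)] fin_dim_subset(1)[OF U(1,2) rep_fin_dim[OF assms(1)]]
      U(2,3) rep_one[OF assms(1)] rep_mult[OF assms(1)] by blast
qed

section \<open>Intertwiners, isomorphism and Schur's lemma\<close>

definition intertwiner ::
    "('g, 'm) monoid_scheme \<Rightarrow> ('g, 'x) crep \<Rightarrow> ('g, 'y) crep \<Rightarrow> (('x \<Rightarrow> complex) \<Rightarrow> 'y \<Rightarrow> complex) \<Rightarrow> bool"
  where "intertwiner G R S T \<longleftrightarrow> linear_on (space R) T \<and> T ` space R \<subseteq> space S \<and>
    (\<forall>g\<in>carrier G. \<forall>v\<in>space R. T (act R g v) = act S g (T v))"

lemma intertwinerD:
  assumes "intertwiner G R S T"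
  shows "linear_on (space R) T" "v \<in> space R \<Longrightarrow> T v \<in> space S"
    "g \<in> carrier G \<Longrightarrow> v \<in> space R \<Longrightarrow> T (act R g v) = act S g (T v)"
  using assms by (auto simp: intertwiner_def)

lemma intertwiner_comp:
  assumes "intertwiner G Q R T" "intertwiner G R S T'"
  shows "intertwiner G Q S (T' \<circ> T)"
  using assms unfolding intertwiner_def linear_on_def by (auto simp: image_subset_iff)

lemma rep_iso_alt:
  "rep_iso G R S \<longleftrightarrow> representation G R \<and> representation G S \<and>
    (\<exists>T. intertwiner G R S T \<and> bij_betw T (space R) (space S))"
  unfolding rep_iso_def intertwiner_def bij_betw_def by (auto simp: equalityD1)

lemma rep_iso_refl: "representation G R \<Longrightarrow> rep_iso G R R"
  unfolding rep_iso_alt by (auto simp: intertwiner_def linear_on_def intro!: exI[of _ id])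

lemma rep_iso_sym:
  assumes "rep_iso G R S"
  shows "rep_iso G S R"
proof -
  obtain T where T: "representation G R" "representation G S" "intertwiner G R S T"
    "bij_betw T (space R) (space S)"
    using assms unfolding rep_iso_alt by blast
  define T' where "T' = inv_into (space R) T"
  have i: "T' w \<in> space R" "T (T' w) = w" if "w \<in> space S" for w
    using T(4) that by (auto simp: bij_betw_def T'_def inv_into_into f_inv_into_f)
  have j: "T' (T v) = v" if "v \<in> space R" for v
    using T(4) that by (auto simp: bij_betw_def T'_def)
  have "T' (act S g w) = act R g (T' w)" if "g \<in> carrier G" "w \<in> space S" for g w
    using j[OF rep_closed[OF T(1) that(1) i(1)[OF that(2)]]] intertwinerD(3)[OF T(3) that(1) i(1)[OF that(2)]]
      i(2)[OF that(2)] by simp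
  then have "intertwiner G S R T'"
    unfolding intertwiner_def
    using linear_on_inv_into[OF intertwinerD(1)[OF T(3)] rep_subspace[OF T(1)] T(4)] i
    by (auto simp: T'_def)
  moreover have "bij_betw T' (space S) (space R)"
    unfolding T'_def by (rule bij_betw_inv_into[OF T(4)])
  ultimately show ?thesis unfolding rep_iso_alt using T(1,2) by blast
qed

lemma rep_iso_trans:
  assumes "rep_iso G Q R" "rep_iso G R S"
  shows "rep_iso G Q S"
proof -
  obtain T T' where "intertwiner G Q R T" "bij_betw T (space Q) (space R)"
    "intertwiner G R S T'" "bij_betw T' (space R) (space S)"
    using assms unfolding rep_iso_alt by blast
  then have "intertwiner G Q S (T' \<circ> T)" "bij_betw (T' \<circ> T) (space Q) (space S)"
    by (auto intro: intertwiner_comp bij_betw_trans)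
  then show ?thesis using assms unfolding rep_iso_alt by blast
qed

lemma intertwiner_image_invariant:
  assumes "representation G R" "intertwiner G R S T"
  shows "invariant_subspace G S (T ` space R)"
  using linear_on_subspace_image[OF intertwinerD(1)[OF assms(2)] rep_subspace[OF assms(1)]]
    intertwinerD(2,3)[OF assms(2)] rep_closed[OF assms(1)]
  unfolding invariant_subspace_def by (auto simp flip: intertwinerD(3)[OF assms(2)])

lemma intertwiner_kernel_invariant:
  assumes "representation G R" "representation G S" "intertwiner G R S T"
  shows "invariant_subspace G R {v \<in> space R. T v = 0}"
  using linear_on_kernel[OF intertwinerD(1)[OF assms(3)] rep_subspace[OF assms(1)]]
    rep_closed[OF assms(1)] intertwinerD(3)[OF assms(3)]
    linear_on_zero[OF rep_linear[OF assms(2)] rep_subspace[OF assms(2)]]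
  unfolding invariant_subspace_def by auto

text \<open>Kernel and image of an intertwiner are invariant, so a nonzero one between irreducibles
  is bijective. That the endomorphisms of \<open>sigma D\<close> form a line is a separate matter,
  settled in \<open>hom_dim_sigma\<close>.\<close>

lemma schur:
  assumes "irreducible_rep G R" "irreducible_rep G S" "intertwiner G R S T" "v \<in> space R" "T v \<noteq> 0"
  shows "rep_iso G R S"
proof -
  have R: "representation G R" and S: "representation G S"
    using assms(1,2) by (auto simp: irreducible_rep_def)
  have "{v \<in> space R. T v = 0} = {0}"
    using assms(1,4,5) intertwiner_kernel_invariant[OF R S assms(3)]
    unfolding irreducible_rep_def by blast
  then have "inj_on T (space R)"
    using linear_on_inj_iff[OF intertwinerD(1)[OF assms(3)] rep_subspace[OF R]] by blast
  moreover have "T ` space R = space S"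
    using assms(2,4,5) intertwiner_image_invariant[OF R assms(3)]
    unfolding irreducible_rep_def by blast
  ultimately show ?thesis using R S assms(3) by (auto simp: rep_iso_alt bij_betw_def)
qed

subsection \<open>Complete reducibility\<close>

lemma internal_sum_decompose:
  assumes "internal_sum V A B" "cfun.subspace A" "cfun.subspace B"
  shows "A \<subseteq> V" "B \<subseteq> V" "v \<in> V \<Longrightarrow> \<exists>a\<in>A. \<exists>b\<in>B. v = a + b"
    "a \<in> A \<Longrightarrow> a' \<in> A \<Longrightarrow> b \<in> B \<Longrightarrow> b' \<in> B \<Longrightarrow> a + b = a' + b' \<Longrightarrow> a = a' \<and> b = b'"
proof -
  have V: "V = {a + b | a b. a \<in> A \<and> b \<in> B}" and AB: "A \<inter> B = {0}"
    using assms(1) by (auto simp: internal_sum_def)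
  show "A \<subseteq> V"
  proof
    fix a assume "a \<in> A"
    then show "a \<in> V" unfolding V using cfun.subspace_0[OF assms(3)] add_0_right[of a] by (metis (mono_tags, lifting) mem_Collect_eq)
  qed
  show "B \<subseteq> V"
  proof
    fix b assume "b \<in> B"
    then show "b \<in> V" unfolding V using cfun.subspace_0[OF assms(2)] add_0_left[of b] by (metis (mono_tags, lifting) mem_Collect_eq)
  qed
  show "v \<in> V \<Longrightarrow> \<exists>a\<in>A. \<exists>b\<in>B. v = a + b" unfolding V by blast
  assume *: "a \<in> A" "a' \<in> A" "b \<in> B" "b' \<in> B" "a + b = a' + b'"
  then have "a - a' = b' - b" by (metis add_diff_cancel_left' add_diff_eq diff_add_cancel diff_diff_eq2)
  moreover have "a - a' \<in> A" "b' - b \<in> B"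
    using * cfun.subspace_diff assms(2,3) by blast+
  ultimately have "a - a' = 0" "b' - b = 0" using AB by (metis IntI singletonD)+
  then show "a = a' \<and> b = b'" by simp
qed

text \<open>\<open>construct\<close> fixes a basis of \<open>U\<close> and takes values in its span.
  The projection is defined on all functions, so it can be averaged over a group without tracking
  its domain.\<close>

lemma projection_exists:
  assumes "cfun.subspace V" "cfun.subspace U" "U \<subseteq> V"
  shows "\<exists>P. Vector_Spaces.linear cscale cscale P \<and> (\<forall>v. P v \<in> U) \<and> (\<forall>u\<in>U. P u = u)"
proof -
  obtain B where B: "B \<subseteq> U" "cfun.independent B" "U \<subseteq> cfun.span B" "card B = cfun.dim U"
    by (rule cfun.basis_exists[of U])
  define P where "P = cfun_pair.construct B (\<lambda>b. b)"
  have lin: "Vector_Spaces.linear cscale cscale P"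
    unfolding P_def by (rule cfun_pair.linear_construct[OF B(2)])
  have r: "P v \<in> U" for v
  proof -
    have "P v \<in> cfun.span ((\<lambda>b. b) ` B)"
      unfolding P_def by (rule cfun_pair.construct_in_span[OF B(2)])
    then show ?thesis using cfun.span_minimal[OF B(1) assms(2)] by auto
  qed
  have "P u = u" if "u \<in> U" for u
  proof -
    have "cfun.span B \<subseteq> {u. P u = u}"
    proof (rule cfun.span_minimal)
      show "B \<subseteq> {u. P u = u}"
        unfolding P_def using cfun_pair.construct_basis[OF B(2)] by auto
      show "cfun.subspace {u. P u = u}"
        unfolding cfun.subspace_def
        using cfun_pair.linear_0[OF lin] cfun_pair.linear_add[OF lin] cfun_pair.linear_scale[OF lin] by auto
    qed
    then show ?thesis using that B(3) by blast
  qed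
  then show ?thesis using lin r by blast
qed

lemma group_sum_translate:
  fixes f :: "'g \<Rightarrow> 'b::comm_monoid_add"
  assumes "group G" "a \<in> carrier G"
  shows "(\<Sum>g\<in>carrier G. f (a \<otimes>\<^bsub>G\<^esub> g)) = (\<Sum>g\<in>carrier G. f g)"
    and "(\<Sum>g\<in>carrier G. f (g \<otimes>\<^bsub>G\<^esub> a)) = (\<Sum>g\<in>carrier G. f g)"
proof -
  interpret group G by fact
  show "(\<Sum>g\<in>carrier G. f (a \<otimes>\<^bsub>G\<^esub> g)) = (\<Sum>g\<in>carrier G. f g)"
    by (rule sum.reindex_bij_witness[where i = "\<lambda>g. inv\<^bsub>G\<^esub> a \<otimes>\<^bsub>G\<^esub> g" and j = "\<lambda>g. a \<otimes>\<^bsub>G\<^esub> g"])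
      (use assms(2) in \<open>auto simp flip: m_assoc\<close>)
  show "(\<Sum>g\<in>carrier G. f (g \<otimes>\<^bsub>G\<^esub> a)) = (\<Sum>g\<in>carrier G. f g)"
    by (rule sum.reindex_bij_witness[where i = "\<lambda>g. g \<otimes>\<^bsub>G\<^esub> inv\<^bsub>G\<^esub> a" and j = "\<lambda>g. g \<otimes>\<^bsub>G\<^esub> a"])
      (use assms(2) in \<open>auto simp: m_assoc\<close>)
qed

text \<open>The average of the conjugates of a linear projection onto \<open>U\<close> is an
  equivariant projection, and its kernel in \<open>V\<close> is the complement. The ambient
  \<open>V\<close> is an arbitrary invariant subspace because decompositions are built by descending
  into complements.\<close>

theorem maschke:
  assumes "finite (carrier G)" "representation G R" "invariant_subspace G R V"
    "invariant_subspace G R U" "U \<subseteq> V"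
  shows "\<exists>U'. invariant_subspace G R U' \<and> internal_sum V U U'"
proof -
  interpret group G using rep_group[OF assms(2)] .
  note VD = invariant_subspaceD[OF assms(3)] and UD = invariant_subspaceD[OF assms(4)]
  obtain P0 where P0: "Vector_Spaces.linear cscale cscale P0" "\<And>v. P0 v \<in> U" "\<And>u. u \<in> U \<Longrightarrow> P0 u = u"
    using projection_exists[OF VD(1) UD(1) assms(5)] by metis
  define P where "P v = cscale (1 / of_nat (card (carrier G)))
    (\<Sum>g\<in>carrier G. act R g (P0 (act R (inv\<^bsub>G\<^esub> g) v)))" for v
  note subR = rep_subspace[OF assms(2)]
  have actU: "act R g u \<in> U" if "g \<in> carrier G" "u \<in> U" for g u using UD(3)[OF that] .
  have PU: "P v \<in> U" for v
    unfolding P_def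
    by (intro cfun.subspace_scale[OF UD(1)] cfun.subspace_sum[OF UD(1)] actU P0(2))
  have card: "(of_nat (card (carrier G)) :: complex) \<noteq> 0" using assms(1) one_closed by auto
  have Pid: "P u = u" if "u \<in> U" for u
  proof -
    have "act R g (P0 (act R (inv\<^bsub>G\<^esub> g) u)) = u" if "g \<in> carrier G" for g
      using P0(3)[OF actU[OF inv_closed[OF that] \<open>u \<in> U\<close>]] rep_inv(2)[OF assms(2) that] UD(2) \<open>u \<in> U\<close> by auto
    then have "P u = cscale (1 / of_nat (card (carrier G))) (\<Sum>g\<in>carrier G. u)" unfolding P_def by simp
    also have "\<dots> = u" using card by (simp add: cscale_def fun_eq_iff sum_apply)
    finally show ?thesis .
  qed
  have lin_term: "linear_on (space R) (\<lambda>v. act R g (P0 (act R (inv\<^bsub>G\<^esub> g) v)))" if g: "g \<in> carrier G" for g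
    unfolding linear_on_def
  proof (intro conjI ballI allI)
    have r: "P0 v \<in> space R" for v using P0(2) UD(2) by blast
    show "act R g (P0 (act R (inv\<^bsub>G\<^esub> g) (u + v))) =
      act R g (P0 (act R (inv\<^bsub>G\<^esub> g) u)) + act R g (P0 (act R (inv\<^bsub>G\<^esub> g) v))"
      if "u \<in> space R" "v \<in> space R" for u v
      using linear_on_add[OF rep_linear[OF assms(2) inv_closed[OF g]] that] cfun_pair.linear_add[OF P0(1)]
        linear_on_add[OF rep_linear[OF assms(2) g] r r] by simp
    show "act R g (P0 (act R (inv\<^bsub>G\<^esub> g) (cscale c v))) = cscale c (act R g (P0 (act R (inv\<^bsub>G\<^esub> g) v)))"
      if "v \<in> space R" for c v
      using linear_on_scale[OF rep_linear[OF assms(2) inv_closed[OF g]] that] cfun_pair.linear_scale[OF P0(1)]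
        linear_on_scale[OF rep_linear[OF assms(2) g] r] by simp
  qed
  have lin: "linear_on (space R) P"
    unfolding linear_on_def P_def
    using linear_on_add[OF lin_term] linear_on_scale[OF lin_term]
    by (simp add: sum.distrib cfun.scale_right_distrib cfun.scale_sum_right cong: sum.cong)
  have equiv: "P (act R a v) = act R a (P v)" if a: "a \<in> carrier G" and v: "v \<in> space R" for a v
  proof -
    let ?f = "\<lambda>g. act R g (P0 (act R (inv\<^bsub>G\<^esub> g) v))"
    have f: "?f g \<in> space R" if "g \<in> carrier G" for g using actU[OF that P0(2)] UD(2) by blast
    have "act R (a \<otimes>\<^bsub>G\<^esub> g) (P0 (act R (inv\<^bsub>G\<^esub> (a \<otimes>\<^bsub>G\<^esub> g)) (act R a v))) = act R a (?f g)"
      if g: "g \<in> carrier G" for g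
    proof -
      have r: "P0 w \<in> space R" for w using P0(2) UD(2) by blast
      have "act R (inv\<^bsub>G\<^esub> (a \<otimes>\<^bsub>G\<^esub> g)) (act R a v) = act R (inv\<^bsub>G\<^esub> g) v"
        using rep_mult[OF assms(2) inv_closed[OF g] inv_closed[OF a] rep_closed[OF assms(2) a v]]
          rep_inv(1)[OF assms(2) a v] a g by (simp add: inv_mult_group)
      then show ?thesis using rep_mult[OF assms(2) a g r] by simp
    qed
    \<comment> \<open>Moving \<open>a\<close> into the sum turns the summand at \<open>g\<close>
      into a summand at \<open>a\<close> times \<open>g\<close>, and translation by \<open>a\<close>
      permutes the range of summation.\<close>
    then have "(\<Sum>g\<in>carrier G. act R a (?f g)) =
      (\<Sum>g\<in>carrier G. act R (a \<otimes>\<^bsub>G\<^esub> g) (P0 (act R (inv\<^bsub>G\<^esub> (a \<otimes>\<^bsub>G\<^esub> g)) (act R a v))))"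
      by simp
    also have "\<dots> = (\<Sum>g\<in>carrier G. act R g (P0 (act R (inv\<^bsub>G\<^esub> g) (act R a v))))"
      by (rule group_sum_translate(1)[OF is_group a])
    finally have "P (act R a v) = cscale (1 / of_nat (card (carrier G))) (\<Sum>g\<in>carrier G. act R a (?f g))"
      unfolding P_def by simp
    also have "\<dots> = act R a (P v)"
      unfolding P_def
      using linear_on_sum[OF rep_linear[OF assms(2) a] subR, of "carrier G" ?f, OF f]
        linear_on_scale[OF rep_linear[OF assms(2) a] cfun.subspace_sum[OF subR, of "carrier G" ?f, OF f]]
      by simp
    finally show ?thesis .
  qed
  define U' where "U' = {v \<in> V. P v = 0}"
  have linV: "linear_on V P" using linear_on_subset[OF lin VD(2)] .
  have "act R g 0 = 0" if "g \<in> carrier G" for g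
    using linear_on_zero[OF rep_linear[OF assms(2) that] subR] .
  then have "invariant_subspace G R U'"
    unfolding invariant_subspace_def U'_def
    using linear_on_kernel[OF linV VD(1)] VD equiv by (auto simp: subsetD)
  moreover have "internal_sum V U U'"
    unfolding internal_sum_def
  proof
    show "U \<inter> U' = {0}"
      using Pid cfun.subspace_0[OF UD(1)] cfun.subspace_0[OF VD(1)] linear_on_zero[OF linV VD(1)]
      by (auto simp: U'_def)
    show "V = {a + b | a b. a \<in> U \<and> b \<in> U'}"
    proof (intro subset_antisym subsetI)
      fix v assume v: "v \<in> V"
      have PV: "P v \<in> V" using PU assms(5) by blast
      have "P (v - P v) = 0" using linear_on_diff[OF linV VD(1) v PV] Pid[OF PU] by simp
      then have "v - P v \<in> U'" using cfun.subspace_diff[OF VD(1) v PV] by (simp add: U'_def)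
      then show "v \<in> {a + b | a b. a \<in> U \<and> b \<in> U'}" using PU[of v] by force
    next
      fix v assume "v \<in> {a + b | a b. a \<in> U \<and> b \<in> U'}"
      then show "v \<in> V" using assms(5) cfun.subspace_add[OF VD(1)] by (auto simp: U'_def)
    qed
  qed
  ultimately show ?thesis by blast
qed

text \<open>Takes the place of a character: a number attached to submodules that adds up over direct
  sums. Its instances are dimensions of spaces of intertwiners to or from a fixed module, also after
  inducing the submodule, so a single statement about decompositions serves all of them.\<close>

definition additive :: "('g, 'm) monoid_scheme \<Rightarrow> ('g, 'x) crep \<Rightarrow> (('x \<Rightarrow> complex) set \<Rightarrow> nat) \<Rightarrow> bool"
  where "additive G R \<phi> \<longleftrightarrow> (\<forall>V A B. invariant_subspace G R V \<longrightarrow> invariant_subspace G R A \<longrightarrow>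
    invariant_subspace G R B \<longrightarrow> internal_sum V A B \<longrightarrow> \<phi> V = \<phi> A + \<phi> B)"

text \<open>The last clause carries the summation of every additive number through the inductive
  construction. The summands form a set of subspaces; isomorphic copies are still different
  subspaces, so multiplicities are cardinalities of subsets of \<open>\<W>\<close>.\<close>

definition irreducible_decomposition ::
    "('g, 'm) monoid_scheme \<Rightarrow> ('g, 'x) crep \<Rightarrow> ('x \<Rightarrow> complex) set \<Rightarrow> ('x \<Rightarrow> complex) set set \<Rightarrow> bool"
  where "irreducible_decomposition G R V \<W> \<longleftrightarrow> finite \<W> \<and>
    (\<forall>U\<in>\<W>. invariant_subspace G R U \<and> U \<subseteq> V \<and> irreducible_rep G (subrep R U)) \<and>
    (\<forall>v\<in>V. \<exists>f. (\<forall>U\<in>\<W>. f U \<in> U) \<and> v = (\<Sum>U\<in>\<W>. f U)) \<and>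
    (\<forall>f. (\<forall>U\<in>\<W>. f U \<in> U) \<and> (\<Sum>U\<in>\<W>. f U) = 0 \<longrightarrow> (\<forall>U\<in>\<W>. f U = 0)) \<and>
    (\<forall>\<phi>. additive G R \<phi> \<longrightarrow> \<phi> V = (\<Sum>U\<in>\<W>. \<phi> U))"

text \<open>A nonzero invariant subspace of least dimension inside \<open>V\<close> has no smaller
  ones within it.\<close>

lemma irreducible_subrep_exists:
  assumes "representation G R" "invariant_subspace G R V" "V \<noteq> {0}"
  shows "\<exists>U. invariant_subspace G R U \<and> U \<subseteq> V \<and> irreducible_rep G (subrep R U)"
proof -
  define P where "P U \<longleftrightarrow> invariant_subspace G R U \<and> U \<subseteq> V \<and> U \<noteq> {0}" for U
  have "P V" using assms by (simp add: P_def)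
  then obtain U where U: "P U" "\<And>W. P W \<Longrightarrow> cfun.dim U \<le> cfun.dim W"
    using exists_least_iff[of "\<lambda>d. \<exists>U. P U \<and> cfun.dim U = d"] by (metis linorder_not_less)
  have inv: "invariant_subspace G R U" and UV: "U \<subseteq> V" and ne: "U \<noteq> {0}" using U(1) by (auto simp: P_def)
  have fU: "fin_dim U" using rep_fin_dim[OF representation_subrep[OF assms(1) inv]] by simp
  have "W = {0} \<or> W = U" if W: "invariant_subspace G (subrep R U) W" for W
  proof (rule ccontr)
    assume *: "\<not> (W = {0} \<or> W = U)"
    have W': "invariant_subspace G R W" "W \<subseteq> U"
      using W invariant_subspace_subrep[OF inv] by blast+
    then have "P W" using * UV by (auto simp: P_def)
    then have "cfun.dim W = cfun.dim U"
      using U(2) fin_dim_subset(2)[OF invariant_subspaceD(1)[OF W'(1)] W'(2) fU] by (simp add: le_antisym)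
    then show False using dim_eq_subset[OF invariant_subspaceD(1)[OF W'(1)] W'(2) fU] * by blast
  qed
  then have "irreducible_rep G (subrep R U)"
    using representation_subrep[OF assms(1) inv] ne by (auto simp: irreducible_rep_def)
  then show ?thesis using inv UV by blast
qed

theorem irreducible_decomposition_exists:
  fixes R :: "('g, 'x) crep"
  assumes "finite (carrier G)" "representation G R" "invariant_subspace G R V"
  shows "\<exists>\<W>. irreducible_decomposition G R V \<W>"
  using assms(3)
proof (induction "cfun.dim V" arbitrary: V rule: less_induct)
  case less
  note VD = invariant_subspaceD[OF less.prems]
  show ?case
  proof (cases "V = {0}")
    case True
    \<comment> \<open>The zero space is the direct sum of itself with itself, which forces the value
      zero.\<close>
    have "\<phi> {0} = 0" if "additive G R \<phi>" for \<phi>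
    proof -
      have "internal_sum {0} {0} {0 :: 'x \<Rightarrow> complex}" by (auto simp: internal_sum_def)
      then have "\<phi> {0} = \<phi> {0} + \<phi> {0}"
        using that invariant_subspace_zero[OF assms(2)] unfolding additive_def by blast
      then show ?thesis by simp
    qed
    then have "irreducible_decomposition G R V {}"
      using True by (auto simp: irreducible_decomposition_def)
    then show ?thesis by blast
  next
    case False
    obtain U where U: "invariant_subspace G R U" "U \<subseteq> V" "irreducible_rep G (subrep R U)"
      using irreducible_subrep_exists[OF assms(2) less.prems False] by blast
    obtain U' where U': "invariant_subspace G R U'" "internal_sum V U U'"
      using maschke[OF assms(1,2) less.prems U(1,2)] by blast
    note UD = invariant_subspaceD[OF U(1)] and UD' = invariant_subspaceD[OF U'(1)]
    note dec = internal_sum_decompose[OF U'(2) UD(1) UD'(1)]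
    have fd: "fin_dim U" "fin_dim U'"
      using rep_fin_dim[OF representation_subrep[OF assms(2) U(1)]]
        rep_fin_dim[OF representation_subrep[OF assms(2) U'(1)]] by simp_all
    have U0: "U \<noteq> {0}" using U(3) by (simp add: irreducible_rep_def)
    then have "cfun.dim U \<noteq> 0" using dim_zero_iff[OF fd(1)] by simp
    then have "cfun.dim U' < cfun.dim V" using internal_sum_dim[OF U'(2) fd] by simp
    then obtain \<W> where W: "irreducible_decomposition G R U' \<W>" using less.hyps U'(1) by blast
    have fW: "finite \<W>" and
      W1: "\<And>X. X \<in> \<W> \<Longrightarrow> invariant_subspace G R X \<and> X \<subseteq> U' \<and> irreducible_rep G (subrep R X)" and
      W2: "\<And>v. v \<in> U' \<Longrightarrow> \<exists>f. (\<forall>X\<in>\<W>. f X \<in> X) \<and> v = (\<Sum>X\<in>\<W>. f X)" and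
      W3: "\<And>f. (\<forall>X\<in>\<W>. f X \<in> X) \<Longrightarrow> (\<Sum>X\<in>\<W>. f X) = 0 \<Longrightarrow> \<forall>X\<in>\<W>. f X = 0" and
      W4: "\<And>\<phi>. additive G R \<phi> \<Longrightarrow> \<phi> U' = (\<Sum>X\<in>\<W>. \<phi> X)"
      using W unfolding irreducible_decomposition_def by blast+
    \<comment> \<open>Sums run over the set of summands, so \<open>U\<close> has to be a new member;
      otherwise it would lie in its own complement.\<close>
    have UW: "U \<notin> \<W>"
    proof
      assume "U \<in> \<W>"
      then have "U \<subseteq> U'" using W1 by blast
      then have "U = {0}" using U'(2) by (auto simp: internal_sum_def)
      then show False using U0 by blast
    qed
    have "irreducible_decomposition G R V (insert U \<W>)"
      unfolding irreducible_decomposition_def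
    proof (intro conjI ballI allI impI)
      show "finite (insert U \<W>)" using fW by simp
      show "invariant_subspace G R X" if "X \<in> insert U \<W>" for X using that W1 U(1) by blast
      show "X \<subseteq> V" if "X \<in> insert U \<W>" for X using that W1 U(2) dec(2) by blast
      show "irreducible_rep G (subrep R X)" if "X \<in> insert U \<W>" for X using that W1 U(3) by blast
      show "\<exists>f. (\<forall>X\<in>insert U \<W>. f X \<in> X) \<and> v = (\<Sum>X\<in>insert U \<W>. f X)" if v: "v \<in> V" for v
      proof -
        obtain a b where ab: "a \<in> U" "b \<in> U'" "v = a + b" using dec(3)[OF v] by blast
        obtain f where f: "\<forall>X\<in>\<W>. f X \<in> X" "b = (\<Sum>X\<in>\<W>. f X)" using W2[OF ab(2)] by blast
        have "(\<Sum>X\<in>\<W>. (f(U := a)) X) = b"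
          unfolding f(2) by (rule sum.cong) (use UW in auto)
        then have "v = (\<Sum>X\<in>insert U \<W>. (f(U := a)) X)"
          using ab(3) by (simp only: sum.insert[OF fW UW] fun_upd_same)
        then show ?thesis using f(1) ab(1) UW by (intro exI[of _ "f(U := a)"]) auto
      qed
      show "f X = 0" if f: "(\<forall>X\<in>insert U \<W>. f X \<in> X) \<and> (\<Sum>X\<in>insert U \<W>. f X) = 0" and X: "X \<in> insert U \<W>" for f X
      proof -
        have fU: "f U \<in> U" and fW': "\<forall>X\<in>\<W>. f X \<in> X" using f by auto
        have s: "(\<Sum>X\<in>\<W>. f X) \<in> U'"
          by (rule cfun.subspace_sum[OF UD'(1)]) (use fW' W1 in blast)
        have "f U + (\<Sum>X\<in>\<W>. f X) = 0 + 0" using f by (simp only: sum.insert[OF fW UW] add_0_left)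
        then have "f U = 0 \<and> (\<Sum>X\<in>\<W>. f X) = 0"
          by (rule dec(4)[OF fU cfun.subspace_0[OF UD(1)] s cfun.subspace_0[OF UD'(1)]])
        then show ?thesis using W3[OF fW'] X by blast
      qed
      show "\<phi> V = (\<Sum>X\<in>insert U \<W>. \<phi> X)" if "additive G R \<phi>" for \<phi>
      proof -
        have "\<phi> V = \<phi> U + \<phi> U'" using that less.prems U(1) U' unfolding additive_def by blast
        then show ?thesis using W4[OF that] fW UW by simp
      qed
    qed
    then show ?thesis by blast
  qed
qed

text \<open>Linearity, unit and product axioms for \<open>D\<close> are reflected along the
  injective map \<open>T\<close>, which leaves only closure of the space and equivariance of
  \<open>T\<close> to be checked. It is applied to direct sums.\<close>

lemma representation_transport:
  assumes "representation G R" "cfun.subspace (space D)"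
    "\<And>g v. g \<in> carrier G \<Longrightarrow> v \<in> space D \<Longrightarrow> act D g v \<in> space D"
    "linear_on (space D) T" "bij_betw T (space D) (space R)"
    "\<And>g v. g \<in> carrier G \<Longrightarrow> v \<in> space D \<Longrightarrow> T (act D g v) = act R g (T v)"
  shows "rep_iso G D R"
proof -
  interpret group G using rep_group[OF assms(1)] .
  have inj: "inj_on T (space D)" and im: "T ` space D = space R" using assms(5) by (auto simp: bij_betw_def)
  have Tr: "T v \<in> space R" if "v \<in> space D" for v using im that by blast
  have eqI: "u = v" if "u \<in> space D" "v \<in> space D" "T u = T v" for u v using inj that by (meson inj_onD)
  have "fin_dim (space D)" using fin_dim_inj(1)[OF assms(2,4) inj _ rep_fin_dim[OF assms(1)]] im by blast
  moreover have "linear_on (space D) (act D g)" if g: "g \<in> carrier G" for g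
    unfolding linear_on_def
  proof (intro conjI ballI allI)
    fix u v assume uv: "u \<in> space D" "v \<in> space D"
    note s = cfun.subspace_add[OF assms(2)]
    show "act D g (u + v) = act D g u + act D g v"
      by (rule eqI) (use uv g s assms(3,6) Tr linear_on_add[OF assms(4)] linear_on_add[OF rep_linear[OF assms(1) g]] in simp_all)
  next
    fix c v assume v: "v \<in> space D"
    note s = cfun.subspace_scale[OF assms(2)]
    show "act D g (cscale c v) = cscale c (act D g v)"
      by (rule eqI) (use v g s assms(3,6) Tr linear_on_scale[OF assms(4)] linear_on_scale[OF rep_linear[OF assms(1) g]] in simp_all)
  qed
  moreover have "act D \<one>\<^bsub>G\<^esub> v = v" if v: "v \<in> space D" for v
    by (rule eqI) (use v assms(3,6) rep_one[OF assms(1)] Tr in simp_all)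
  moreover have "act D (g \<otimes>\<^bsub>G\<^esub> h) v = act D g (act D h v)"
    if v: "g \<in> carrier G" "h \<in> carrier G" "v \<in> space D" for g h v
    by (rule eqI) (use v assms(3,6) rep_mult[OF assms(1)] Tr in simp_all)
  ultimately have "representation G D" unfolding representation_alt using assms(3) is_group by blast
  then show ?thesis using assms im unfolding rep_iso_def by blast
qed

text \<open>The map \<open>\<Phi>\<close> moves the slice at \<open>i\<close> into the summand
  \<open>e i\<close> and adds the results inside \<open>R\<close>. The index bijection
  \<open>e\<close> lets the same statement serve both an indexing by the summands themselves and an
  indexing by diagrams.\<close>

theorem irreducible_decomposition_direct_sum:
  fixes R :: "('g, 'x) crep" and Rs :: "'i \<Rightarrow> ('g, 'y) crep"
  assumes "representation G R" "irreducible_decomposition G R (space R) \<W>"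
    "bij_betw e I \<W>" "\<And>i. i \<in> I \<Longrightarrow> rep_iso G (Rs i) (subrep R (e i))"
  shows "rep_iso G R (direct_sum I Rs)"
proof -
  have fW: "finite \<W>" and
    W1: "\<And>X. X \<in> \<W> \<Longrightarrow> invariant_subspace G R X \<and> X \<subseteq> space R" and
    W2: "\<And>v. v \<in> space R \<Longrightarrow> \<exists>f. (\<forall>X\<in>\<W>. f X \<in> X) \<and> v = (\<Sum>X\<in>\<W>. f X)" and
    W3: "\<And>f. (\<forall>X\<in>\<W>. f X \<in> X) \<Longrightarrow> (\<Sum>X\<in>\<W>. f X) = 0 \<Longrightarrow> \<forall>X\<in>\<W>. f X = 0"
    using assms(2) unfolding irreducible_decomposition_def by blast+
  have fI: "finite I" using fW assms(3) bij_betw_finite by blast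
  have eW: "e i \<in> \<W>" if "i \<in> I" for i using assms(3) that by (auto simp: bij_betw_def)
  have "\<exists>T. intertwiner G (Rs i) (subrep R (e i)) T \<and> bij_betw T (space (Rs i)) (e i)" if "i \<in> I" for i
    using assms(4)[OF that] unfolding rep_iso_alt by auto
  then obtain T where T: "\<And>i. i \<in> I \<Longrightarrow> intertwiner G (Rs i) (subrep R (e i)) (T i)"
    "\<And>i. i \<in> I \<Longrightarrow> bij_betw (T i) (space (Rs i)) (e i)" by metis
  have rep: "representation G (Rs i)" if "i \<in> I" for i using assms(4)[OF that] by (simp add: rep_iso_def)
  let ?D = "direct_sum I Rs"
  define sl where "sl F i = (\<lambda>x. F (i, x))" for F :: "'i \<times> 'y \<Rightarrow> complex" and i
  define \<Phi> where "\<Phi> F = (\<Sum>i\<in>I. T i (sl F i))" for F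
  have D: "F \<in> space ?D \<longleftrightarrow> (\<forall>i\<in>I. sl F i \<in> space (Rs i)) \<and> (\<forall>i. i \<notin> I \<longrightarrow> sl F i = 0)" for F
    by (auto simp: direct_sum_def sl_def fun_eq_iff)
  have sl_add: "sl (F + F') i = sl F i + sl F' i" and sl_scale: "sl (cscale c F) i = cscale c (sl F i)"
    and sl0: "sl 0 i = 0" for F F' c i
    by (auto simp: sl_def cscale_def fun_eq_iff)
  have sl_ext: "F = F'" if "\<And>i. sl F i = sl F' i" for F F'
    using that by (fastforce simp: sl_def fun_eq_iff)
  have sl_act: "sl (act ?D g F) i = (if i \<in> I then act (Rs i) g (sl F i) else 0)" for g F i
    by (auto simp: sl_def direct_sum_def fun_eq_iff)
  have sub: "cfun.subspace (space ?D)"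
    unfolding cfun.subspace_def D
    using cfun.subspace_0[OF rep_subspace[OF rep]] cfun.subspace_add[OF rep_subspace[OF rep]]
      cfun.subspace_scale[OF rep_subspace[OF rep]]
    by (auto simp: sl_add sl_scale sl0 D)
  have closed: "act ?D g F \<in> space ?D" if "g \<in> carrier G" "F \<in> space ?D" for g F
    using that rep_closed[OF rep] by (simp add: D sl_act)
  have Tin: "T i (sl F i) \<in> e i" "T i (sl F i) \<in> space R" if "F \<in> space ?D" "i \<in> I" for F i
    using intertwinerD(2)[OF T(1)[OF that(2)], of "sl F i"] that W1[OF eW[OF that(2)]] by (auto simp: D)
  have lin: "linear_on (space ?D) \<Phi>"
    unfolding linear_on_def \<Phi>_def sl_add sl_scale
    using linear_on_add[OF intertwinerD(1)[OF T(1)]] linear_on_scale[OF intertwinerD(1)[OF T(1)]]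
    by (auto simp: D sum.distrib cfun.scale_sum_right intro!: sum.cong simp flip: sum.distrib)
  have equiv: "\<Phi> (act ?D g F) = act R g (\<Phi> F)" if "g \<in> carrier G" "F \<in> space ?D" for g F
  proof -
    have "\<Phi> (act ?D g F) = (\<Sum>i\<in>I. act R g (T i (sl F i)))"
      unfolding \<Phi>_def sl_act
      by (rule sum.cong) (use intertwinerD(3)[OF T(1)] that in \<open>auto simp: D\<close>)
    also have "\<dots> = act R g (\<Phi> F)"
      unfolding \<Phi>_def
      using linear_on_sum[OF rep_linear[OF assms(1) that(1)] rep_subspace[OF assms(1)],
          of I "\<lambda>i. T i (sl F i)", OF Tin(2)[OF that(2)]] by simp
    finally show ?thesis .
  qed
  have reindex: "(\<Sum>X\<in>\<W>. f X) = (\<Sum>i\<in>I. f (e i))" for f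
    using sum.reindex_bij_betw[OF assms(3), of f] by simp
  have inj: "inj_on \<Phi> (space ?D)"
  proof (subst linear_on_inj_iff[OF lin sub], intro ballI impI)
    fix F assume F: "F \<in> space ?D" "\<Phi> F = 0"
    \<comment> \<open>The independence of the summands concerns families indexed by
      \<open>\<W>\<close>, so the components are reindexed along the inverse of
      \<open>e\<close>.\<close>
    define f where "f X = T (inv_into I e X) (sl F (inv_into I e X))" for X
    have fe: "f (e i) = T i (sl F i)" if "i \<in> I" for i
      using that assms(3) by (simp add: f_def bij_betw_def)
    have "\<forall>X\<in>\<W>. f X \<in> X"
      using fe Tin(1)[OF F(1)] assms(3) by (metis bij_betw_def image_iff)
    moreover have "(\<Sum>X\<in>\<W>. f X) = 0"
      using F(2) fe unfolding \<Phi>_def reindex by simp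
    ultimately have f0: "f (e i) = 0" if "i \<in> I" for i using W3 eW[OF that] by blast
    show "F = 0"
    proof (rule sl_ext)
      fix i
      show "sl F i = sl 0 i"
      proof (cases "i \<in> I")
        case True
        have "inj_on (T i) (space (Rs i))" using T(2)[OF True] by (simp add: bij_betw_def)
        then have "sl F i = 0"
          using linear_on_inj_iff[OF intertwinerD(1)[OF T(1)[OF True]] rep_subspace[OF rep[OF True]]]
            F(1) f0[OF True] fe[OF True] True unfolding D by metis
        then show ?thesis by (simp add: sl0)
      qed (use F(1) D sl0 in auto)
    qed
  qed
  have surj: "\<Phi> ` space ?D = space R"
  proof (intro subset_antisym subsetI)
    fix v assume "v \<in> \<Phi> ` space ?D"
    then show "v \<in> space R"
      using Tin(2) by (auto simp: \<Phi>_def intro!: cfun.subspace_sum[OF rep_subspace[OF assms(1)]])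
  next
    fix v assume v: "v \<in> space R"
    obtain f where f: "\<forall>X\<in>\<W>. f X \<in> X" "v = (\<Sum>X\<in>\<W>. f X)" using W2[OF v] by blast
    define F where "F = (\<lambda>(i, x). if i \<in> I then inv_into (space (Rs i)) (T i) (f (e i)) x else 0)"
    have slF: "sl F i = (if i \<in> I then inv_into (space (Rs i)) (T i) (f (e i)) else 0)" for i
      by (auto simp: sl_def F_def)
    have im: "f (e i) \<in> T i ` space (Rs i)" if "i \<in> I" for i
      using T(2)[OF that] f(1) eW[OF that] by (simp add: bij_betw_def)
    have "F \<in> space ?D" unfolding D slF using inv_into_into[OF im] by simp
    moreover have "\<Phi> F = v"
      unfolding \<Phi>_def slF f(2) reindex using f_inv_into_f[OF im] by simp
    ultimately show "v \<in> \<Phi> ` space ?D" by blast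
  qed
  have "rep_iso G ?D R"
    by (rule representation_transport[OF assms(1) sub closed lin _ equiv]) (use inj surj in \<open>auto simp: bij_betw_def\<close>)
  then show ?thesis by (rule rep_iso_sym)
qed

subsection \<open>Dimensions of spaces of intertwiners\<close>

text \<open>Intertwiners are written uncurried, so that they form a subspace of a function space and
  \<open>cfun.dim\<close> applies to them. Vanishing outside the source makes the encoding of each
  intertwiner unique.\<close>

definition hom_space ::
    "('g, 'm) monoid_scheme \<Rightarrow> ('g, 'x) crep \<Rightarrow> ('g, 'y) crep \<Rightarrow> (('x \<Rightarrow> complex) \<times> 'y \<Rightarrow> complex) set"
  where "hom_space G R S = {F. intertwiner G R S (\<lambda>v y. F (v, y)) \<and> (\<forall>v y. v \<notin> space R \<longrightarrow> F (v, y) = 0)}"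

definition hom_dim :: "('g, 'm) monoid_scheme \<Rightarrow> ('g, 'x) crep \<Rightarrow> ('g, 'y) crep \<Rightarrow> nat"
  where "hom_dim G R S = cfun.dim (hom_space G R S)"

definition hom_of :: "('g, 'x) crep \<Rightarrow> (('x \<Rightarrow> complex) \<Rightarrow> 'y \<Rightarrow> complex) \<Rightarrow> ('x \<Rightarrow> complex) \<times> 'y \<Rightarrow> complex"
  where "hom_of R T = (\<lambda>(v, y). if v \<in> space R then T v y else 0)"

lemma hom_of_slice: "v \<in> space R \<Longrightarrow> (\<lambda>y. hom_of R T (v, y)) = T v"
  by (simp add: hom_of_def)

lemma intertwiner_cong:
  assumes "representation G R" "\<And>v. v \<in> space R \<Longrightarrow> T v = T' v" "intertwiner G R S T"
  shows "intertwiner G R S T'"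
  using assms(3) rep_closed[OF assms(1)] cfun.subspace_add[OF rep_subspace[OF assms(1)]]
    cfun.subspace_scale[OF rep_subspace[OF assms(1)]]
  unfolding intertwiner_def linear_on_def by (auto simp flip: assms(2))

lemma hom_of_hom_space:
  assumes "representation G R" "intertwiner G R S T"
  shows "hom_of R T \<in> hom_space G R S"
  unfolding hom_space_def
  using intertwiner_cong[OF assms(1) _ assms(2), of "\<lambda>v y. hom_of R T (v, y)"] hom_of_slice
  by (force simp: hom_of_def)

lemma hom_space_intertwiner: "F \<in> hom_space G R S \<Longrightarrow> intertwiner G R S (\<lambda>v y. F (v, y))"
  by (simp add: hom_space_def)

lemma hom_space_ext:
  assumes "F \<in> hom_space G R S" "F' \<in> hom_space G R S'"
    "\<And>v. v \<in> space R \<Longrightarrow> (\<lambda>y. F (v, y)) = (\<lambda>y. F' (v, y))"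
  shows "F = F'"
proof (rule ext, clarify)
  fix v y
  show "F (v, y) = F' (v, y)"
  proof (cases "v \<in> space R")
    case True
    then show ?thesis using assms(3) by meson
  qed (use assms(1,2) in \<open>simp add: hom_space_def\<close>)
qed

lemma hom_space_subspace:
  assumes "representation G R" "representation G S"
  shows "cfun.subspace (hom_space G R S)"
proof -
  note ss = cfun.subspace_add[OF rep_subspace[OF assms(2)]] cfun.subspace_scale[OF rep_subspace[OF assms(2)]]
    cfun.subspace_0[OF rep_subspace[OF assms(2)]]
  have lin: "linear_on (space S) (act S g)" if "g \<in> carrier G" for g using rep_linear[OF assms(2) that] .
  have z: "intertwiner G R S (\<lambda>v y. (0 :: _ \<Rightarrow> complex) (v, y))"
    using ss(3) linear_on_zero[OF lin rep_subspace[OF assms(2)]]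
    by (auto simp: intertwiner_def linear_on_def cscale_def zero_fun_def fun_eq_iff)
  have a: "intertwiner G R S (\<lambda>v y. (F + F') (v, y))"
    if F: "intertwiner G R S (\<lambda>v y. F (v, y))" "intertwiner G R S (\<lambda>v y. F' (v, y))" for F F'
  proof -
    define T T' where "T = (\<lambda>v y. F (v, y))" and "T' = (\<lambda>v y. F' (v, y))"
    have T: "intertwiner G R S T" "intertwiner G R S T'" using F by (simp_all add: T_def T'_def)
    have "(\<lambda>v y. (F + F') (v, y)) = (\<lambda>v. T v + T' v)" by (simp add: T_def T'_def fun_eq_iff)
    moreover have "intertwiner G R S (\<lambda>v. T v + T' v)"
      unfolding intertwiner_def linear_on_def
      using intertwinerD(2,3)[OF T(1)] intertwinerD(2,3)[OF T(2)] ss(1)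
        linear_on_add[OF intertwinerD(1)[OF T(1)]] linear_on_add[OF intertwinerD(1)[OF T(2)]]
        linear_on_scale[OF intertwinerD(1)[OF T(1)]] linear_on_scale[OF intertwinerD(1)[OF T(2)]]
        linear_on_add[OF lin]
      by (auto simp: cfun.scale_right_distrib algebra_simps)
    ultimately show ?thesis by simp
  qed
  have s: "intertwiner G R S (\<lambda>v y. (cscale c F) (v, y))"
    if F: "intertwiner G R S (\<lambda>v y. F (v, y))" for c F
  proof -
    define T where "T = (\<lambda>v y. F (v, y))"
    have T: "intertwiner G R S T" using F by (simp add: T_def)
    have "(\<lambda>v y. (cscale c F) (v, y)) = (\<lambda>v. cscale c (T v))" by (auto simp: T_def cscale_def)
    moreover have "intertwiner G R S (\<lambda>v. cscale c (T v))"
      unfolding intertwiner_def linear_on_def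
      using intertwinerD(2,3)[OF T] ss(2)
        linear_on_add[OF intertwinerD(1)[OF T]] linear_on_scale[OF intertwinerD(1)[OF T]]
        linear_on_scale[OF lin]
      by (auto simp: cfun.scale_right_distrib mult.commute)
    ultimately show ?thesis by simp
  qed
  show ?thesis
    unfolding cfun.subspace_def
    using z a s by (auto simp: hom_space_def cscale_def)
qed

text \<open>Restriction to a finite basis \<open>B\<close> of the source is injective on
  intertwiners and lands in finitely many copies of the target.\<close>

lemma hom_space_fin_dim:
  fixes R :: "('g, 'x) crep" and S :: "('g, 'y) crep"
  assumes "representation G R" "representation G S"
  shows "fin_dim (hom_space G R S)"
proof -
  obtain B where B: "finite B" "cfun.independent B" "cfun.span B = space R" "card B = cfun.dim (space R)" "B \<subseteq> space R"
    by (rule fin_dim_basis[OF rep_fin_dim[OF assms(1)]])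
  define \<rho> where "\<rho> F = (\<lambda>(v, y). if v \<in> B then F (v, y) else 0)"
    for F :: "('x \<Rightarrow> complex) \<times> 'y \<Rightarrow> complex"
  have lin: "linear_on (hom_space G R S) \<rho>"
    by (auto simp: linear_on_def \<rho>_def cscale_def fun_eq_iff)
  have inj: "inj_on \<rho> (hom_space G R S)"
  proof (subst linear_on_inj_iff[OF lin hom_space_subspace[OF assms]], intro ballI impI)
    fix F assume F: "F \<in> hom_space G R S" "\<rho> F = 0"
    define T where "T = (\<lambda>v y. F (v, y))"
    have T: "linear_on (space R) T" using hom_space_intertwiner[OF F(1)] intertwinerD(1) T_def by blast
    have "T b = 0" if b: "b \<in> B" for b
    proof
      fix y
      show "T b y = 0 y" using fun_cong[OF F(2), of "(b, y)"] b by (simp add: T_def \<rho>_def)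
    qed
    then have "cfun.span B \<subseteq> {v \<in> space R. T v = 0}"
      using B(5) by (intro cfun.span_minimal linear_on_kernel[OF T rep_subspace[OF assms(1)]]) blast
    then have "T v = 0" for v
      using F(1) B(3) by (cases "v \<in> space R") (auto simp: hom_space_def T_def)
    then show "F = 0" by (auto simp: T_def fun_eq_iff)
  qed
  have "(\<lambda>y. F (v, y)) \<in> space S" if "F \<in> hom_space G R S" "v \<in> B" for F v
    using intertwinerD(2)[OF hom_space_intertwiner[OF that(1)]] that(2) B(5) by blast
  then have "\<rho> ` hom_space G R S \<subseteq>
    {F. (\<forall>v\<in>B. (\<lambda>y. F (v, y)) \<in> space S) \<and> (\<forall>v. v \<notin> B \<longrightarrow> (\<forall>y. F (v, y) = 0))}"
    by (auto simp: \<rho>_def)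
  then show ?thesis
    using fin_dim_inj(1)[OF hom_space_subspace[OF assms] lin inj _ fin_dim_slices[OF B(1) rep_fin_dim[OF assms(2)]]]
    by blast
qed

lemma hom_dim_pos_iff:
  assumes "representation G R" "representation G S"
  shows "hom_dim G R S > 0 \<longleftrightarrow> (\<exists>T v. intertwiner G R S T \<and> v \<in> space R \<and> T v \<noteq> 0)"
proof -
  have "hom_dim G R S > 0 \<longleftrightarrow> hom_space G R S \<noteq> {0}"
    unfolding hom_dim_def using dim_zero_iff[OF hom_space_fin_dim[OF assms]] by (metis neq0_conv)
  also have "\<dots> \<longleftrightarrow> (\<exists>F\<in>hom_space G R S. F \<noteq> 0)"
    using cfun.subspace_0[OF hom_space_subspace[OF assms]] by blast
  also have "\<dots> \<longleftrightarrow> (\<exists>T v. intertwiner G R S T \<and> v \<in> space R \<and> T v \<noteq> 0)"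
  proof
    assume "\<exists>F\<in>hom_space G R S. F \<noteq> 0"
    then obtain F where F: "F \<in> hom_space G R S" "F \<noteq> 0" by blast
    then obtain v y where vy: "F (v, y) \<noteq> 0" by (auto simp: fun_eq_iff)
    then have v: "v \<in> space R" using F(1) by (auto simp: hom_space_def)
    have "(\<lambda>y. F (v, y)) \<noteq> 0" using vy by (metis zero_fun_apply)
    then show "\<exists>T v. intertwiner G R S T \<and> v \<in> space R \<and> T v \<noteq> 0"
      using hom_space_intertwiner[OF F(1)] v by blast
  next
    assume "\<exists>T v. intertwiner G R S T \<and> v \<in> space R \<and> T v \<noteq> 0"
    then obtain T v where T: "intertwiner G R S T" "v \<in> space R" "T v \<noteq> 0" by blast
    have "(\<lambda>y. hom_of R T (v, y)) \<noteq> 0" using hom_of_slice[OF T(2)] T(3) by metis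
    then have "hom_of R T \<noteq> 0" by (auto simp: fun_eq_iff)
    then show "\<exists>F\<in>hom_space G R S. F \<noteq> 0" using hom_of_hom_space[OF assms(1) T(1)] by blast
  qed
  finally show ?thesis .
qed

lemma hom_dim_schur:
  assumes "irreducible_rep G R" "irreducible_rep G S" "hom_dim G R S > 0"
  shows "rep_iso G R S"
proof -
  have "representation G R" "representation G S" using assms(1,2) by (auto simp: irreducible_rep_def)
  then obtain T v where "intertwiner G R S T" "v \<in> space R" "T v \<noteq> 0"
    using hom_dim_pos_iff assms(3) by blast
  then show ?thesis by (rule schur[OF assms(1,2)])
qed

text \<open>Composition with an injective map is injective on intertwiners. Applied to an
  isomorphism and to its inverse, the inequality shows that \<open>hom_dim\<close> depends only on
  the isomorphism class of the target; \<open>hom_dim_le_pre\<close> does the same for the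
  source.\<close>

lemma hom_dim_le_post:
  assumes "representation G Q" "representation G R" "representation G S"
    "intertwiner G R S T" "inj_on T (space R)"
  shows "hom_dim G Q R \<le> hom_dim G Q S"
proof -
  define \<Phi> where "\<Phi> F = hom_of Q (\<lambda>v. T (\<lambda>y. F (v, y)))" for F
  note TD = intertwinerD[OF assms(4)]
  have slice: "(\<lambda>y. F (v, y)) \<in> space R" if "F \<in> hom_space G Q R" "v \<in> space Q" for F v
    using intertwinerD(2)[OF hom_space_intertwiner[OF that(1)] that(2)] .
  have im: "\<Phi> F \<in> hom_space G Q S" if "F \<in> hom_space G Q R" for F
    unfolding \<Phi>_def
    using intertwiner_comp[OF hom_space_intertwiner[OF that] assms(4)]
    by (intro hom_of_hom_space assms(1)) (simp add: comp_def)
  have lin: "linear_on (hom_space G Q R) \<Phi>"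
    unfolding linear_on_def
  proof (intro conjI ballI allI)
    fix F F' assume F: "F \<in> hom_space G Q R" "F' \<in> hom_space G Q R"
    have "T (\<lambda>y. (F + F') (v, y)) = T (\<lambda>y. F (v, y)) + T (\<lambda>y. F' (v, y))" if "v \<in> space Q" for v
      using linear_on_add[OF TD(1) slice[OF F(1) that] slice[OF F(2) that]]
      by (simp add: plus_fun_def)
    then show "\<Phi> (F + F') = \<Phi> F + \<Phi> F'" by (auto simp: \<Phi>_def hom_of_def fun_eq_iff)
  next
    fix c F assume F: "F \<in> hom_space G Q R"
    have "T (\<lambda>y. (cscale c F) (v, y)) = cscale c (T (\<lambda>y. F (v, y)))" if "v \<in> space Q" for v
      using linear_on_scale[OF TD(1) slice[OF F that], of c] by (simp add: cscale_def)
    then show "\<Phi> (cscale c F) = cscale c (\<Phi> F)" by (auto simp: \<Phi>_def hom_of_def fun_eq_iff cscale_def)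
  qed
  have inj: "inj_on \<Phi> (hom_space G Q R)"
  proof (rule inj_onI)
    fix F F' assume F: "F \<in> hom_space G Q R" "F' \<in> hom_space G Q R" "\<Phi> F = \<Phi> F'"
    show "F = F'"
    proof (rule hom_space_ext[OF F(1,2)])
      fix v assume v: "v \<in> space Q"
      have "T (\<lambda>y. F (v, y)) = T (\<lambda>y. F' (v, y))"
        using F(3) hom_of_slice[OF v] unfolding \<Phi>_def by metis
      then show "(\<lambda>y. F (v, y)) = (\<lambda>y. F' (v, y))"
        using assms(5) slice[OF F(1) v] slice[OF F(2) v] by (meson inj_onD)
    qed
  qed
  show ?thesis
    unfolding hom_dim_def
    using fin_dim_inj(2)[OF hom_space_subspace[OF assms(1,2)] lin inj _ hom_space_fin_dim[OF assms(1,3)]] im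
    by blast
qed

lemma hom_dim_le_pre:
  fixes Q :: "('g, 'x) crep" and R :: "('g, 'y) crep" and S :: "('g, 'z) crep"
  assumes "representation G Q" "representation G R" "representation G S"
    "intertwiner G Q R T" "T ` space Q = space R"
  shows "hom_dim G R S \<le> hom_dim G Q S"
proof -
  define \<Phi> where "\<Phi> F = hom_of Q (\<lambda>v y. F (T v, y))" for F :: "('y \<Rightarrow> complex) \<times> 'z \<Rightarrow> complex"
  note TD = intertwinerD[OF assms(4)]
  have im: "\<Phi> F \<in> hom_space G Q S" if "F \<in> hom_space G R S" for F
    unfolding \<Phi>_def
    using intertwiner_comp[OF assms(4) hom_space_intertwiner[OF that]]
    by (intro hom_of_hom_space assms(1)) (simp add: comp_def)
  have lin: "linear_on (hom_space G R S) \<Phi>"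
    by (auto simp: linear_on_def \<Phi>_def hom_of_def fun_eq_iff cscale_def)
  have inj: "inj_on \<Phi> (hom_space G R S)"
  proof (rule inj_onI)
    fix F F' assume F: "F \<in> hom_space G R S" "F' \<in> hom_space G R S" "\<Phi> F = \<Phi> F'"
    show "F = F'"
    proof (rule hom_space_ext[OF F(1,2)])
      fix w assume "w \<in> space R"
      then obtain v where v: "v \<in> space Q" "w = T v" using assms(5) by blast
      then show "(\<lambda>y. F (w, y)) = (\<lambda>y. F' (w, y))"
        using F(3) hom_of_slice[OF v(1)] unfolding \<Phi>_def by metis
    qed
  qed
  show ?thesis
    unfolding hom_dim_def
    using fin_dim_inj(2)[OF hom_space_subspace[OF assms(2,3)] lin inj _ hom_space_fin_dim[OF assms(1,3)]] im
    by blast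
qed

lemma hom_dim_iso_right:
  assumes "representation G Q" "rep_iso G R S"
  shows "hom_dim G Q R = hom_dim G Q S"
proof (rule le_antisym)
  show "hom_dim G Q R \<le> hom_dim G Q S"
    using assms(2) hom_dim_le_post[OF assms(1)] unfolding rep_iso_alt bij_betw_def by blast
  show "hom_dim G Q S \<le> hom_dim G Q R"
    using rep_iso_sym[OF assms(2)] hom_dim_le_post[OF assms(1)] unfolding rep_iso_alt bij_betw_def by blast
qed

lemma hom_dim_iso_left:
  assumes "representation G S" "rep_iso G Q R"
  shows "hom_dim G Q S = hom_dim G R S"
proof (rule le_antisym)
  show "hom_dim G R S \<le> hom_dim G Q S"
    using assms(2) hom_dim_le_pre[OF _ _ assms(1)] unfolding rep_iso_alt bij_betw_def by blast
  show "hom_dim G Q S \<le> hom_dim G R S"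
    using rep_iso_sym[OF assms(2)] hom_dim_le_pre[OF _ _ assms(1)] unfolding rep_iso_alt bij_betw_def by blast
qed

section \<open>Additivity of the dimension of intertwiners in both arguments\<close>

lemma intertwiner_subrep:
  assumes "invariant_subspace G S U"
  shows "intertwiner G R (subrep S U) T \<longleftrightarrow> intertwiner G R S T \<and> T ` space R \<subseteq> U"
  using invariant_subspaceD(2)[OF assms] by (auto simp: intertwiner_def)

text \<open>Linearity and equivariance of the two components follow from uniqueness of the
  decomposition: each identity compares two decompositions of one vector.\<close>

lemma projections_exist:
  assumes "representation G R" "invariant_subspace G R A" "invariant_subspace G R B" "internal_sum V A B"
  shows "\<exists>p q. intertwiner G (subrep R V) (subrep R A) p \<and> intertwiner G (subrep R V) (subrep R B) q \<and>
    (\<forall>v\<in>V. v = p v + q v) \<and> (\<forall>a\<in>A. p a = a \<and> q a = 0) \<and> (\<forall>b\<in>B. p b = 0 \<and> q b = b)"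
proof -
  note AD = invariant_subspaceD[OF assms(2)] and BD = invariant_subspaceD[OF assms(3)]
  note dec = internal_sum_decompose[OF assms(4) AD(1) BD(1)]
  have "\<exists>a b. v \<in> V \<longrightarrow> a \<in> A \<and> b \<in> B \<and> v = a + b" for v using dec(3) by blast
  then obtain p q where pq: "\<And>v. v \<in> V \<Longrightarrow> p v \<in> A" "\<And>v. v \<in> V \<Longrightarrow> q v \<in> B" "\<And>v. v \<in> V \<Longrightarrow> v = p v + q v"
    by metis
  have uniq: "p v = a \<and> q v = b" if "v = a + b" "a \<in> A" "b \<in> B" for v a b
  proof -
    have "v \<in> V" using assms(4) that by (auto simp: internal_sum_def)
    then show ?thesis using dec(4)[OF pq(1) that(2) pq(2) that(3)] pq(3) that(1) by metis
  qed
  have add: "p (u + v) = p u + p v \<and> q (u + v) = q u + q v" if "u \<in> V" "v \<in> V" for u v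
  proof (rule uniq)
    have "u + v = (p u + q u) + (p v + q v)" using pq(3) that by metis
    then show "u + v = (p u + p v) + (q u + q v)" by (simp add: algebra_simps)
    show "p u + p v \<in> A" "q u + q v \<in> B"
      using cfun.subspace_add AD(1) BD(1) pq(1,2) that by blast+
  qed
  have scale: "p (cscale c v) = cscale c (p v) \<and> q (cscale c v) = cscale c (q v)" if "v \<in> V" for c v
  proof (rule uniq)
    show "cscale c v = cscale c (p v) + cscale c (q v)"
      using pq(3)[OF that] by (metis cfun.scale_right_distrib)
    show "cscale c (p v) \<in> A" "cscale c (q v) \<in> B"
      using cfun.subspace_scale AD(1) BD(1) pq(1,2) that by blast+
  qed
  have VR: "v \<in> space R" if "v \<in> V" for v
  proof -
    have "p v \<in> space R" "q v \<in> space R" using AD(2) BD(2) pq(1,2) that by blast+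
    then have "p v + q v \<in> space R" by (rule cfun.subspace_add[OF rep_subspace[OF assms(1)]])
    then show ?thesis using pq(3)[OF that] by simp
  qed
  have act: "p (act R g v) = act R g (p v) \<and> q (act R g v) = act R g (q v)"
    if g: "g \<in> carrier G" and v: "v \<in> V" for g v
  proof (rule uniq)
    have "p v \<in> space R" "q v \<in> space R" using AD(2) BD(2) pq(1,2) v by blast+
    then have "act R g (p v + q v) = act R g (p v) + act R g (q v)"
      by (rule linear_on_add[OF rep_linear[OF assms(1) g]])
    then show "act R g v = act R g (p v) + act R g (q v)" using pq(3)[OF v] by simp
    show "act R g (p v) \<in> A" "act R g (q v) \<in> B" using AD(3) BD(3) pq(1,2) g v by blast+
  qed
  have "\<forall>a\<in>A. p a = a \<and> q a = 0"
    using uniq[where b = 0] cfun.subspace_0[OF BD(1)] by simp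
  moreover have "\<forall>b\<in>B. p b = 0 \<and> q b = b"
    using uniq[where a = 0] cfun.subspace_0[OF AD(1)] by simp
  moreover have "intertwiner G (subrep R V) (subrep R A) p" "intertwiner G (subrep R V) (subrep R B) q"
    unfolding intertwiner_def linear_on_def using add scale act pq(1,2) by auto
  ultimately show ?thesis using pq(3) by blast
qed

text \<open>Intertwiners into \<open>A\<close> or \<open>B\<close> are literally intertwiners into
  \<open>V\<close>, so this direct sum is internal; composing with the two projections splits a
  given intertwiner.\<close>

lemma hom_space_right_sum:
  assumes "representation G X" "representation G R" "invariant_subspace G R A" "invariant_subspace G R B"
    "invariant_subspace G R V" "internal_sum V A B"
  shows "internal_sum (hom_space G X (subrep R V)) (hom_space G X (subrep R A)) (hom_space G X (subrep R B))"
proof -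
  note AD = invariant_subspaceD[OF assms(3)] and BD = invariant_subspaceD[OF assms(4)]
  note dec = internal_sum_decompose[OF assms(6) AD(1) BD(1)]
  have AB: "A \<inter> B = {0}" using assms(6) by (simp add: internal_sum_def)
  obtain p q where pq: "intertwiner G (subrep R V) (subrep R A) p" "intertwiner G (subrep R V) (subrep R B) q"
    "\<And>v. v \<in> V \<Longrightarrow> v = p v + q v"
    using projections_exist[OF assms(2,3,4,6)] by auto
  have sub: "hom_space G X (subrep R U) \<subseteq> hom_space G X (subrep R V)"
    if "invariant_subspace G R U" "U \<subseteq> V" for U
    using that(2) unfolding hom_space_def intertwiner_subrep[OF assms(5)] intertwiner_subrep[OF that(1)] by auto
  show ?thesis
    unfolding internal_sum_def
  proof (intro conjI subset_antisym subsetI)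
    fix F assume F: "F \<in> hom_space G X (subrep R A) \<inter> hom_space G X (subrep R B)"
    have "(\<lambda>y. F (v, y)) = 0" for v
    proof (cases "v \<in> space X")
      case True
      then have "(\<lambda>y. F (v, y)) \<in> A" "(\<lambda>y. F (v, y)) \<in> B"
        using F intertwinerD(2)[OF hom_space_intertwiner] by fastforce+
      then show ?thesis using AB by blast
    qed (use F in \<open>auto simp: hom_space_def\<close>)
    then show "F \<in> {0}" by (auto simp: fun_eq_iff)
  next
    fix F :: "('c \<Rightarrow> complex) \<times> 'd \<Rightarrow> complex" assume "F \<in> {0}"
    then show "F \<in> hom_space G X (subrep R A) \<inter> hom_space G X (subrep R B)"
      using cfun.subspace_0 hom_space_subspace[OF assms(1) representation_subrep] assms(2,3,4) by blast
  next
    fix F assume F: "F \<in> hom_space G X (subrep R V)"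
    let ?Fp = "hom_of X (\<lambda>v. p (\<lambda>y. F (v, y)))" and ?Fq = "hom_of X (\<lambda>v. q (\<lambda>y. F (v, y)))"
    have "?Fp \<in> hom_space G X (subrep R A)" "?Fq \<in> hom_space G X (subrep R B)"
      using intertwiner_comp[OF hom_space_intertwiner[OF F] pq(1)]
        intertwiner_comp[OF hom_space_intertwiner[OF F] pq(2)]
      by (auto intro!: hom_of_hom_space[OF assms(1)] simp: comp_def)
    moreover have "F = ?Fp + ?Fq"
    proof (rule ext, clarify)
      fix v y
      show "F (v, y) = (?Fp + ?Fq) (v, y)"
      proof (cases "v \<in> space X")
        case True
        then have "(\<lambda>y. F (v, y)) \<in> V"
          using intertwinerD(2)[OF hom_space_intertwiner[OF F]] by fastforce
        then show ?thesis using fun_cong[OF pq(3), of "\<lambda>y. F (v, y)" y] True by (simp add: hom_of_def)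
      qed (use F in \<open>auto simp: hom_space_def hom_of_def\<close>)
    qed
    ultimately show "F \<in> {a + b |a b. a \<in> hom_space G X (subrep R A) \<and> b \<in> hom_space G X (subrep R B)}"
      by blast
  next
    fix F assume "F \<in> {a + b |a b. a \<in> hom_space G X (subrep R A) \<and> b \<in> hom_space G X (subrep R B)}"
    then obtain a b where "F = a + b" "a \<in> hom_space G X (subrep R V)" "b \<in> hom_space G X (subrep R V)"
      using sub[OF assms(3) dec(1)] sub[OF assms(4) dec(2)] by blast
    then show "F \<in> hom_space G X (subrep R V)"
      using cfun.subspace_add[OF hom_space_subspace[OF assms(1) representation_subrep[OF assms(2,5)]]] by blast
  qed
qed

lemma additive_hom_dim_right:
  assumes "representation G X" "representation G R"
  shows "additive G R (\<lambda>U. hom_dim G X (subrep R U))"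
  unfolding additive_def hom_dim_def
  using internal_sum_dim[OF hom_space_right_sum[OF assms]] hom_space_fin_dim[OF assms(1) representation_subrep[OF assms(2)]]
  by blast

text \<open>In the source argument there is no inclusion: the encoded intertwiners out of
  \<open>A\<close> vanish off \<open>A\<close> and are not linear on \<open>V\<close>. They are
  first extended to \<open>V\<close> by precomposing with the projection, the map
  \<open>pre p\<close>, which is injective and so preserves dimensions.\<close>

lemma additive_hom_dim_left:
  fixes R :: "('g, 'x) crep" and X :: "('g, 'y) crep"
  assumes "representation G R" "representation G X"
  shows "additive G R (\<lambda>U. hom_dim G (subrep R U) X)"
  unfolding additive_def
proof (intro allI impI)
  fix V A B assume V: "invariant_subspace G R V" and A: "invariant_subspace G R A"
    and B: "invariant_subspace G R B" and V_AB: "internal_sum V A B"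
  obtain p q where pq: "intertwiner G (subrep R V) (subrep R A) p" "intertwiner G (subrep R V) (subrep R B) q"
    "\<And>v. v \<in> V \<Longrightarrow> v = p v + q v" "\<And>a. a \<in> A \<Longrightarrow> p a = a \<and> q a = 0" "\<And>b. b \<in> B \<Longrightarrow> p b = 0 \<and> q b = b"
    using projections_exist[OF assms(1) A B V_AB] by auto
  note dec = internal_sum_decompose[OF V_AB invariant_subspaceD(1)[OF A] invariant_subspaceD(1)[OF B]]
  have repV: "representation G (subrep R V)" by (rule representation_subrep[OF assms(1) V])
  let ?H = "\<lambda>U. hom_space G (subrep R U) X"
  define pre :: "(('x \<Rightarrow> complex) \<Rightarrow> 'x \<Rightarrow> complex) \<Rightarrow> (('x \<Rightarrow> complex) \<times> 'y \<Rightarrow> complex) \<Rightarrow> (('x \<Rightarrow> complex) \<times> 'y \<Rightarrow> complex)"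
    where "pre r F = hom_of (subrep R V) (\<lambda>v y. F (r v, y))" for r F
  have pre_slice: "(\<lambda>y. pre r F (v, y)) = (\<lambda>y. F (r v, y))" if "v \<in> V" for r F v
    using that by (simp add: pre_def hom_of_def)
  have lin: "linear_on UNIV (pre r)" for r
    by (auto simp: linear_on_def pre_def hom_of_def fun_eq_iff cscale_def)
  have in_H: "pre r F \<in> ?H V" if "intertwiner G (subrep R V) (subrep R U) r" "F \<in> ?H U" for r F U
    unfolding pre_def
    using intertwiner_comp[OF that(1) hom_space_intertwiner[OF that(2)]]
    by (intro hom_of_hom_space repV) (simp add: comp_def)
  have inj: "inj_on (pre r) (?H U)" if r: "\<And>u. u \<in> U \<Longrightarrow> r u = u" and UV: "U \<subseteq> V" for r U
  proof (rule inj_onI)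
    fix F F' assume F: "F \<in> ?H U" "F' \<in> ?H U" "pre r F = pre r F'"
    show "F = F'"
    proof (rule hom_space_ext[OF F(1,2)])
      fix v assume "v \<in> space (subrep R U)"
      then have v: "v \<in> U" by simp
      then have vV: "v \<in> V" using UV by blast
      have "(\<lambda>y. F (r v, y)) = (\<lambda>y. F' (r v, y))"
        using F(3) pre_slice[OF vV, of r F] pre_slice[OF vV, of r F'] by simp
      then show "(\<lambda>y. F (v, y)) = (\<lambda>y. F' (v, y))" using r[OF v] by simp
    qed
  qed
  have fd: "fin_dim (?H U)" if "invariant_subspace G R U" for U
    by (rule hom_space_fin_dim[OF representation_subrep[OF assms(1) that] assms(2)])
  have dim: "cfun.dim (pre r ` ?H U) = cfun.dim (?H U)" "fin_dim (pre r ` ?H U)"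
    if "invariant_subspace G R U" "\<And>u. u \<in> U \<Longrightarrow> r u = u" "U \<subseteq> V" for r U
    using fin_dim_image[OF fd[OF that(1)] linear_on_subset[OF lin]] inj[OF that(2,3)] by auto
  have "internal_sum (?H V) (pre p ` ?H A) (pre q ` ?H B)"
    unfolding internal_sum_def
  proof (intro conjI subset_antisym subsetI)
    fix F assume "F \<in> pre p ` ?H A \<inter> pre q ` ?H B"
    then obtain F1 F2 where F: "F1 \<in> ?H A" "F2 \<in> ?H B" "F = pre p F1" "F = pre q F2" by blast
    have z: "(\<lambda>y. F1 (0, y)) = 0" 
      using linear_on_zero[OF intertwinerD(1)[OF hom_space_intertwiner[OF F(1)]]] invariant_subspaceD(1)[OF A] by simp
    have "(\<lambda>y. F1 (a, y)) = 0" if a: "a \<in> A" for a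
    proof -
      have aV: "a \<in> V" using a dec(1) by blast
      have "(\<lambda>y. F1 (a, y)) = (\<lambda>y. F (a, y))" using pre_slice[OF aV, of p F1] pq(4)[OF a] F(3) by simp
      also have "\<dots> = (\<lambda>y. F2 (0, y))" using pre_slice[OF aV, of q F2] pq(4)[OF a] F(4) by simp
      also have "\<dots> = 0"
        using linear_on_zero[OF intertwinerD(1)[OF hom_space_intertwiner[OF F(2)]]] invariant_subspaceD(1)[OF B] by simp
      finally show ?thesis .
    qed
    moreover have "p v \<in> A" if "v \<in> V" for v using intertwinerD(2)[OF pq(1)] that by simp
    ultimately have "(\<lambda>y. F (v, y)) = 0" if "v \<in> V" for v using pre_slice[OF that, of p F1] F(3) that by simp
    then have "F (v, y) = 0" for v y
      using F(3) by (cases "v \<in> V") (metis zero_fun_apply, simp add: pre_def hom_of_def)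
    then show "F \<in> {0}" by (auto simp: fun_eq_iff)
  next
    fix F :: "('x \<Rightarrow> complex) \<times> 'y \<Rightarrow> complex" assume "F \<in> {0}"
    moreover have "pre r 0 = 0" for r by (auto simp: pre_def hom_of_def fun_eq_iff)
    moreover have "0 \<in> ?H A" "0 \<in> ?H B"
      using cfun.subspace_0[OF fin_dim_subspace[OF fd]] A B by blast+
    ultimately show "F \<in> pre p ` ?H A \<inter> pre q ` ?H B" by (metis IntI imageI singletonD)
  next
    fix F assume F: "F \<in> ?H V"
    have res: "hom_of (subrep R U) (\<lambda>v y. F (v, y)) \<in> ?H U" if "invariant_subspace G R U" "U \<subseteq> V" for U
    proof (rule hom_of_hom_space[OF representation_subrep[OF assms(1) that(1)]])
      show "intertwiner G (subrep R U) X (\<lambda>v y. F (v, y))"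
        using hom_space_intertwiner[OF F] linear_on_subset[OF _ that(2)] that(2)
        unfolding intertwiner_def subrep_simps by blast
    qed
    let ?F1 = "hom_of (subrep R A) (\<lambda>v y. F (v, y))" and ?F2 = "hom_of (subrep R B) (\<lambda>v y. F (v, y))"
    have "F = pre p ?F1 + pre q ?F2"
    proof (rule ext, clarify)
      fix v y
      show "F (v, y) = (pre p ?F1 + pre q ?F2) (v, y)"
      proof (cases "v \<in> V")
        case True
        have r: "p v \<in> A" "q v \<in> B" using intertwinerD(2)[OF pq(1)] intertwinerD(2)[OF pq(2)] True by simp_all
        then have "p v \<in> V" "q v \<in> V" using dec(1,2) by blast+
        then have "(\<lambda>y. F (p v + q v, y)) = (\<lambda>y. F (p v, y)) + (\<lambda>y. F (q v, y))"
          using linear_on_add[OF intertwinerD(1)[OF hom_space_intertwiner[OF F]]] by simp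
        then have "F (p v + q v, y) = F (p v, y) + F (q v, y)" by (metis plus_fun_apply)
        then show ?thesis using True r pq(3)[OF True] by (simp add: pre_def hom_of_def)
      qed (use F in \<open>auto simp: hom_space_def pre_def hom_of_def\<close>)
    qed
    then show "F \<in> {a + b |a b. a \<in> pre p ` ?H A \<and> b \<in> pre q ` ?H B}"
      using res[OF A dec(1)] res[OF B dec(2)] by blast
  next
    fix F assume "F \<in> {a + b |a b. a \<in> pre p ` ?H A \<and> b \<in> pre q ` ?H B}"
    then show "F \<in> ?H V"
      using in_H[OF pq(1)] in_H[OF pq(2)] cfun.subspace_add[OF fin_dim_subspace[OF fd[OF V]]] by blast
  qed
  then have "cfun.dim (?H V) = cfun.dim (pre p ` ?H A) + cfun.dim (pre q ` ?H B)"
    by (rule internal_sum_dim) (use dim(2)[OF A] dim(2)[OF B] pq(4,5) dec(1,2) in blast)+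
  then show "hom_dim G (subrep R V) X = hom_dim G (subrep R A) X + hom_dim G (subrep R B) X"
    unfolding hom_dim_def using dim(1)[OF A] dim(1)[OF B] pq(4,5) dec(1,2) by auto
qed

subsection \<open>Induced representations\<close>

lemma induced_space_iff:
  "F \<in> space (induced G K \<phi> R) \<longleftrightarrow>
    (\<forall>g\<in>carrier G. (\<lambda>x. F (g, x)) \<in> space R) \<and> (\<forall>g. g \<notin> carrier G \<longrightarrow> (\<forall>x. F (g, x) = 0)) \<and>
    (\<forall>h\<in>carrier K. \<forall>g\<in>carrier G. (\<lambda>x. F (\<phi> h \<otimes>\<^bsub>G\<^esub> g, x)) = act R h (\<lambda>x. F (g, x)))"
  by (simp add: induced_def)

lemma induced_act: "act (induced G K \<phi> R) g F (a, x) = (if a \<in> carrier G then F (a \<otimes>\<^bsub>G\<^esub> g, x) else 0)"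
  by (simp add: induced_def)

text \<open>The condition on \<open>F\<close> involves left multiplication by
  \<open>\<phi> h\<close> and the action is right translation; the two commute by
  associativity.\<close>

lemma representation_induced:
  fixes R :: "('h, 'x) crep"
  assumes "group G" "finite (carrier G)" "fin_dim (space R)"
    "\<And>h. h \<in> carrier K \<Longrightarrow> linear_on (space R) (act R h)" "\<And>h. h \<in> carrier K \<Longrightarrow> \<phi> h \<in> carrier G"
  shows "representation G (induced G K \<phi> R)"
proof -
  interpret group G by fact
  let ?I = "induced G K \<phi> R"
  note sR = fin_dim_subspace[OF assms(3)]
  have eqs: "(\<lambda>x. (F + F') (g, x)) = (\<lambda>x. F (g, x)) + (\<lambda>x. F' (g, x))"
    "(\<lambda>x. (cscale c F) (g, x)) = cscale c (\<lambda>x. F (g, x))"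
    "(\<lambda>x. (0 :: 'a \<times> 'x \<Rightarrow> complex) (g, x)) = 0" for F F' :: "'a \<times> 'x \<Rightarrow> complex" and g c
    by (simp_all add: fun_eq_iff cscale_def)
  have "0 \<in> space ?I"
    unfolding induced_space_iff eqs
    using linear_on_zero[OF assms(4) sR] cfun.subspace_0[OF sR] by auto
  moreover have "F + F' \<in> space ?I" if "F \<in> space ?I" "F' \<in> space ?I" for F F'
    using that linear_on_add[OF assms(4)] cfun.subspace_add[OF sR]
    unfolding induced_space_iff eqs by auto
  moreover have "cscale c F \<in> space ?I" if "F \<in> space ?I" for c F
    using that linear_on_scale[OF assms(4)] cfun.subspace_scale[OF sR]
    unfolding induced_space_iff eqs by (auto simp: cscale_def)
  ultimately have sub: "cfun.subspace (space ?I)" by (simp add: cfun.subspace_def)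
  have "space ?I \<subseteq>
    {F. (\<forall>a\<in>carrier G. (\<lambda>x. F (a, x)) \<in> space R) \<and> (\<forall>a. a \<notin> carrier G \<longrightarrow> (\<forall>x. F (a, x) = 0))}"
    by (auto simp: induced_space_iff)
  then have "fin_dim (space ?I)"
    using fin_dim_subset(1)[OF sub _ fin_dim_slices[OF assms(2,3)]] by blast
  moreover have "act ?I g F \<in> space ?I" if "g \<in> carrier G" "F \<in> space ?I" for g F
    using that assms(5) unfolding induced_space_iff induced_act by (auto simp: m_assoc)
  moreover have "linear_on (space ?I) (act ?I g)" if "g \<in> carrier G" for g
    by (auto simp: linear_on_def fun_eq_iff induced_act cscale_def)
  moreover have "act ?I \<one>\<^bsub>G\<^esub> F = F" if "F \<in> space ?I" for F
    using that by (auto simp: fun_eq_iff induced_act induced_space_iff)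
  moreover have "act ?I (g \<otimes>\<^bsub>G\<^esub> h) F = act ?I g (act ?I h F)"
    if "g \<in> carrier G" "h \<in> carrier G" for g h F
    using that by (auto simp: fun_eq_iff induced_act m_assoc)
  ultimately show ?thesis unfolding representation_alt using is_group by auto
qed

section \<open>Frobenius reciprocity for one-dimensional characters\<close>

definition char_rep :: "('h \<Rightarrow> complex) \<Rightarrow> ('h, unit) crep"
  where "char_rep \<chi> = \<lparr>space = UNIV, act = (\<lambda>h. cscale (\<chi> h))\<rparr>"

lemma trivial_rep_char: "trivial_rep = char_rep (\<lambda>_. 1)"
  by (simp add: trivial_rep_def char_rep_def cscale_def fun_eq_iff)

lemma sign_rep_char: "sign_rep = char_rep (\<lambda>p. of_int (sign p))"
  by (simp add: sign_rep_def char_rep_def)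

lemma fin_dim_unit: "fin_dim (UNIV :: (unit \<Rightarrow> complex) set)"
proof -
  have "v = cscale (v ()) (\<lambda>_. 1)" for v :: "unit \<Rightarrow> complex" by (simp add: cscale_def)
  then have "v \<in> cfun.span {\<lambda>_. 1}" for v :: "unit \<Rightarrow> complex"
    by (metis cfun.span_base cfun.span_scale singletonI)
  then have "cfun.span {\<lambda>_. 1} = (UNIV :: (unit \<Rightarrow> complex) set)" by blast
  then show ?thesis unfolding fin_dim_def using cfun.subspace_UNIV by blast
qed

text \<open>The trivial and the sign character of a Young subgroup are both instances, so Young
  modules and twisted Young modules share one reciprocity theorem.\<close>

locale linear_character = group G for G (structure) +
  fixes H :: "'a set" and \<chi> :: "'a \<Rightarrow> complex"
  assumes fin: "finite (carrier G)" and sub: "subgroup H G"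
    and chi_mult: "h \<in> H \<Longrightarrow> k \<in> H \<Longrightarrow> \<chi> (h \<otimes> k) = \<chi> h * \<chi> k" and chi_one: "\<chi> \<one> = 1"
begin

definition ind :: "('a, 'a \<times> unit) crep"
  where "ind = induced G (G\<lparr>carrier := H\<rparr>) id (char_rep \<chi>)"

lemma H_carrier: "h \<in> H \<Longrightarrow> h \<in> carrier G" using subgroup.mem_carrier[OF sub] .

lemma chi_inv: "h \<in> H \<Longrightarrow> \<chi> h * \<chi> (inv h) = 1"
  using chi_mult[of h "inv h"] chi_one H_carrier subgroup.m_inv_closed[OF sub] by simp

lemma ind_space: "F \<in> space ind \<longleftrightarrow> (\<forall>g. g \<notin> carrier G \<longrightarrow> F (g, ()) = 0) \<and>
    (\<forall>h\<in>H. \<forall>g\<in>carrier G. F (h \<otimes> g, ()) = \<chi> h * F (g, ()))"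
  unfolding ind_def induced_space_iff by (auto simp: char_rep_def cscale_def fun_eq_iff)

lemma ind_act: "act ind g F (a, u) = (if a \<in> carrier G then F (a \<otimes> g, ()) else 0)"
  unfolding ind_def induced_act by simp

lemma ind_rep: "representation G ind"
  unfolding ind_def
  by (rule representation_induced[OF is_group fin])
    (auto simp: char_rep_def fin_dim_unit linear_on_def cscale_def fun_eq_iff algebra_simps H_carrier)

definition isotypic :: "('a, 'y) crep \<Rightarrow> ('y \<Rightarrow> complex) set"
  where "isotypic W = {w \<in> space W. \<forall>h\<in>H. act W h w = cscale (\<chi> h) w}"

text \<open>The character extended by zero generates the induced module, so an intertwiner out of
  \<open>ind\<close> is determined by its value here.\<close>

definition gen :: "'a \<times> unit \<Rightarrow> complex"
  where "gen = (\<lambda>(g, u). if g \<in> H then \<chi> g else 0)"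

lemma gen_apply: "gen (g, ()) = (if g \<in> H then \<chi> g else 0)"
  by (simp add: gen_def)

lemma H_mult_iff: "h \<in> H \<Longrightarrow> g \<in> carrier G \<Longrightarrow> h \<otimes> g \<in> H \<longleftrightarrow> g \<in> H"
  "h \<in> H \<Longrightarrow> g \<in> carrier G \<Longrightarrow> g \<otimes> h \<in> H \<longleftrightarrow> g \<in> H"
proof -
  assume h: "h \<in> H" and g: "g \<in> carrier G"
  note cl = subgroup.m_closed[OF sub] subgroup.m_inv_closed[OF sub]
  have "g = inv h \<otimes> (h \<otimes> g)" using h g H_carrier by (simp flip: m_assoc)
  then show "h \<otimes> g \<in> H \<longleftrightarrow> g \<in> H" using cl h by metis
  have "g = (g \<otimes> h) \<otimes> inv h" using h g H_carrier by (simp add: m_assoc)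
  then show "g \<otimes> h \<in> H \<longleftrightarrow> g \<in> H" using cl h by metis
qed

lemma fin_dim_isotypic:
  assumes "representation G W"
  shows "fin_dim (isotypic W)"
proof (rule fin_dim_subset(1)[OF _ _ rep_fin_dim[OF assms]])
  note lin = rep_linear[OF assms H_carrier] and s = rep_subspace[OF assms]
  show "cfun.subspace (isotypic W)"
    unfolding cfun.subspace_def isotypic_def
    using linear_on_zero[OF lin s] linear_on_add[OF lin] linear_on_scale[OF lin]
      cfun.subspace_0[OF s] cfun.subspace_add[OF s] cfun.subspace_scale[OF s]
    by (auto simp: cfun.scale_right_distrib mult.commute)
qed (auto simp: isotypic_def)

lemma gen_isotypic: "gen \<in> isotypic ind"
proof -
  have "gen \<in> space ind"
    unfolding ind_space gen_apply using H_mult_iff(1) H_carrier chi_mult by auto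
  moreover have "act ind h gen = cscale (\<chi> h) gen" if "h \<in> H" for h
    using that H_mult_iff(2)[OF that] H_carrier chi_mult
    by (auto simp: fun_eq_iff ind_act gen_apply cscale_def)
  ultimately show ?thesis by (simp add: isotypic_def)
qed

lemma card_H: "(of_nat (card H) :: complex) \<noteq> 0"
  using subgroup.finite_imp_card_positive[OF sub fin] by simp

text \<open>At a point \<open>a\<close> only the \<open>g\<close> in the coset \<open>H a\<close>
  contribute. For such a \<open>g\<close>, written as \<open>h\<close> times \<open>a\<close>, the
  term is \<open>\<chi> h * f (a, ()) * \<chi> (inv h)\<close>, which equals
  \<open>f (a, ())\<close>; the factor in front divides by the number of these
  \<open>g\<close>.\<close>

lemma ind_expand:
  assumes "f \<in> space ind"
  shows "f = cscale (1 / of_nat (card H)) (\<Sum>g\<in>carrier G. cscale (f (g, ())) (act ind (inv g) gen))"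
proof (rule ext, clarify)
  fix a :: 'a
  let ?t = "\<lambda>g. f (g, ()) * gen (a \<otimes> inv g, ())"
  show "f (a, ()) = cscale (1 / of_nat (card H)) (\<Sum>g\<in>carrier G. cscale (f (g, ())) (act ind (inv g) gen)) (a, ())"
  proof (cases "a \<in> carrier G")
    case True
    have "(\<Sum>g\<in>carrier G. ?t g) = (\<Sum>g\<in>(\<lambda>h. h \<otimes> a) ` H. ?t g)"
    proof (rule sum.mono_neutral_right[OF fin])
      show "(\<lambda>h. h \<otimes> a) ` H \<subseteq> carrier G" using H_carrier True by auto
      show "\<forall>g\<in>carrier G - (\<lambda>h. h \<otimes> a) ` H. ?t g = 0"
      proof
        fix g assume g: "g \<in> carrier G - (\<lambda>h. h \<otimes> a) ` H"
        have "a \<otimes> inv g \<notin> H"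
        proof
          assume "a \<otimes> inv g \<in> H"
          then have "inv (a \<otimes> inv g) \<in> H" by (rule subgroup.m_inv_closed[OF sub])
          moreover have "g = inv (a \<otimes> inv g) \<otimes> a" using g True by (simp add: inv_mult_group m_assoc)
          ultimately show False using g by blast
        qed
        then show "?t g = 0" by (simp add: gen_apply)
      qed
    qed
    also have "\<dots> = (\<Sum>h\<in>H. ?t (h \<otimes> a))"
      by (rule sum.reindex_cong[OF _ refl refl]) (use True H_carrier in \<open>auto simp: inj_on_def\<close>)
    also have "\<dots> = (\<Sum>h\<in>H. f (a, ()))"
    proof (rule sum.cong[OF refl])
      fix h assume h: "h \<in> H"
      have "a \<otimes> inv (h \<otimes> a) = inv h"
        using h H_carrier True by (simp add: inv_mult_group flip: m_assoc)
      then have "?t (h \<otimes> a) = \<chi> h * f (a, ()) * \<chi> (inv h)"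
        using assms h True subgroup.m_inv_closed[OF sub h] by (simp add: ind_space gen_apply)
      then show "?t (h \<otimes> a) = f (a, ())" using chi_inv[OF h] by (metis mult.commute mult.left_commute mult_1_right)
    qed
    finally have "(\<Sum>g\<in>carrier G. ?t g) = of_nat (card H) * f (a, ())" by simp
    then show ?thesis using card_H True by (simp add: cscale_def sum_apply ind_act)
  next
    case False
    then show ?thesis using assms by (simp add: ind_space cscale_def sum_apply ind_act)
  qed
qed

text \<open>Evaluation at \<open>gen\<close> identifies the intertwiners out of \<open>ind\<close>
  with the vectors on which \<open>H\<close> acts by \<open>\<chi>\<close>. It is injective by
  \<open>ind_expand\<close>, and the same formula with \<open>gen\<close> replaced by such a vector
  gives the inverse.\<close>

theorem frobenius:
  assumes W: "representation G W"
  shows "hom_dim G ind W = cfun.dim (isotypic W)"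
  unfolding hom_dim_def
proof (rule dim_bij[OF hom_space_fin_dim[OF ind_rep W]])
  let ?\<Phi> = "\<lambda>F y. F (gen, y)"
  note sW = rep_subspace[OF W]
  have gen: "gen \<in> space ind" "\<And>h. h \<in> H \<Longrightarrow> act ind h gen = cscale (\<chi> h) gen"
    using gen_isotypic by (auto simp: isotypic_def)
  show "linear_on (hom_space G ind W) ?\<Phi>" by (auto simp: linear_on_def cscale_def fun_eq_iff)
  show "bij_betw ?\<Phi> (hom_space G ind W) (isotypic W)"
    unfolding bij_betw_def
  proof
    show "inj_on ?\<Phi> (hom_space G ind W)"
    proof (rule inj_onI)
      fix F F' assume F: "F \<in> hom_space G ind W" "F' \<in> hom_space G ind W" "?\<Phi> F = ?\<Phi> F'"
      have formula: "(\<lambda>y. F (f, y)) =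
          cscale (1 / of_nat (card H)) (\<Sum>g\<in>carrier G. cscale (f (g, ())) (act W (inv g) (?\<Phi> F)))"
        if F: "F \<in> hom_space G ind W" and f: "f \<in> space ind" for F f
      proof -
        define T where "T = (\<lambda>v y. F (v, y))"
        have T: "intertwiner G ind W T" unfolding T_def by (rule hom_space_intertwiner[OF F])
        note TD = intertwinerD[OF T]
        let ?s = "\<lambda>g. cscale (f (g, ())) (act ind (inv g) gen)"
        have s: "act ind (inv g) gen \<in> space ind" "?s g \<in> space ind" if "g \<in> carrier G" for g
          using rep_closed[OF ind_rep inv_closed[OF that] gen(1)] cfun.subspace_scale[OF rep_subspace[OF ind_rep]] by blast+
        have "T f = T (cscale (1 / of_nat (card H)) (\<Sum>g\<in>carrier G. ?s g))"
          using ind_expand[OF f] by simp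
        also have "\<dots> = cscale (1 / of_nat (card H)) (T (\<Sum>g\<in>carrier G. ?s g))"
          by (rule linear_on_scale[OF TD(1)]) (rule cfun.subspace_sum[OF rep_subspace[OF ind_rep] s(2)])
        also have "T (\<Sum>g\<in>carrier G. ?s g) = (\<Sum>g\<in>carrier G. T (?s g))"
          by (rule linear_on_sum[OF TD(1) rep_subspace[OF ind_rep] s(2)])
        also have "\<dots> = (\<Sum>g\<in>carrier G. cscale (f (g, ())) (act W (inv g) (T gen)))"
          by (rule sum.cong[OF refl]) (use linear_on_scale[OF TD(1) s(1)] TD(3)[OF inv_closed gen(1)] in simp)
        finally show ?thesis by (simp add: T_def)
      qed
      show "F = F'"
        by (rule hom_space_ext[OF F(1,2)]) (use formula[OF F(1)] formula[OF F(2)] F(3) in simp)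
    qed
    show "?\<Phi> ` hom_space G ind W = isotypic W"
    proof (intro subset_antisym subsetI)
      fix w assume "w \<in> ?\<Phi> ` hom_space G ind W"
      then obtain F where F: "F \<in> hom_space G ind W" "w = ?\<Phi> F" by blast
      define T where "T = (\<lambda>v y. F (v, y))"
      have T: "intertwiner G ind W T" unfolding T_def by (rule hom_space_intertwiner[OF F(1)])
      have w: "w = T gen" using F(2) by (simp add: T_def)
      show "w \<in> isotypic W"
        unfolding isotypic_def w
        using intertwinerD(2)[OF T gen(1)] intertwinerD(3)[OF T H_carrier gen(1)] gen(2)
          linear_on_scale[OF intertwinerD(1)[OF T] gen(1)] by auto
    next
      fix w assume "w \<in> isotypic W"
      then have w: "w \<in> space W" "\<And>h. h \<in> H \<Longrightarrow> act W h w = cscale (\<chi> h) w" by (auto simp: isotypic_def)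
      \<comment> \<open>This is the only possible extension, by \<open>ind_expand\<close>; the work
        lies in its equivariance and in \<open>T gen = w\<close>.\<close>
      define T where "T f = cscale (1 / of_nat (card H)) (\<Sum>g\<in>carrier G. cscale (f (g, ())) (act W (inv g) w))"
        for f :: "'a \<times> unit \<Rightarrow> complex"
      have aw: "act W g w \<in> space W" if "g \<in> carrier G" for g using rep_closed[OF W that w(1)] .
      have Tin: "T f \<in> space W" for f
        unfolding T_def by (intro cfun.subspace_scale[OF sW] cfun.subspace_sum[OF sW] aw inv_closed)
      have "linear_on (space ind) T"
        by (auto simp: linear_on_def T_def cscale_def fun_eq_iff sum_apply algebra_simps sum.distrib sum_distrib_left)
      moreover have "T (act ind a f) = act W a (T f)" if a: "a \<in> carrier G" for a f
      proof -
        have "(\<Sum>g\<in>carrier G. cscale (act ind a f (g, ())) (act W (inv g) w)) =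
          (\<Sum>g\<in>carrier G. cscale (f (g \<otimes> a, ())) (act W a (act W (inv (g \<otimes> a)) w)))"
        proof (rule sum.cong[OF refl])
          fix g assume g: "g \<in> carrier G"
          have "act W a (act W (inv (g \<otimes> a)) w) = act W (a \<otimes> inv (g \<otimes> a)) w"
            using rep_mult[OF W a _ w(1)] a g by simp
          also have "a \<otimes> inv (g \<otimes> a) = inv g" using a g by (simp add: inv_mult_group flip: m_assoc)
          finally show "cscale (act ind a f (g, ())) (act W (inv g) w) =
            cscale (f (g \<otimes> a, ())) (act W a (act W (inv (g \<otimes> a)) w))"
            using g by (simp add: ind_act)
        qed
        also have "\<dots> = (\<Sum>g\<in>carrier G. cscale (f (g, ())) (act W a (act W (inv g) w)))"
          by (rule group_sum_translate(2)[OF is_group a, of "\<lambda>g. cscale (f (g, ())) (act W a (act W (inv g) w))"])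
        also have "\<dots> = (\<Sum>g\<in>carrier G. act W a (cscale (f (g, ())) (act W (inv g) w)))"
          by (rule sum.cong[OF refl]) (use linear_on_scale[OF rep_linear[OF W a] aw] in simp)
        also have "\<dots> = act W a (\<Sum>g\<in>carrier G. cscale (f (g, ())) (act W (inv g) w))"
          by (rule linear_on_sum[OF rep_linear[OF W a] sW, symmetric])
            (intro cfun.subspace_scale[OF sW] aw inv_closed)
        finally show ?thesis
          unfolding T_def
          by (subst linear_on_scale[OF rep_linear[OF W a]])
            (auto intro!: cfun.subspace_scale[OF sW] cfun.subspace_sum[OF sW] aw)
      qed
      ultimately have "intertwiner G ind W T" unfolding intertwiner_def using Tin by blast
      then have h: "hom_of ind T \<in> hom_space G ind W" by (rule hom_of_hom_space[OF ind_rep])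
      have "T gen = w"
      proof -
        have "(\<Sum>g\<in>carrier G. cscale (gen (g, ())) (act W (inv g) w)) =
          (\<Sum>g\<in>H. cscale (gen (g, ())) (act W (inv g) w))"
          by (rule sum.mono_neutral_right[OF fin]) (use H_carrier in \<open>auto simp: gen_apply\<close>)
        also have "\<dots> = (\<Sum>g\<in>H. w)"
        proof (rule sum.cong[OF refl])
          fix g assume g: "g \<in> H"
          then show "cscale (gen (g, ())) (act W (inv g) w) = w"
            using w(2)[OF subgroup.m_inv_closed[OF sub g]] chi_inv[OF g] by (simp add: gen_apply)
        qed
        finally show ?thesis unfolding T_def using card_H by (simp add: cscale_def fun_eq_iff sum_apply)
      qed
      then have "?\<Phi> (hom_of ind T) = w" using hom_of_slice[OF gen(1)] by metis
      then show "w \<in> ?\<Phi> ` hom_space G ind W" using h by blast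
    qed
  qed
qed

end

subsection \<open>Spaces of class functions\<close>

lemma supported_functions:
  assumes "finite S"
  shows "fin_dim {F :: 'b \<Rightarrow> complex. \<forall>b. b \<notin> S \<longrightarrow> F b = 0}"
    "cfun.dim {F :: 'b \<Rightarrow> complex. \<forall>b. b \<notin> S \<longrightarrow> F b = 0} = card S"
proof -
  let ?V = "\<lambda>S. {F :: 'b \<Rightarrow> complex. \<forall>b. b \<notin> S \<longrightarrow> F b = 0}"
  have sub: "cfun.subspace (?V S)" for S by (auto simp: cfun.subspace_def cscale_def)
  have inj: "linear_on (?V S) (\<lambda>F (b, u :: unit). F b)" "inj_on (\<lambda>F (b, u :: unit). F b) (?V S)" for S
    by (auto simp: linear_on_def cscale_def fun_eq_iff inj_on_def)
  have fd: "fin_dim (?V S)" if "finite S" for S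
    by (rule fin_dim_inj(1)[OF sub inj _ fin_dim_slices[OF that fin_dim_unit]]) auto
  show "fin_dim (?V S)" by (rule fd[OF assms])
  show "cfun.dim (?V S) = card S"
    using assms
  proof (induction S)
    case empty
    have "?V {} = {0}" by (auto simp: fun_eq_iff)
    then show ?case using dim_zero_iff[OF fin_dim_zero] by simp
  next
    case (insert b S)
    have one: "cfun.dim (?V {b}) = 1"
    proof (rule dim_one[OF fd, of _ "\<lambda>x. if x = b then 1 else 0"])
      show "\<exists>c. w = cscale c (\<lambda>x. if x = b then 1 else 0)" if "w \<in> ?V {b}" for w
        using that by (intro exI[of _ "w b"]) (auto simp: cscale_def fun_eq_iff)
    qed (auto simp: fun_eq_iff)
    have "internal_sum (?V (insert b S)) (?V {b}) (?V S)"
      unfolding internal_sum_def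
    proof (intro conjI subset_antisym subsetI)
      fix F assume F: "F \<in> ?V (insert b S)"
      have "F = (\<lambda>x. if x = b then F x else 0) + (\<lambda>x. if x = b then 0 else F x)"
        by (auto simp: fun_eq_iff)
      moreover have "(\<lambda>x. if x = b then F x else 0) \<in> ?V {b}" "(\<lambda>x. if x = b then 0 else F x) \<in> ?V S"
        using F by auto
      ultimately show "F \<in> {f + g | f g. f \<in> ?V {b} \<and> g \<in> ?V S}" by blast
    qed (use insert.hyps in \<open>auto simp: fun_eq_iff\<close>)
    then show ?case using internal_sum_dim[OF _ fd fd, of "?V (insert b S)" "{b}" S] one insert by simp
  qed
qed

text \<open>Functions constant on the fibres of \<open>m\<close> are the functions on the image of
  \<open>m\<close>. With the colour matrix as \<open>m\<close> this counts double cosets.\<close>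

lemma dim_class_functions:
  fixes m :: "'a \<Rightarrow> 'b" and A :: "'a set"
  assumes "finite A"
  shows "cfun.dim {F :: 'a \<times> unit \<Rightarrow> complex. (\<forall>a. a \<notin> A \<longrightarrow> F (a, ()) = 0) \<and>
    (\<forall>a\<in>A. \<forall>b\<in>A. m a = m b \<longrightarrow> F (a, ()) = F (b, ()))} = card (m ` A)" (is "cfun.dim ?C = _")
proof -
  let ?V = "{F :: 'b \<Rightarrow> complex. \<forall>b. b \<notin> m ` A \<longrightarrow> F b = 0}"
  let ?\<Phi> = "\<lambda>F (a, u :: unit). if a \<in> A then F (m a) else 0 :: complex"
  have "linear_on ?V ?\<Phi>" by (auto simp: linear_on_def cscale_def fun_eq_iff)
  moreover have "bij_betw ?\<Phi> ?V ?C"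
    unfolding bij_betw_def
  proof
    show "inj_on ?\<Phi> ?V"
    proof (rule inj_onI)
      fix F F' assume F: "F \<in> ?V" "F' \<in> ?V" "?\<Phi> F = ?\<Phi> F'"
      have "F b = F' b" for b
      proof (cases "b \<in> m ` A")
        case True
        then obtain a where "a \<in> A" "b = m a" by blast
        then show ?thesis using fun_cong[OF F(3), of "(a, ())"] by simp
      qed (use F in auto)
      then show "F = F'" by auto
    qed
    show "?\<Phi> ` ?V = ?C"
    proof (intro subset_antisym subsetI)
      fix F assume F: "F \<in> ?C"
      define F' where "F' b = (if b \<in> m ` A then F (SOME a. a \<in> A \<and> m a = b, ()) else 0)" for b
      have "F' (m a) = F (a, ())" if a: "a \<in> A" for a
      proof -
        define a' where "a' = (SOME a'. a' \<in> A \<and> m a' = m a)"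
        have "a' \<in> A \<and> m a' = m a"
          unfolding a'_def by (rule someI[where P = "\<lambda>a'. a' \<in> A \<and> m a' = m a"]) (use a in simp)
        then have "F (a', ()) = F (a, ())" using F a by blast
        moreover have "F' (m a) = F (a', ())" using a by (simp add: F'_def a'_def)
        ultimately show ?thesis by simp
      qed
      moreover have "F (a, ()) = 0" if "a \<notin> A" for a using F that by blast
      ultimately have F'1: "F (a, u) = (if a \<in> A then F' (m a) else 0)" for a u by simp
      have "F = ?\<Phi> F'" by (rule ext) (simp add: F'1 split: prod.splits)
      moreover have "F' \<in> ?V" by (simp add: F'_def)
      ultimately show "F \<in> ?\<Phi> ` ?V" by blast
    qed auto
  qed
  ultimately have "cfun.dim ?V = cfun.dim ?C"
    by (rule dim_bij[OF supported_functions(1)[OF finite_imageI[OF assms]]])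
  then show ?thesis using supported_functions(2)[OF finite_imageI[OF assms]] by metis
qed

text \<open>Equal fibre sizes mean equal multisets of colours. All permutations built later, for
  double cosets, for realising a matrix and for filling a diagram, come from here.\<close>

lemma permutation_between_colourings:
  assumes "finite A" "\<And>i. card {x \<in> A. f x = i} = card {x \<in> A. f' x = i}"
  obtains p where "p permutes A" "\<And>x. x \<in> A \<Longrightarrow> f x = f' (p x)"
proof -
  have "image_mset f (mset_set A) = image_mset f' (mset_set A)"
  proof (rule multiset_eqI)
    fix i
    have "{x \<in> A. f x = i} = f -` {i} \<inter> A" "{x \<in> A. f' x = i} = f' -` {i} \<inter> A" by auto
    then show "count (image_mset f (mset_set A)) i = count (image_mset f' (mset_set A)) i"
      using assms(2)[of i] by (simp add: count_image_mset_eq_card_vimage[OF assms(1)] vimage_def)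
  qed
  then obtain p where p: "p permutes A" "\<forall>x\<in>A. f x = f' (p x)"
    by (rule image_mset_eq_implies_permutes[OF assms(1)])
  show ?thesis by (rule that[OF p(1)]) (use p(2) in blast)
qed

section \<open>Partitions and Kostka numbers\<close>

text \<open>A partition is a function that is zero beyond its last row, so that conditions relating
  the rows \<open>i\<close> and \<open>Suc i\<close> have no boundary cases;
  \<open>row_length\<close> brings diagrams into this form.\<close>

definition is_part :: "(nat \<Rightarrow> nat) \<Rightarrow> bool"
  where "is_part p \<longleftrightarrow> antimono p \<and> finite {i. p i \<noteq> 0}"

definition psize :: "(nat \<Rightarrow> nat) \<Rightarrow> nat"
  where "psize p = sum p {i. p i \<noteq> 0}"

definition parts :: "nat \<Rightarrow> (nat \<Rightarrow> nat) set"
  where "parts n = {p. is_part p \<and> psize p = n}"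

lemma psize_eq: "finite S \<Longrightarrow> (\<And>i. i \<notin> S \<Longrightarrow> p i = 0) \<Longrightarrow> psize p = sum p S"
  unfolding psize_def by (rule sum.mono_neutral_left) (blast, (metis (mono_tags, lifting) mem_Collect_eq subsetI), blast)

lemma psize_lessThan: "(\<And>i. i \<ge> L \<Longrightarrow> p i = 0) \<Longrightarrow> psize p = sum p {..<L}"
  by (rule psize_eq) auto

lemma is_part_bound:
  assumes "is_part p"
  shows "i \<ge> psize p \<Longrightarrow> p i = 0" "p i \<le> psize p"
proof -
  have anti: "p i \<le> p j" if "j \<le> i" for i j using assms that by (auto simp: is_part_def antimono_def)
  have f: "finite {i. p i \<noteq> 0}" using assms by (simp add: is_part_def)
  show "p i = 0" if "i \<ge> psize p"
  proof (rule ccontr)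
    assume "p i \<noteq> 0"
    then have ne: "p j \<ge> 1" if "j \<le> i" for j using anti[OF that] by linarith
    have "Suc i = (\<Sum>j\<le>i. 1)" by simp
    also have "\<dots> \<le> (\<Sum>j\<le>i. p j)" by (rule sum_mono) (use ne in auto)
    also have "\<dots> \<le> psize p" unfolding psize_def by (rule sum_mono2[OF f]) (use ne in force)+
    finally show False using that by simp
  qed
  show "p i \<le> psize p"
    unfolding psize_def using f by (cases "p i = 0") (auto intro!: member_le_sum)
qed

lemma parts_vanish: "p \<in> parts n \<Longrightarrow> i \<ge> n \<Longrightarrow> p i = 0"
  using is_part_bound(1) by (auto simp: parts_def)

lemma finite_parts: "finite (parts n)"
proof (rule finite_subset)
  show "parts n \<subseteq> {p. \<forall>i. (i \<in> {..<n} \<longrightarrow> p i \<in> {..n}) \<and> (i \<notin> {..<n} \<longrightarrow> p i = 0)}"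
  proof
    fix p assume p: "p \<in> parts n"
    then have "p i \<le> n" for i using is_part_bound(2) by (auto simp: parts_def)
    then show "p \<in> {p. \<forall>i. (i \<in> {..<n} \<longrightarrow> p i \<in> {..n}) \<and> (i \<notin> {..<n} \<longrightarrow> p i = 0)}"
      using parts_vanish[OF p] by simp
  qed
  show "finite {p :: nat \<Rightarrow> nat. \<forall>i. (i \<in> {..<n} \<longrightarrow> p i \<in> {..n}) \<and> (i \<notin> {..<n} \<longrightarrow> p i = 0)}"
    by (rule finite_set_of_finite_funs) auto
qed

lemma is_part_zero: "is_part (\<lambda>_. 0)"
  by (simp add: is_part_def antimono_def)

lemma psize_zero: "psize (\<lambda>_. 0) = 0"
  by (simp add: psize_def)

lemma psize_zero_iff: "is_part p \<Longrightarrow> psize p = 0 \<longleftrightarrow> p = (\<lambda>_. 0)"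
  using is_part_bound(2) psize_zero by (metis (full_types) ext le_zero_eq)

text \<open>The row form of a horizontal strip: row \<open>Suc i\<close> of \<open>E\<close> does
  not reach beyond row \<open>i\<close> of \<open>D\<close>, so no column receives two new boxes.
  The agreement with the column condition is \<open>strip_diagrams_iff\<close>.\<close>

definition interlace :: "(nat \<Rightarrow> nat) \<Rightarrow> (nat \<Rightarrow> nat) \<Rightarrow> bool"
  where "interlace D E \<longleftrightarrow> (\<forall>i. D i \<le> E i \<and> E (Suc i) \<le> D i)"

definition strip :: "nat \<Rightarrow> (nat \<Rightarrow> nat) \<Rightarrow> (nat \<Rightarrow> nat) \<Rightarrow> bool"
  where "strip m D E \<longleftrightarrow> interlace D E \<and> psize E = psize D + m"

lemma interlace_is_part:
  assumes "interlace D E"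
  shows "is_part D \<longleftrightarrow> is_part E"
proof -
  have D: "antimono D" and E: "antimono E"
    using assms by (auto simp: interlace_def antimono_iff_le_Suc intro: le_trans)
  have "{i. E i \<noteq> 0} \<subseteq> insert 0 (Suc ` {i. D i \<noteq> 0})"
  proof
    fix i assume "i \<in> {i. E i \<noteq> 0}"
    then have Ei: "E i \<noteq> 0" by simp
    show "i \<in> insert 0 (Suc ` {i. D i \<noteq> 0})"
    proof (cases i)
      case (Suc j)
      have "E (Suc j) \<le> D j" using assms by (simp add: interlace_def)
      then have "D j \<noteq> 0" using Ei Suc by (metis le_zero_eq)
      then show ?thesis using Suc by blast
    qed simp
  qed
  moreover have "{i. D i \<noteq> 0} \<subseteq> {i. E i \<noteq> 0}"
  proof
    fix i assume "i \<in> {i. D i \<noteq> 0}"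
    moreover have "D i \<le> E i" using assms by (simp add: interlace_def)
    ultimately show "i \<in> {i. E i \<noteq> 0}" by simp
  qed
  ultimately have "finite {i. D i \<noteq> 0} \<longleftrightarrow> finite {i. E i \<noteq> 0}"
    by (meson finite_imageI finite_insert finite_subset)
  then show ?thesis using D E by (simp add: is_part_def)
qed

lemma strip_is_part: "strip m D E \<Longrightarrow> is_part D \<longleftrightarrow> is_part E"
  using interlace_is_part by (simp add: strip_def)

lemma interlace_psize_le:
  assumes "interlace D E" "is_part E"
  shows "psize D \<le> psize E"
proof -
  have "psize D = sum D {i. E i \<noteq> 0}"
  proof (rule psize_eq)
    show "finite {i. E i \<noteq> 0}" using assms(2) by (simp add: is_part_def)
    show "D i = 0" if "i \<notin> {i. E i \<noteq> 0}" for i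
      using assms(1) that unfolding interlace_def by (metis (mono_tags) le_zero_eq mem_Collect_eq)
  qed
  also have "\<dots> \<le> psize E" unfolding psize_def using assms(1) by (auto simp: interlace_def intro: sum_mono)
  finally show ?thesis .
qed

lemma finite_strips_below: "finite {D. strip m D E \<and> is_part E}"
  by (rule finite_subset[OF _ finite_parts[of "psize E - m"]]) (auto simp: parts_def strip_def interlace_is_part)

lemma finite_strips_above: "finite {E. strip m D E \<and> is_part D}"
  by (rule finite_subset[OF _ finite_parts[of "psize D + m"]]) (auto simp: parts_def strip_def interlace_is_part)

text \<open>The numbers of semistandard tableaux of a given shape whose content is the composition
  \<open>c 0, \<dots>, c (l - 1)\<close>.\<close>

fun kos :: "nat \<Rightarrow> (nat \<Rightarrow> nat) \<Rightarrow> (nat \<Rightarrow> nat) \<Rightarrow> nat"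
  where "kos 0 c E = (if E = (\<lambda>_. 0) then 1 else 0)"
  | "kos (Suc l) c E = (\<Sum>D | strip (c l) D E \<and> is_part E. kos l c D)"

lemma kos_cong: "(\<And>j. j < l \<Longrightarrow> c j = c' j) \<Longrightarrow> kos l c E = kos l c' E"
  by (induction l arbitrary: E) simp_all

lemma kos_psize: "kos l c E \<noteq> 0 \<Longrightarrow> E \<in> parts (sum c {..<l})"
proof (induction l arbitrary: E)
  case 0
  then show ?case using is_part_zero psize_zero by (auto simp: parts_def split: if_splits)
next
  case (Suc l)
  then obtain D where "strip (c l) D E" "is_part E" "kos l c D \<noteq> 0"
    using sum.not_neutral_contains_not_neutral by (metis (no_types, lifting) kos.simps(2) mem_Collect_eq)
  then show ?case using Suc.IH[of D] by (auto simp: parts_def strip_def)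
qed

lemma kos_zero: "kos l c (\<lambda>_. 0) = (if \<forall>j<l. c j = 0 then 1 else 0)"
proof (induction l)
  case (Suc l)
  have "strip m D (\<lambda>_. 0) \<longleftrightarrow> m = 0 \<and> D = (\<lambda>_. 0)" for m D
    by (auto simp: strip_def interlace_def psize_zero)
  then have "{D. strip (c l) D (\<lambda>_. 0) \<and> is_part (\<lambda>_. 0)} = (if c l = 0 then {\<lambda>_. 0} else {})"
    using is_part_zero by auto
  then show ?case using Suc by (auto simp: less_Suc_eq)
qed simp

subsection \<open>The local rule for adding and removing strips\<close>

text \<open>In each row minimum and maximum add up to the two row lengths. The maxima of the shifted
  rows omit row \<open>0\<close>, whose maximum is supplied by \<open>nu 0\<close> together with the
  excess \<open>j\<close>.\<close>

lemma local_rule_size: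
  fixes \<kappa> la mu nu :: "nat \<Rightarrow> nat"
  assumes "is_part la" "is_part mu" "nu 0 = max (la 0) (mu 0) + j"
    "\<And>i. \<kappa> i + nu (Suc i) = min (la i) (mu i) + max (la (Suc i)) (mu (Suc i))"
  shows "psize \<kappa> + psize nu = psize la + psize mu + j"
proof -
  define L where "L = psize la + psize mu"
  have z: "la i = 0" "mu i = 0" if "i \<ge> L" for i
    using that is_part_bound(1)[OF assms(1)] is_part_bound(1)[OF assms(2)] by (auto simp: L_def)
  have zk: "\<kappa> i = 0" "nu (Suc i) = 0" if "i \<ge> L" for i
    using assms(4)[of i] z[of i] z[of "Suc i"] that by auto
  have "psize \<kappa> = sum \<kappa> {..<L}" by (rule psize_lessThan) (rule zk)
  moreover have "psize nu = sum nu {..<Suc L}"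
    by (rule psize_lessThan) (metis zk(2) Suc_le_D Suc_le_mono)
  moreover have "sum nu {..<Suc L} = nu 0 + (\<Sum>i<L. nu (Suc i))" by (rule sum.lessThan_Suc_shift)
  moreover have "(\<Sum>i<L. \<kappa> i) + (\<Sum>i<L. nu (Suc i)) =
    (\<Sum>i<L. min (la i) (mu i)) + (\<Sum>i<L. max (la (Suc i)) (mu (Suc i)))"
    unfolding sum.distrib[symmetric] by (rule sum.cong) (use assms(4) in auto)
  moreover have "(\<Sum>i<Suc L. max (la i) (mu i)) = max (la 0) (mu 0) + (\<Sum>i<L. max (la (Suc i)) (mu (Suc i)))"
    by (rule sum.lessThan_Suc_shift)
  moreover have "(\<Sum>i<Suc L. max (la i) (mu i)) = (\<Sum>i<L. max (la i) (mu i))" using z by simp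
  moreover have "(\<Sum>i<L. min (la i) (mu i)) + (\<Sum>i<L. max (la i) (mu i)) = sum la {..<L} + sum mu {..<L}"
    unfolding sum.distrib[symmetric] by (rule sum.cong) auto
  moreover have "psize la = sum la {..<L}" "psize mu = sum mu {..<L}"
    by (rule psize_lessThan, rule z, assumption)+
  ultimately show ?thesis using assms(3) by simp
qed

text \<open>Both \<open>\<nu> (Suc i)\<close> and \<open>\<kappa> i\<close> range over the interval from \<open>max (\<lambda> (Suc i)) (\<mu> (Suc i))\<close> to
  \<open>min (\<lambda> i) (\<mu> i)\<close>; reflecting this interval gives a bijection, and the excess \<open>j\<close> of \<open>\<nu> 0\<close>
  is free.\<close>

lemma local_rule:
  assumes "is_part la" "is_part mu"
  shows "card {nu. strip a mu nu \<and> strip b la nu} =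
    (\<Sum>j\<le>min a b. card {\<kappa>. strip (a - j) \<kappa> la \<and> strip (b - j) \<kappa> mu})"
proof -
  \<comment> \<open>The sum of the two endpoints of the interval, so that subtraction from
    \<open>hl i\<close> is the reflection.\<close>
  define hl where "hl i = min (la i) (mu i) + max (la (Suc i)) (mu (Suc i))" for i
  let ?N = "{nu. strip a mu nu \<and> strip b la nu}"
  let ?K = "\<lambda>j. {\<kappa>. strip (a - j) \<kappa> la \<and> strip (b - j) \<kappa> mu}"
  define f where "f nu = (nu 0 - max (la 0) (mu 0), \<lambda>i. hl i - nu (Suc i))" for nu :: "nat \<Rightarrow> nat"
  define g where "g = (\<lambda>(j, \<kappa>) i. case i of 0 \<Rightarrow> max (la 0) (mu 0) + j | Suc i \<Rightarrow> hl i - \<kappa> i)"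
  have finK: "finite (?K j)" for j
    by (rule finite_subset[OF _ finite_strips_below[of "a - j" la]]) (use assms in auto)
  have "bij_betw f ?N (SIGMA j:{..min a b}. ?K j)"
  proof (rule bij_betw_byWitness[where f' = g])
    show "\<forall>nu\<in>?N. g (f nu) = nu"
    proof
      fix nu assume "nu \<in> ?N"
      then have i: "interlace mu nu" "interlace la nu" by (auto simp: strip_def)
      show "g (f nu) = nu"
      proof
        fix i
        show "g (f nu) i = nu i"
        proof (cases i)
          case 0
          then show ?thesis using i by (auto simp: f_def g_def interlace_def)
        next
          case (Suc k)
          have "nu (Suc k) \<le> hl k" using i unfolding interlace_def hl_def by (metis min.bounded_iff trans_le_add1)
          then show ?thesis using Suc by (simp add: f_def g_def)
        qed
      qed
    qed
    show "\<forall>x\<in>SIGMA j:{..min a b}. ?K j. f (g x) = x"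
    proof clarify
      fix j \<kappa> assume "strip (a - j) \<kappa> la" "strip (b - j) \<kappa> mu"
      then have "\<kappa> i \<le> hl i" for i unfolding strip_def interlace_def hl_def by (metis min.bounded_iff trans_le_add1)
      then show "f (g (j, \<kappa>)) = (j, \<kappa>)" by (auto simp: f_def g_def)
    qed
    show "f ` ?N \<subseteq> (SIGMA j:{..min a b}. ?K j)"
    proof (rule image_subsetI)
      fix nu assume "nu \<in> ?N"
      then have nu: "strip a mu nu" "strip b la nu" by auto
      then have i: "interlace mu nu" "interlace la nu" by (auto simp: strip_def)
      define \<kappa> j where "\<kappa> = (\<lambda>i. hl i - nu (Suc i))" and "j = nu 0 - max (la 0) (mu 0)"
      have nui: "nu (Suc i) \<le> min (la i) (mu i)" "max (la (Suc i)) (mu (Suc i)) \<le> nu (Suc i)" for i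
        \<comment> \<open>The upper bound comes from the shifted half of the two interlacings, the
          lower bound from the unshifted half in row \<open>Suc i\<close>.\<close>
        using i by (auto simp: interlace_def)
      have k: "\<kappa> i + nu (Suc i) = min (la i) (mu i) + max (la (Suc i)) (mu (Suc i))" for i
        using le_add_diff_inverse2[OF trans_le_add1[OF nui(1)[of i]]] by (simp only: \<kappa>_def hl_def)
      have j: "nu 0 = max (la 0) (mu 0) + j" using i by (auto simp: j_def interlace_def)
      have kb: "\<kappa> i \<le> min (la i) (mu i)" "max (la (Suc i)) (mu (Suc i)) \<le> \<kappa> i" for i
        using k[of i] nui[of i] by linarith+
      have il: "interlace \<kappa> la" "interlace \<kappa> mu" using kb by (auto simp: interlace_def)
      have "psize \<kappa> + psize nu = psize la + psize mu + j" by (rule local_rule_size[OF assms j k])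
      moreover have "psize \<kappa> \<le> psize la" "psize \<kappa> \<le> psize mu"
        using interlace_psize_le il assms by blast+
      ultimately have "j \<le> min a b" "strip (a - j) \<kappa> la" "strip (b - j) \<kappa> mu"
        using nu il by (auto simp: strip_def)
      then show "f nu \<in> (SIGMA j:{..min a b}. ?K j)" by (simp add: f_def \<kappa>_def[symmetric] j_def[symmetric])
    qed
    show "g ` (SIGMA j:{..min a b}. ?K j) \<subseteq> ?N"
    proof (rule image_subsetI)
      fix x assume "x \<in> (SIGMA j:{..min a b}. ?K j)"
      then obtain j \<kappa> where x: "x = (j, \<kappa>)"
        and jk: "j \<le> min a b" "strip (a - j) \<kappa> la" "strip (b - j) \<kappa> mu" by auto
      then have il: "interlace \<kappa> la" "interlace \<kappa> mu" by (auto simp: strip_def)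
      define nu where "nu = g (j, \<kappa>)"
      have kb: "\<kappa> i \<le> min (la i) (mu i)" "max (la (Suc i)) (mu (Suc i)) \<le> \<kappa> i" for i
        using il by (auto simp: interlace_def)
      have j: "nu 0 = max (la 0) (mu 0) + j" by (simp add: nu_def g_def)
      have k: "\<kappa> i + nu (Suc i) = min (la i) (mu i) + max (la (Suc i)) (mu (Suc i))" for i
        using le_add_diff_inverse[OF trans_le_add1[OF kb(1)[of i]]] by (simp add: nu_def g_def hl_def)
      have nb: "nu (Suc i) \<le> min (la i) (mu i)" "max (la (Suc i)) (mu (Suc i)) \<le> nu (Suc i)" for i
        using k[of i] kb[of i] by linarith+
      have "la i \<le> nu i" "mu i \<le> nu i" for i using j nb(2) by (cases i, auto)+
      then have il': "interlace la nu" "interlace mu nu" using nb(1) by (auto simp: interlace_def)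
      have "psize \<kappa> + psize nu = psize la + psize mu + j" by (rule local_rule_size[OF assms j k])
      then have "strip a mu nu" "strip b la nu" using jk il' by (auto simp: strip_def)
      then show "g x \<in> ?N" by (simp add: nu_def x)
    qed
  qed
  then have "card ?N = card (SIGMA j:{..min a b}. ?K j)" by (rule bij_betw_same_card)
  also have "\<dots> = (\<Sum>j\<le>min a b. card (?K j))" using finK by simp
  finally show ?thesis .
qed

subsection \<open>Matrices with given margins\<close>

text \<open>The possible last rows of a matrix with column sums \<open>c\<close>. The bound by
  \<open>c\<close> keeps the truncated differences \<open>c j - r j\<close> exact when such a row is
  removed.\<close>

definition rows :: "nat \<Rightarrow> (nat \<Rightarrow> nat) \<Rightarrow> nat \<Rightarrow> (nat \<Rightarrow> nat) set"
  where "rows l c a = {r. (\<forall>j\<ge>l. r j = 0) \<and> (\<forall>j<l. r j \<le> c j) \<and> sum r {..<l} = a}"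

definition mats :: "nat \<Rightarrow> (nat \<Rightarrow> nat) \<Rightarrow> nat \<Rightarrow> (nat \<Rightarrow> nat) \<Rightarrow> (nat \<Rightarrow> nat \<Rightarrow> nat) set"
  where "mats k d l c = {M. (\<forall>i j. i \<ge> k \<or> j \<ge> l \<longrightarrow> M i j = 0) \<and>
    (\<forall>i<k. (\<Sum>j<l. M i j) = d i) \<and> (\<forall>j<l. (\<Sum>i<k. M i j) = c j)}"

lemma finite_rows: "finite (rows l c a)"
proof (rule finite_subset)
  show "rows l c a \<subseteq> {r. \<forall>j. (j \<in> {..<l} \<longrightarrow> r j \<in> {..a}) \<and> (j \<notin> {..<l} \<longrightarrow> r j = 0)}"
    by (auto simp: rows_def intro: member_le_sum)
  show "finite {r :: nat \<Rightarrow> nat. \<forall>j. (j \<in> {..<l} \<longrightarrow> r j \<in> {..a}) \<and> (j \<notin> {..<l} \<longrightarrow> r j = 0)}"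
    by (rule finite_set_of_finite_funs) auto
qed

text \<open>Splits off the last entry \<open>j\<close>; its range is that of the excess in
  \<open>local_rule\<close>, which makes the two fit together in
  \<open>kos_remove_strip\<close>.\<close>

lemma sum_rows_Suc:
  fixes f :: "(nat \<Rightarrow> nat) \<Rightarrow> nat"
  shows "(\<Sum>r\<in>rows (Suc l) c a. f r) = (\<Sum>j\<le>min a (c l). \<Sum>r\<in>rows l c (a - j). f (r(l := j)))"
proof -
  have "bij_betw (\<lambda>(j, r). r(l := j)) (SIGMA j:{..min a (c l)}. rows l c (a - j)) (rows (Suc l) c a)"
  proof (rule bij_betw_byWitness[where f' = "\<lambda>r. (r l, r(l := 0))"])
    show "\<forall>x\<in>SIGMA j:{..min a (c l)}. rows l c (a - j). (\<lambda>r. (r l, r(l := 0))) ((\<lambda>(j, r). r(l := j)) x) = x"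
      by (auto simp: rows_def fun_eq_iff)
    show "\<forall>r\<in>rows (Suc l) c a. (\<lambda>(j, r). r(l := j)) (r l, r(l := 0)) = r" by auto
    have s: "sum (r(l := j)) {..<l} = sum r {..<l}" for r :: "nat \<Rightarrow> nat" and j by (rule sum.cong) auto
    show "(\<lambda>(j, r). r(l := j)) ` (SIGMA j:{..min a (c l)}. rows l c (a - j)) \<subseteq> rows (Suc l) c a"
      by (auto simp: rows_def s)
    show "(\<lambda>r. (r l, r(l := 0))) ` rows (Suc l) c a \<subseteq> (SIGMA j:{..min a (c l)}. rows l c (a - j))"
      by (auto simp: rows_def s)
  qed
  then have "(\<Sum>r\<in>rows (Suc l) c a. f r) = (\<Sum>x\<in>(SIGMA j:{..min a (c l)}. rows l c (a - j)). f ((\<lambda>(j, r). r(l := j)) x))"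
    by (rule sum.reindex_bij_betw[symmetric])
  also have "\<dots> = (\<Sum>j\<le>min a (c l). \<Sum>r\<in>rows l c (a - j). f (r(l := j)))"
    by (subst sum.Sigma) (auto simp: finite_rows split_def)
  finally show ?thesis .
qed

lemma finite_mats: "finite (mats k d l c)"
proof (rule finite_subset)
  let ?B = "{r. \<forall>j. (j \<in> {..<l} \<longrightarrow> r j \<in> {..sum d {..<k}}) \<and> (j \<notin> {..<l} \<longrightarrow> r j = 0)}"
  have "M i j \<le> sum d {..<k}" if M: "M \<in> mats k d l c" and ij: "i < k" "j < l" for M i j
  proof -
    have "M i j \<le> (\<Sum>j<l. M i j)" by (rule member_le_sum) (use ij in auto)
    also have "\<dots> = d i" using M ij by (simp add: mats_def)
    also have "\<dots> \<le> sum d {..<k}" by (rule member_le_sum) (use ij in auto)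
    finally show ?thesis .
  qed
  then show "mats k d l c \<subseteq> {M. \<forall>i. (i \<in> {..<k} \<longrightarrow> M i \<in> ?B) \<and> (i \<notin> {..<k} \<longrightarrow> M i = (\<lambda>_. 0))}"
  proof (intro subsetI CollectI allI conjI impI)
    fix M i assume M: "M \<in> mats k d l c"
    show "M i = (\<lambda>_. 0)" if "i \<notin> {..<k}" using M that by (auto simp: mats_def)
    show "M i j \<in> {..sum d {..<k}}" if "i \<in> {..<k}" "j \<in> {..<l}" for j
      using \<open>\<And>M i j. M \<in> mats k d l c \<Longrightarrow> i < k \<Longrightarrow> j < l \<Longrightarrow> M i j \<le> sum d {..<k}\<close>[OF M] that by simp
    show "M i j = 0" if "j \<notin> {..<l}" for j using M that by (auto simp: mats_def)
  qed
  have "finite ?B" by (rule finite_set_of_finite_funs) auto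
  then show "finite {M. \<forall>i. (i \<in> {..<k} \<longrightarrow> M i \<in> ?B) \<and> (i \<notin> {..<k} \<longrightarrow> M i = (\<lambda>_. 0))}"
    by (intro finite_set_of_finite_funs) auto
qed

text \<open>Deleting the last row \<open>r\<close> lowers the column sums by
  \<open>r\<close>.\<close>

lemma card_mats_Suc:
  "card (mats (Suc k) d l c) = (\<Sum>r\<in>rows l c (d k). card (mats k d l (\<lambda>j. c j - r j)))"
proof -
  let ?S = "SIGMA r:rows l c (d k). mats k d l (\<lambda>j. c j - r j)"
  have s: "(\<Sum>i<k. (M(k := r)) i j) = (\<Sum>i<k. M i j)" for M :: "nat \<Rightarrow> nat \<Rightarrow> nat" and r j
    by (rule sum.cong) auto
  have "bij_betw (\<lambda>M. (M k, M(k := \<lambda>_. 0))) (mats (Suc k) d l c) ?S"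
  proof (rule bij_betw_byWitness[where f' = "\<lambda>(r, M). M(k := r)"])
    show "\<forall>M\<in>mats (Suc k) d l c. (\<lambda>(r, M). M(k := r)) (M k, M(k := \<lambda>_. 0)) = M" by auto
    show "\<forall>x\<in>?S. (\<lambda>M. (M k, M(k := \<lambda>_. 0))) ((\<lambda>(r, M). M(k := r)) x) = x"
      by (auto simp: mats_def fun_eq_iff)
    show "(\<lambda>M. (M k, M(k := \<lambda>_. 0))) ` mats (Suc k) d l c \<subseteq> ?S"
    proof (rule image_subsetI)
      fix M assume M: "M \<in> mats (Suc k) d l c"
      then have c: "(\<Sum>i<k. M i j) + M k j = c j" if "j < l" for j using that by (simp add: mats_def)
      have "M k \<in> rows l c (d k)" using M c by (auto simp: rows_def mats_def) (metis le_add2)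
      moreover have "M(k := \<lambda>_. 0) \<in> mats k d l (\<lambda>j. c j - M k j)"
        using M unfolding mats_def by (auto simp: s)
      ultimately show "(M k, M(k := \<lambda>_. 0)) \<in> ?S" by simp
    qed
    show "(\<lambda>(r, M). M(k := r)) ` ?S \<subseteq> mats (Suc k) d l c"
      by (auto simp: mats_def rows_def s less_Suc_eq)
  qed
  then have "card (mats (Suc k) d l c) = card ?S" by (rule bij_betw_same_card)
  also have "\<dots> = (\<Sum>r\<in>rows l c (d k). card (mats k d l (\<lambda>j. c j - r j)))"
    using finite_mats finite_rows by simp
  finally show "card (mats (Suc k) d l c) = (\<Sum>r\<in>rows l c (d k). card (mats k d l (\<lambda>j. c j - r j)))" .
qed

text \<open>In terms of symmetric functions, the adjoint of multiplication by the complete function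
  of degree \<open>a\<close> sends a product of complete functions to the sum over all ways of
  lowering their degrees by \<open>a\<close> in total; this is its coefficient at \<open>mu\<close>.
  In the induction the last strip of the tableau is moved past the added strip by
  \<open>local_rule\<close>.\<close>

lemma kos_remove_strip:
  assumes "is_part mu"
  shows "(\<Sum>nu | strip a mu nu. kos l c nu) = (\<Sum>r\<in>rows l c a. kos l (\<lambda>j. c j - r j) mu)"
  using assms
proof (induction l arbitrary: a mu)
  case 0
  have fin: "finite {nu. strip a mu nu}" using finite_strips_above[of a mu] 0 by simp
  have z: "strip a mu (\<lambda>_. 0) \<longleftrightarrow> a = 0 \<and> mu = (\<lambda>_. 0)"
    by (auto simp: strip_def interlace_def psize_zero)
  have r: "rows 0 c a = (if a = 0 then {\<lambda>_. 0} else {})" by (auto simp: rows_def)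
  show ?case using fin z r by (auto simp: sum.delta)
next
  case (Suc l)
  let ?b = "c l"
  \<comment> \<open>A finite set containing every shape \<open>la\<close> that occurs between
    \<open>mu\<close> and \<open>nu\<close> or above some \<open>\<kappa>\<close>, so that the order
    of summation can be exchanged.\<close>
  define Q where "Q = (\<Union>n\<le>psize mu + a. parts n)"
  have finQ: "finite Q" by (simp add: Q_def finite_parts)
  have Q: "p \<in> Q \<longleftrightarrow> is_part p \<and> psize p \<le> psize mu + a" for p by (auto simp: Q_def parts_def)
  have nuQ: "nu \<in> Q" if "strip a mu nu" for nu
    using that Suc.prems strip_is_part[OF that] by (auto simp: Q strip_def)
  have step1: "(\<Sum>nu | strip a mu nu. kos (Suc l) c nu) =
    (\<Sum>nu\<in>{nu. strip a mu nu}. \<Sum>la\<in>{la. la \<in> Q \<and> strip ?b la nu}. kos l c la)"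
  proof (rule sum.cong[OF refl])
    fix nu assume nu: "nu \<in> {nu. strip a mu nu}"
    then have "is_part nu" "psize nu = psize mu + a" using strip_is_part Suc.prems by (auto simp: strip_def)
    then have "{D. strip ?b D nu \<and> is_part nu} = {la. la \<in> Q \<and> strip ?b la nu}"
      using strip_is_part by (auto simp: Q strip_def)
    then show "kos (Suc l) c nu = (\<Sum>la\<in>{la. la \<in> Q \<and> strip ?b la nu}. kos l c la)" by simp
  qed
  have finmu: "finite {nu. strip a mu nu}" using finite_strips_above[of a mu] Suc.prems by simp
  have "(\<Sum>nu\<in>{nu. strip a mu nu}. \<Sum>la\<in>{la. la \<in> Q \<and> strip ?b la nu}. kos l c la) =
    (\<Sum>la\<in>Q. \<Sum>nu\<in>{nu. nu \<in> {nu. strip a mu nu} \<and> strip ?b la nu}. kos l c la)"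
    by (rule sum.swap_restrict[OF finmu finQ])
  \<comment> \<open>For fixed \<open>la\<close> the summand does not depend on \<open>nu\<close>, so
    the inner sum counts the \<open>nu\<close> above both \<open>la\<close> and \<open>mu\<close>;
    the local rule turns this into a count of the \<open>\<kappa>\<close> below both.\<close>
  also have "\<dots> = (\<Sum>la\<in>Q. (\<Sum>j\<le>min a ?b. card {\<kappa>. strip (a - j) \<kappa> la \<and> strip (?b - j) \<kappa> mu}) * kos l c la)"
  proof (rule sum.cong[OF refl])
    fix la assume "la \<in> Q"
    then have "is_part la" by (simp add: Q)
    then show "(\<Sum>nu\<in>{nu. nu \<in> {nu. strip a mu nu} \<and> strip ?b la nu}. kos l c la) =
      (\<Sum>j\<le>min a ?b. card {\<kappa>. strip (a - j) \<kappa> la \<and> strip (?b - j) \<kappa> mu}) * kos l c la"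
      using local_rule[of la mu a ?b] \<open>is_part la\<close> Suc.prems by simp
  qed
  also have "\<dots> = (\<Sum>j\<le>min a ?b. \<Sum>la\<in>Q. \<Sum>\<kappa>\<in>{\<kappa>. \<kappa> \<in> {\<kappa>. strip (?b - j) \<kappa> mu} \<and> strip (a - j) \<kappa> la}. kos l c la)"
    unfolding sum_distrib_right by (subst sum.swap) (simp add: conj_commute)
  also have "\<dots> = (\<Sum>j\<le>min a ?b. \<Sum>r\<in>rows l c (a - j). kos (Suc l) (\<lambda>i. c i - (r(l := j)) i) mu)"
  proof (rule sum.cong[OF refl])
    fix j assume "j \<in> {..min a ?b}"
    have fink: "finite {\<kappa>. strip (?b - j) \<kappa> mu}" using finite_strips_below[of "?b - j" mu] Suc.prems by simp
    have "(\<Sum>la\<in>Q. \<Sum>\<kappa>\<in>{\<kappa>. \<kappa> \<in> {\<kappa>. strip (?b - j) \<kappa> mu} \<and> strip (a - j) \<kappa> la}. kos l c la) =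
      (\<Sum>\<kappa> | strip (?b - j) \<kappa> mu. \<Sum>la\<in>{la. la \<in> Q \<and> strip (a - j) \<kappa> la}. kos l c la)"
      by (rule sum.swap_restrict[OF finQ fink])
    also have "\<dots> = (\<Sum>\<kappa> | strip (?b - j) \<kappa> mu. \<Sum>r\<in>rows l c (a - j). kos l (\<lambda>i. c i - r i) \<kappa>)"
    proof (rule sum.cong[OF refl])
      fix \<kappa> assume k: "\<kappa> \<in> {\<kappa>. strip (?b - j) \<kappa> mu}"
      then have kp: "is_part \<kappa>" "psize \<kappa> \<le> psize mu" using strip_is_part Suc.prems by (auto simp: strip_def)
      have "{la. la \<in> Q \<and> strip (a - j) \<kappa> la} = {la. strip (a - j) \<kappa> la}"
        using kp strip_is_part by (auto simp: Q strip_def)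
      then show "(\<Sum>la\<in>{la. la \<in> Q \<and> strip (a - j) \<kappa> la}. kos l c la) = (\<Sum>r\<in>rows l c (a - j). kos l (\<lambda>i. c i - r i) \<kappa>)"
        using Suc.IH[OF kp(1)] by simp
    qed
    also have "\<dots> = (\<Sum>r\<in>rows l c (a - j). \<Sum>\<kappa> | strip (?b - j) \<kappa> mu. kos l (\<lambda>i. c i - r i) \<kappa>)"
      by (rule sum.swap)
    also have "\<dots> = (\<Sum>r\<in>rows l c (a - j). kos (Suc l) (\<lambda>i. c i - (r(l := j)) i) mu)"
    proof (rule sum.cong[OF refl])
      fix r
      have "kos l (\<lambda>i. c i - (r(l := j)) i) \<kappa> = kos l (\<lambda>i. c i - r i) \<kappa>" for \<kappa>
        by (rule kos_cong) simp
      then show "(\<Sum>\<kappa> | strip (?b - j) \<kappa> mu. kos l (\<lambda>i. c i - r i) \<kappa>) = kos (Suc l) (\<lambda>i. c i - (r(l := j)) i) mu"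
        using Suc.prems by simp
    qed
    finally show "(\<Sum>la\<in>Q. \<Sum>\<kappa>\<in>{\<kappa>. \<kappa> \<in> {\<kappa>. strip (?b - j) \<kappa> mu} \<and> strip (a - j) \<kappa> la}. kos l c la) =
      (\<Sum>r\<in>rows l c (a - j). kos (Suc l) (\<lambda>i. c i - (r(l := j)) i) mu)" .
  qed
  also have "\<dots> = (\<Sum>r\<in>rows (Suc l) c a. kos (Suc l) (\<lambda>j. c j - r j) mu)"
    by (rule sum_rows_Suc[symmetric])
  finally show ?case using step1 by simp
qed

text \<open>The counting form of the Knuth correspondence, obtained by induction on the number of
  rows: the last strip of the tableau with content \<open>d\<close> becomes an added strip for the
  other tableau, and \<open>kos_remove_strip\<close> converts it into a last row \<open>r\<close> of
  the matrix.\<close>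

theorem card_mats_kos:
  assumes "sum d {..<k} = N"
  shows "card (mats k d l c) = (\<Sum>E\<in>parts N. kos k d E * kos l c E)"
  using assms
proof (induction k arbitrary: c N)
  case 0
  have "mats 0 d l c = (if \<forall>j<l. c j = 0 then {\<lambda>_ _. 0} else {})" by (auto simp: mats_def fun_eq_iff)
  moreover have "parts 0 = {\<lambda>_. 0}" using psize_zero_iff is_part_zero psize_zero by (auto simp: parts_def)
  ultimately show ?case using 0 by (simp add: kos_zero)
next
  case (Suc k)
  define M where "M = sum d {..<k}"
  have N: "N = M + d k" using Suc.prems by (simp add: M_def)
  have "(\<Sum>E\<in>parts N. kos (Suc k) d E * kos l c E) =
    (\<Sum>E\<in>parts N. \<Sum>D\<in>{D. D \<in> parts M \<and> strip (d k) D E}. kos k d D * kos l c E)"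
  proof (rule sum.cong[OF refl])
    fix E assume E: "E \<in> parts N"
    then have "{D. strip (d k) D E \<and> is_part E} = {D. D \<in> parts M \<and> strip (d k) D E}"
      using strip_is_part by (auto simp: parts_def N strip_def)
    then show "kos (Suc k) d E * kos l c E = (\<Sum>D\<in>{D. D \<in> parts M \<and> strip (d k) D E}. kos k d D * kos l c E)"
      by (simp add: sum_distrib_right)
  qed
  also have "\<dots> = (\<Sum>D\<in>parts M. \<Sum>E\<in>{E. E \<in> parts N \<and> strip (d k) D E}. kos k d D * kos l c E)"
    by (rule sum.swap_restrict[OF finite_parts finite_parts])
  also have "\<dots> = (\<Sum>D\<in>parts M. kos k d D * (\<Sum>r\<in>rows l c (d k). kos l (\<lambda>j. c j - r j) D))"
  proof (rule sum.cong[OF refl])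
    fix D assume D: "D \<in> parts M"
    then have "{E. E \<in> parts N \<and> strip (d k) D E} = {E. strip (d k) D E}"
      using strip_is_part by (auto simp: parts_def N strip_def)
    then show "(\<Sum>E\<in>{E. E \<in> parts N \<and> strip (d k) D E}. kos k d D * kos l c E) =
      kos k d D * (\<Sum>r\<in>rows l c (d k). kos l (\<lambda>j. c j - r j) D)"
      using kos_remove_strip[of D l c "d k"] D by (simp add: parts_def flip: sum_distrib_left)
  qed
  also have "\<dots> = (\<Sum>r\<in>rows l c (d k). \<Sum>D\<in>parts M. kos k d D * kos l (\<lambda>j. c j - r j) D)"
    unfolding sum_distrib_left by (rule sum.swap)
  also have "\<dots> = (\<Sum>r\<in>rows l c (d k). card (mats k d l (\<lambda>j. c j - r j)))"
    using Suc.IH M_def by simp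
  finally show ?case using card_mats_Suc by simp
qed

subsection \<open>Unitriangularity of the Kostka numbers\<close>

text \<open>The statistic usually written n(p), extended to compositions. It is also the sum of the
  row indices of all boxes, see \<open>nstat_boxes\<close>, and in that form it is compared with
  sets of cells of prescribed column lengths.\<close>

definition nstat :: "(nat \<Rightarrow> nat) \<Rightarrow> nat"
  where "nstat p = (\<Sum>i | p i \<noteq> 0. i * p i)"

lemma nstat_eq: "finite S \<Longrightarrow> (\<And>i. i \<notin> S \<Longrightarrow> p i = 0) \<Longrightarrow> nstat p = (\<Sum>i\<in>S. i * p i)"
  unfolding nstat_def by (rule sum.mono_neutral_left) (blast, (metis (mono_tags, lifting) mem_Collect_eq subsetI), simp)

lemma nstat_lessThan: "(\<And>i. i \<ge> L \<Longrightarrow> p i = 0) \<Longrightarrow> nstat p = (\<Sum>i<L. i * p i)"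
  by (rule nstat_eq) auto

lemma kos_nonzero_Suc:
  assumes "kos (Suc l) c E \<noteq> 0"
  obtains D where "strip (c l) D E" "is_part E" "is_part D" "kos l c D \<noteq> 0"
proof -
  obtain D where "strip (c l) D E" "is_part E" "kos l c D \<noteq> 0"
    using assms sum.not_neutral_contains_not_neutral by (metis (no_types, lifting) kos.simps(2) mem_Collect_eq)
  then show ?thesis using that strip_is_part by blast
qed

lemma kos_vanish: "kos l c E \<noteq> 0 \<Longrightarrow> i \<ge> l \<Longrightarrow> E i = 0"
proof (induction l arbitrary: E i)
  case 0
  then show ?case by (auto split: if_splits)
next
  case (Suc l)
  obtain D where D: "strip (c l) D E" "kos l c D \<noteq> 0" using Suc.prems(1) by (rule kos_nonzero_Suc)
  obtain j where "i = Suc j" "j \<ge> l" using Suc.prems(2) by (cases i) auto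
  then show ?case using Suc.IH[OF D(2)] D(1) by (auto simp: strip_def interlace_def) (metis le_zero_eq)
qed

text \<open>The boxes with entry \<open>i\<close> of a tableau lie in the rows up to row \<open>i\<close>.\<close>

lemma kos_triangular:
  assumes "kos l c E \<noteq> 0"
  shows "nstat E \<le> (\<Sum>i<l. i * c i)" "nstat E = (\<Sum>i<l. i * c i) \<Longrightarrow> i < l \<Longrightarrow> E i = c i"
proof -
  have "nstat E \<le> (\<Sum>i<l. i * c i) \<and> (nstat E = (\<Sum>i<l. i * c i) \<longrightarrow> (\<forall>i<l. E i = c i))"
    using assms
  proof (induction l arbitrary: E)
    case 0
    then show ?case by (auto simp: nstat_def split: if_splits)
  next
    case (Suc l)
    obtain D where D: "strip (c l) D E" "kos l c D \<noteq> 0" using Suc.prems by (rule kos_nonzero_Suc)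
    have DE: "D i \<le> E i" for i using D(1) by (simp add: strip_def interlace_def)
    have zD: "D i = 0" if "i \<ge> l" for i using kos_vanish[OF D(2) that] .
    have zE: "E i = 0" if "i \<ge> Suc l" for i using kos_vanish[OF Suc.prems that] .
    have sE: "psize E = (\<Sum>i<Suc l. E i)" by (rule psize_lessThan[OF zE])
    have sD: "psize D = (\<Sum>i<Suc l. D i)" by (rule psize_lessThan) (use zD in auto)
    have nE: "nstat E = (\<Sum>i<Suc l. i * E i)" by (rule nstat_lessThan[OF zE])
    have nD: "nstat D = (\<Sum>i<Suc l. i * D i)" by (rule nstat_lessThan) (use zD in auto)
    define x where "x i = E i - D i" for i
    have E: "E i = D i + x i" for i using DE[of i] by (simp add: x_def)
    have sx: "(\<Sum>i<Suc l. x i) = c l"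
    proof -
      have "(\<Sum>i<Suc l. E i) = (\<Sum>i<Suc l. D i) + (\<Sum>i<Suc l. x i)"
        unfolding E by (rule sum.distrib)
      then show ?thesis using D(1) sE sD by (simp add: strip_def)
    qed
    have nx: "nstat E = nstat D + (\<Sum>i<Suc l. i * x i)"
      unfolding nE nD E distrib_left by (rule sum.distrib)
    \<comment> \<open>Here \<open>x i\<close> counts the entries \<open>l\<close> in row
      \<open>i\<close>, each of which falls short of the bound by \<open>l - i\<close>. Equality
      therefore forces all of them into row \<open>l\<close>.\<close>
    have defect: "(\<Sum>i<Suc l. i * x i) + (\<Sum>i<Suc l. (l - i) * x i) = l * c l"
    proof -
      have "(\<Sum>i<Suc l. i * x i) + (\<Sum>i<Suc l. (l - i) * x i) = (\<Sum>i<Suc l. l * x i)"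
        unfolding sum.distrib[symmetric] by (rule sum.cong) (auto simp flip: add_mult_distrib)
      then show ?thesis by (simp only: sum_distrib_left[symmetric] sx)
    qed
    have IH: "nstat D \<le> (\<Sum>i<l. i * c i)" "nstat D = (\<Sum>i<l. i * c i) \<Longrightarrow> \<forall>i<l. D i = c i"
      using Suc.IH[OF D(2)] by auto
    have le: "nstat E \<le> (\<Sum>i<Suc l. i * c i)" using nx defect IH(1) by simp
    moreover have "\<forall>i<Suc l. E i = c i" if eq: "nstat E = (\<Sum>i<Suc l. i * c i)"
    proof -
      have "(\<Sum>i<Suc l. i * c i) = (\<Sum>i<l. i * c i) + l * c l" by simp
      then have "nstat D = (\<Sum>i<l. i * c i)" and z: "(\<Sum>i<Suc l. (l - i) * x i) = 0"
        using eq nx defect IH(1) by linarith+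
      then have Dc: "\<forall>i<l. D i = c i" using IH(2) by blast
      have x0: "x i = 0" if "i < l" for i using z that by auto
      then have "x l = c l" using sx by simp
      then show ?thesis using Dc x0 E zD by (auto simp: less_Suc_eq)
    qed
    ultimately show ?case by blast
  qed
  then show "nstat E \<le> (\<Sum>i<l. i * c i)" "nstat E = (\<Sum>i<l. i * c i) \<Longrightarrow> i < l \<Longrightarrow> E i = c i" by auto
qed

text \<open>Row \<open>i\<close> of the only tableau consists of entries \<open>i\<close>: removing
  the last strip leaves a shape bounded by the first \<open>l\<close> parts and of the same size as
  these, hence equal to them.\<close>

lemma kos_diagonal:
  assumes "antimono c"
  shows "kos l c (\<lambda>i. if i < l then c i else 0) = 1"
proof (induction l)
  case (Suc l)
  let ?E = "\<lambda>i. if i < Suc l then c i else 0" and ?D = "\<lambda>i. if i < l then c i else 0"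
  have ac: "c j \<le> c i" if "i \<le> j" for i j using assms that by (simp add: antimono_def)
  have part: "is_part (\<lambda>i. if i < l then c i else 0)" for l
  proof -
    have "finite {i. (if i < l then c i else 0) \<noteq> 0}" by (rule finite_subset[of _ "{..<l}"]) auto
    then show ?thesis using ac by (auto simp: is_part_def antimono_def)
  qed
  have size: "psize (\<lambda>i. if i < l then c i else 0) = sum c {..<l}" for l
    by (subst psize_lessThan[of l]) auto
  have st: "strip (c l) ?D ?E"
    unfolding strip_def size by (auto simp: interlace_def intro: ac)
  have uniq: "D = ?D" if D: "strip (c l) D ?E" "kos l c D \<noteq> 0" for D
  proof -
    have z: "D i = 0" if "i \<ge> l" for i using kos_vanish[OF D(2) that] .
    have le: "D i \<le> c i" if "i < l" for i
    proof -
      have "D i \<le> ?E i" using D(1) unfolding strip_def interlace_def by blast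
      then show ?thesis using that by simp
    qed
    have "psize D = sum c {..<l}" using kos_psize[OF D(2)] by (simp add: parts_def)
    then have "sum D {..<l} = sum c {..<l}" using psize_lessThan[OF z] by simp
    then have "D i = c i" if "i < l" for i
      using sum_mono_inv[of D "{..<l}" c i] le that by simp
    then show ?thesis using z by (auto simp: fun_eq_iff)
  qed
  have "kos (Suc l) c ?E = (\<Sum>D | strip (c l) D ?E \<and> is_part ?E. kos l c D)" by (rule kos.simps)
  also have "\<dots> = (\<Sum>D\<in>{?D}. kos l c D)"
    by (rule sum.mono_neutral_right[OF finite_strips_below]) (use st part[of "Suc l"] uniq in auto)
  finally show ?case using Suc by simp
qed simp

section \<open>Permutation modules of symmetric groups\<close>

lemma sym_group_simps [simp]:
  "p \<in> carrier (sym_group n) \<longleftrightarrow> p permutes {1..n}" "p \<otimes>\<^bsub>sym_group n\<^esub> q = p \<circ> q" "\<one>\<^bsub>sym_group n\<^esub> = id"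
  by (simp_all add: sym_group_def)

lemma finite_sym_group: "finite (carrier (sym_group n))"
  by (simp add: sym_group_def finite_permutations)

lemma permutes_mem: "p permutes {1..n} \<Longrightarrow> x \<in> {1..n} \<Longrightarrow> p x \<in> {1..n}" for x n :: nat
  by (simp only: permutes_in_image)

text \<open>Young subgroups as stabilisers of colourings. Membership becomes a pointwise condition,
  and fibre sizes of colourings replace computations with intervals; the colouring for a list of
  parts is \<open>blk\<close>.\<close>

definition colour_group :: "nat \<Rightarrow> (nat \<Rightarrow> nat) \<Rightarrow> (nat \<Rightarrow> nat) set"
  where "colour_group n c = {p. p permutes {1..n} \<and> (\<forall>x\<in>{1..n}. c (p x) = c x)}"

lemma colour_groupD:
  assumes "p \<in> colour_group n c"
  shows "p permutes {1..n}" "x \<in> {1..n} \<Longrightarrow> p x \<in> {1..n}" "x \<in> {1..n} \<Longrightarrow> c (p x) = c x"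
  using assms permutes_mem[of p n x] by (auto simp del: atLeastAtMost_iff simp: colour_group_def)

lemma colour_group_comp:
  assumes "p \<in> colour_group n c" "q \<in> colour_group n c"
  shows "p \<circ> q \<in> colour_group n c"
  using permutes_compose[OF colour_groupD(1)[OF assms(2)] colour_groupD(1)[OF assms(1)]]
    colour_groupD(2,3)[OF assms(2)] colour_groupD(3)[OF assms(1)]
  unfolding colour_group_def by simp

lemma colour_group_inv:
  assumes "p \<in> colour_group n c"
  shows "inv' p \<in> colour_group n c"
proof -
  note p = colour_groupD[OF assms]
  have i: "inv' p permutes {1..n}" by (rule permutes_inv[OF p(1)])
  have "c (inv' p x) = c x" if "x \<in> {1..n}" for x
    using p(3)[OF permutes_mem[OF i that]] permutes_inverses(1)[OF p(1)] by simp
  then show ?thesis using i by (simp add: colour_group_def)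
qed

lemma colour_group_id: "id \<in> colour_group n c"
  by (simp add: colour_group_def permutes_id)

lemma subgroup_colour_group: "subgroup (colour_group n c) (sym_group n)"
proof (rule group.subgroupI[OF sym_group_is_group])
  show "colour_group n c \<subseteq> carrier (sym_group n)" using colour_groupD(1) by auto
  show "colour_group n c \<noteq> {}" using colour_group_id by blast
  show "inv\<^bsub>sym_group n\<^esub> p \<in> colour_group n c" if "p \<in> colour_group n c" for p
    using colour_group_inv[OF that] sym_group_inv_equality[of p n] colour_groupD(1)[OF that] by simp
  show "p \<otimes>\<^bsub>sym_group n\<^esub> q \<in> colour_group n c"
    if "p \<in> colour_group n c" "q \<in> colour_group n c" for p q
    using colour_group_comp[OF that] by simp
qed

lemma trivial_character: "linear_character (sym_group n) (colour_group n c) (\<lambda>_. 1)"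
  unfolding linear_character_def linear_character_axioms_def
  using sym_group_is_group finite_sym_group subgroup_colour_group by simp

lemma sign_character: "linear_character (sym_group n) (colour_group n c) (\<lambda>p. of_int (sign p))"
proof -
  have "sign (p \<circ> q) = sign p * sign q" if "p \<in> colour_group n c" "q \<in> colour_group n c" for p q
    using that colour_groupD(1) permutes_imp_permutation[OF finite_atLeastAtMost] by (intro sign_compose) blast+
  then show ?thesis
    unfolding linear_character_def linear_character_axioms_def
    using sym_group_is_group finite_sym_group subgroup_colour_group by auto
qed

section \<open>Permutation modules of colourings and their double cosets\<close>

definition colour_module :: "nat \<Rightarrow> (nat \<Rightarrow> nat) \<Rightarrow> (nat \<Rightarrow> nat, (nat \<Rightarrow> nat) \<times> unit) crep"
  where "colour_module n c = induced (sym_group n) (sym_group n\<lparr>carrier := colour_group n c\<rparr>) id trivial_rep"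

definition twisted_colour_module :: "nat \<Rightarrow> (nat \<Rightarrow> nat) \<Rightarrow> (nat \<Rightarrow> nat, (nat \<Rightarrow> nat) \<times> unit) crep"
  where "twisted_colour_module n c = induced (sym_group n) (sym_group n\<lparr>carrier := colour_group n c\<rparr>) id sign_rep"

lemma colour_module_ind: "colour_module n c = linear_character.ind (sym_group n) (colour_group n c) (\<lambda>_. 1)"
  by (simp add: colour_module_def linear_character.ind_def[OF trivial_character] trivial_rep_char)

lemma twisted_colour_module_ind:
  "twisted_colour_module n c = linear_character.ind (sym_group n) (colour_group n c) (\<lambda>p. of_int (sign p))"
  by (simp add: twisted_colour_module_def linear_character.ind_def[OF sign_character] sign_rep_char)

lemma rep_colour_module: "representation (sym_group n) (colour_module n c)"
  unfolding colour_module_ind by (rule linear_character.ind_rep[OF trivial_character])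

lemma rep_twisted_colour_module: "representation (sym_group n) (twisted_colour_module n c)"
  unfolding twisted_colour_module_ind by (rule linear_character.ind_rep[OF sign_character])

lemma colour_module_space:
  "F \<in> space (colour_module n c) \<longleftrightarrow> (\<forall>g. \<not> g permutes {1..n} \<longrightarrow> F (g, ()) = 0) \<and>
    (\<forall>h\<in>colour_group n c. \<forall>g. g permutes {1..n} \<longrightarrow> F (h \<circ> g, ()) = F (g, ()))"
  unfolding colour_module_ind linear_character.ind_space[OF trivial_character] by (simp add: Ball_def)

lemma colour_module_act:
  "act (colour_module n c) g F (a, u) = (if a permutes {1..n} then F (a \<circ> g, ()) else 0)"
  unfolding colour_module_ind linear_character.ind_act[OF trivial_character] by simp

text \<open>The double coset of \<open>g\<close> with respect to the stabilisers of the colourings \<open>c'\<close> and \<open>c\<close>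
  corresponds to the matrix counting the letters \<open>x\<close> with colours \<open>c' (g x)\<close> and \<open>c x\<close>.\<close>

definition colour_matrix :: "nat \<Rightarrow> (nat \<Rightarrow> nat) \<Rightarrow> (nat \<Rightarrow> nat) \<Rightarrow> (nat \<Rightarrow> nat) \<Rightarrow> nat \<Rightarrow> nat \<Rightarrow> nat"
  where "colour_matrix n c' c g i j = card {x \<in> {1..n}. c' (g x) = i \<and> c x = j}"

lemma colour_matrix_left:
  assumes "g permutes {1..n}" "k \<in> colour_group n c'"
  shows "colour_matrix n c' c (k \<circ> g) = colour_matrix n c' c g"
proof (intro ext)
  fix i j
  have "{x \<in> {1..n}. c' ((k \<circ> g) x) = i \<and> c x = j} = {x \<in> {1..n}. c' (g x) = i \<and> c x = j}"
    using colour_groupD(3)[OF assms(2)] permutes_mem[OF assms(1)] by auto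
  then show "colour_matrix n c' c (k \<circ> g) i j = colour_matrix n c' c g i j" by (simp add: colour_matrix_def)
qed

lemma colour_matrix_right:
  assumes "h \<in> colour_group n c"
  shows "colour_matrix n c' c (g \<circ> h) = colour_matrix n c' c g"
proof (intro ext)
  fix i j
  note h = colour_groupD[OF assms]
  have "bij_betw h {x \<in> {1..n}. c' ((g \<circ> h) x) = i \<and> c x = j} {x \<in> {1..n}. c' (g x) = i \<and> c x = j}"
    unfolding bij_betw_def
  proof
    show "inj_on h {x \<in> {1..n}. c' ((g \<circ> h) x) = i \<and> c x = j}"
      using permutes_inj[OF h(1)] by (rule inj_on_subset) simp
    show "h ` {x \<in> {1..n}. c' ((g \<circ> h) x) = i \<and> c x = j} = {x \<in> {1..n}. c' (g x) = i \<and> c x = j}"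
    proof (intro subset_antisym subsetI)
      fix y assume "y \<in> h ` {x \<in> {1..n}. c' ((g \<circ> h) x) = i \<and> c x = j}"
      then obtain x where x: "x \<in> {1..n}" "c' (g (h x)) = i" "c x = j" "y = h x" by auto
      then show "y \<in> {x \<in> {1..n}. c' (g x) = i \<and> c x = j}" using h(2,3)[OF x(1)] by simp
    next
      fix y assume y: "y \<in> {x \<in> {1..n}. c' (g x) = i \<and> c x = j}"
      note h' = colour_groupD[OF colour_group_inv[OF assms]]
      have hy: "h (inv' h y) = y" using permutes_inverses(1)[OF h(1)] .
      have "y \<in> {1..n}" using y by simp
      then have "inv' h y \<in> {x \<in> {1..n}. c' ((g \<circ> h) x) = i \<and> c x = j}"
        using h'(2,3)[of y] y hy by simp
      then show "y \<in> h ` {x \<in> {1..n}. c' ((g \<circ> h) x) = i \<and> c x = j}" by (rule image_eqI[of y h, OF hy[symmetric]])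
    qed
  qed
  then show "colour_matrix n c' c (g \<circ> h) i j = colour_matrix n c' c g i j"
    unfolding colour_matrix_def by (rule bij_betw_same_card)
qed

text \<open>Equal matrices say that the pairs of colours at \<open>x\<close> have the same fibre
  sizes for \<open>g'\<close> and for \<open>g\<close>. A permutation \<open>h\<close> matching
  these pairs preserves \<open>c\<close>, and the remaining factor \<open>k\<close> then preserves
  \<open>c'\<close>.\<close>

lemma double_coset:
  assumes g: "g permutes {1..n}" and g': "g' permutes {1..n}"
    and eq: "colour_matrix n c' c g = colour_matrix n c' c g'"
  obtains k h where "k \<in> colour_group n c'" "h \<in> colour_group n c" "g' = k \<circ> g \<circ> h"
proof -
  have "card {x \<in> {1..n}. (c' (g' x), c x) = ij} = card {x \<in> {1..n}. (c' (g x), c x) = ij}" for ij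
    using fun_cong[OF fun_cong[OF eq, of "fst ij"], of "snd ij"]
    by (cases ij) (simp add: colour_matrix_def)
  then obtain h where h: "h permutes {1..n}"
    "\<And>x. x \<in> {1..n} \<Longrightarrow> (c' (g' x), c x) = (c' (g (h x)), c (h x))"
    using permutation_between_colourings[of "{1..n}" "\<lambda>x. (c' (g' x), c x)" "\<lambda>x. (c' (g x), c x)"]
    by (metis (no_types, lifting) finite_atLeastAtMost)
  have hc: "h \<in> colour_group n c" using h by (auto simp: colour_group_def)
  have gh: "g \<circ> h permutes {1..n}" by (rule permutes_compose[OF h(1) g])
  define k where "k = g' \<circ> inv' (g \<circ> h)"
  have kp: "k permutes {1..n}" unfolding k_def by (rule permutes_compose[OF permutes_inv[OF gh] g'])
  have "c' (k y) = c' y" if y: "y \<in> {1..n}" for y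
  proof -
    let ?x = "inv' (g \<circ> h) y"
    have x: "?x \<in> {1..n}" by (rule permutes_mem[OF permutes_inv[OF gh] y])
    have "g (h ?x) = y" using permutes_inverses(1)[OF gh, of y] by simp
    then show ?thesis using h(2)[OF x] by (simp add: k_def)
  qed
  then have "k \<in> colour_group n c'" using kp by (simp add: colour_group_def)
  moreover have "g' = k \<circ> g \<circ> h"
    unfolding k_def by (simp only: comp_assoc permutes_inv_o(2)[OF gh] comp_id)
  ultimately show ?thesis using that hc by blast
qed

text \<open>To realise a matrix, one takes \<open>M i j\<close> cells at each place
  \<open>(i, j)\<close>, numbers all cells by the letters, and corrects the numbering on both sides
  so that the column colours agree with \<open>c\<close> and the row colours with
  \<open>c'\<close>.\<close>

lemma colour_matrix_image:
  assumes "\<And>i. card {x \<in> {1..n}. c' x = i} = (if i < k then d i else 0)"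
    "\<And>j. card {x \<in> {1..n}. c x = j} = (if j < l then e j else 0)"
  shows "colour_matrix n c' c ` {g. g permutes {1..n}} = mats k d l e"
proof (intro subset_antisym subsetI)
  have cr: "c x < l" if "x \<in> {1..n}" for x
    using assms(2)[of "c x"] that by (auto split: if_splits)
  have cr': "c' x < k" if "x \<in> {1..n}" for x
    using assms(1)[of "c' x"] that by (auto split: if_splits)
  {
    fix M assume "M \<in> colour_matrix n c' c ` {g. g permutes {1..n}}"
    then obtain g where g: "g permutes {1..n}" and M: "M = colour_matrix n c' c g" by blast
    have z: "M i j = 0" if "i \<ge> k \<or> j \<ge> l" for i j
    proof -
      have "{x \<in> {1..n}. c' (g x) = i \<and> c x = j} = {}"
        using that cr cr'[OF permutes_mem[OF g]] by force
      then show ?thesis by (simp add: M colour_matrix_def)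
    qed
    have row: "(\<Sum>j<l. M i j) = d i" if "i < k" for i
    proof -
      have "(\<Sum>j<l. M i j) = card (\<Union>j<l. {x \<in> {1..n}. c' (g x) = i \<and> c x = j})"
        unfolding M colour_matrix_def by (rule card_UN_disjoint[symmetric]) auto
      also have "(\<Union>j<l. {x \<in> {1..n}. c' (g x) = i \<and> c x = j}) = {x \<in> {1..n}. c' (g x) = i}"
        using cr by auto
      also have "card \<dots> = card (g ` {x \<in> {1..n}. c' (g x) = i})"
        by (rule card_image[symmetric]) (rule inj_on_subset[OF permutes_inj[OF g]], simp)
      also have "g ` {x \<in> {1..n}. c' (g x) = i} = {x \<in> {1..n}. c' x = i}"
      proof (intro subset_antisym subsetI)
        fix y assume y: "y \<in> {x \<in> {1..n}. c' x = i}"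
        have gy: "g (inv' g y) = y" by (rule permutes_inverses(1)[OF g])
        have "inv' g y \<in> {1..n}" using permutes_mem[OF permutes_inv[OF g], of y] y by blast
        then have "inv' g y \<in> {x \<in> {1..n}. c' (g x) = i}" using gy y by simp
        then show "y \<in> g ` {x \<in> {1..n}. c' (g x) = i}" by (rule image_eqI[of y g, OF gy[symmetric]])
      qed (use permutes_mem[OF g] in auto)
      finally show ?thesis using assms(1)[of i] that by simp
    qed
    have col: "(\<Sum>i<k. M i j) = e j" if "j < l" for j
    proof -
      have "(\<Sum>i<k. M i j) = card (\<Union>i<k. {x \<in> {1..n}. c' (g x) = i \<and> c x = j})"
        unfolding M colour_matrix_def by (rule card_UN_disjoint[symmetric]) auto
      also have "(\<Union>i<k. {x \<in> {1..n}. c' (g x) = i \<and> c x = j}) = {x \<in> {1..n}. c x = j}"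
        using cr'[OF permutes_mem[OF g]] by auto
      finally show ?thesis using assms(2)[of j] that by simp
    qed
    show "M \<in> mats k d l e" unfolding mats_def using z row col by blast
  }
  {
    fix M assume M: "M \<in> mats k d l e"
    \<comment> \<open>The cells; their number is \<open>n\<close> because the column sums of
      \<open>M\<close> are the fibre sizes of \<open>c\<close>.\<close>
    let ?S = "SIGMA i:{..<k}. SIGMA j:{..<l}. {..<M i j}"
    have "card {1..n} = (\<Sum>j<l. card {x \<in> {1..n}. c x = j})"
    proof -
      have "{1..n} = (\<Union>j<l. {x \<in> {1..n}. c x = j})" using cr by auto
      then have "card {1..n} = card (\<Union>j<l. {x \<in> {1..n}. c x = j})" by (rule arg_cong)
      also have "\<dots> = (\<Sum>j<l. card {x \<in> {1..n}. c x = j})" by (rule card_UN_disjoint) auto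
      finally show ?thesis .
    qed
    also have "\<dots> = (\<Sum>j<l. e j)" using assms(2) by simp
    also have "\<dots> = (\<Sum>j<l. \<Sum>i<k. M i j)" using M by (simp add: mats_def)
    also have "\<dots> = (\<Sum>i<k. \<Sum>j<l. M i j)" by (rule sum.swap)
    also have "\<dots> = card ?S" by simp
    finally have "\<exists>f. bij_betw f {1..n} ?S" by (intro finite_same_card_bij) auto
    then obtain f where f: "bij_betw f {1..n} ?S" by blast
    define r s where "r x = fst (f x)" and "s x = fst (snd (f x))" for x
    have fiber: "card {x \<in> {1..n}. P (f x)} = card {y \<in> ?S. P y}" for P
    proof (rule bij_betw_same_card)
      show "bij_betw f {x \<in> {1..n}. P (f x)} {y \<in> ?S. P y}"
        unfolding bij_betw_def
      proof
        show "inj_on f {x \<in> {1..n}. P (f x)}"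
          using bij_betw_imp_inj_on[OF f] by (rule inj_on_subset) blast
        have "f ` {x \<in> {1..n}. P (f x)} = {y \<in> f ` {1..n}. P y}" by blast
        then show "f ` {x \<in> {1..n}. P (f x)} = {y \<in> ?S. P y}"
          by (simp only: bij_betw_imp_surj_on[OF f])
      qed
    qed
    have Mz: "M i j = 0" if "\<not> (i < k \<and> j < l)" for i j using M that by (auto simp: mats_def)
    have content: "card {x \<in> {1..n}. r x = i \<and> s x = j} = M i j" for i j
    proof -
      have "card {x \<in> {1..n}. r x = i \<and> s x = j} = card {y \<in> ?S. fst y = i \<and> fst (snd y) = j}"
        unfolding r_def s_def by (rule fiber)
      also have "{y \<in> ?S. fst y = i \<and> fst (snd y) = j} = (\<lambda>t. (i, j, t)) ` {..<M i j}"
        using Mz[of i j] by (cases "i < k \<and> j < l") auto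
      also have "card \<dots> = M i j" by (subst card_image) (auto simp: inj_on_def)
      finally show ?thesis .
    qed
    have rs: "r x < k" "s x < l" if "x \<in> {1..n}" for x
      using bij_betwE[OF f, rule_format, OF that] by (auto simp: r_def s_def)
    have s_fib: "card {x \<in> {1..n}. c x = j} = card {x \<in> {1..n}. s x = j}" for j
    proof (cases "j < l")
      case True
      have "card {x \<in> {1..n}. s x = j} = card (\<Union>i<k. {x \<in> {1..n}. r x = i \<and> s x = j})"
        by (rule arg_cong[of _ _ card]) (use rs in auto)
      also have "\<dots> = (\<Sum>i<k. card {x \<in> {1..n}. r x = i \<and> s x = j})" by (rule card_UN_disjoint) auto
      also have "\<dots> = e j" unfolding content using M True by (simp add: mats_def)
      finally show ?thesis using assms(2)[of j] True by simp
    next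
      case False
      then have "{x \<in> {1..n}. s x = j} = {}" using rs(2) by auto
      then show ?thesis using assms(2)[of j] False by (simp del: Collect_empty_eq)
    qed
    have r_fib: "card {x \<in> {1..n}. c' x = i} = card {x \<in> {1..n}. r x = i}" for i
    proof (cases "i < k")
      case True
      have "card {x \<in> {1..n}. r x = i} = card (\<Union>j<l. {x \<in> {1..n}. r x = i \<and> s x = j})"
        by (rule arg_cong[of _ _ card]) (use rs in auto)
      also have "\<dots> = (\<Sum>j<l. card {x \<in> {1..n}. r x = i \<and> s x = j})" by (rule card_UN_disjoint) auto
      also have "\<dots> = d i" unfolding content using M True by (simp add: mats_def)
      finally show ?thesis using assms(1)[of i] True by simp
    next
      case False
      then have "{x \<in> {1..n}. r x = i} = {}" using rs(1) by auto
      then show ?thesis using assms(1)[of i] False by (simp del: Collect_empty_eq)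
    qed
    \<comment> \<open>With this \<open>p\<close> and the \<open>q\<close> below, the letter
      \<open>x\<close> has colours \<open>r (p x)\<close> and \<open>s (p x)\<close> under
      \<open>q \<circ> p\<close>, so the cell of \<open>p x\<close> determines both.\<close>
    obtain p where p: "p permutes {1..n}" "\<And>x. x \<in> {1..n} \<Longrightarrow> c x = s (p x)"
      using permutation_between_colourings[of "{1..n}" c s] s_fib by (metis finite_atLeastAtMost)
    obtain q where q: "q permutes {1..n}" "\<And>x. x \<in> {1..n} \<Longrightarrow> r x = c' (q x)"
      using permutation_between_colourings[of "{1..n}" r c'] r_fib by (metis finite_atLeastAtMost)
    have "colour_matrix n c' c (q \<circ> p) i j = M i j" for i j
    proof -
      have eq: "{x \<in> {1..n}. c' ((q \<circ> p) x) = i \<and> c x = j} = {x \<in> {1..n}. r (p x) = i \<and> s (p x) = j}"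
        using p q permutes_mem[OF p(1)] by auto
      have "card {x \<in> {1..n}. r (p x) = i \<and> s (p x) = j} = card (p ` {x \<in> {1..n}. r (p x) = i \<and> s (p x) = j})"
        by (rule card_image[symmetric]) (rule inj_on_subset[OF permutes_inj[OF p(1)]], simp)
      also have "p ` {x \<in> {1..n}. r (p x) = i \<and> s (p x) = j} = {x \<in> {1..n}. r x = i \<and> s x = j}"
      proof (intro subset_antisym subsetI)
        fix y assume y: "y \<in> {x \<in> {1..n}. r x = i \<and> s x = j}"
        have py: "p (inv' p y) = y" by (rule permutes_inverses(1)[OF p(1)])
        have "inv' p y \<in> {1..n}" using permutes_mem[OF permutes_inv[OF p(1)], of y] y by blast
        then have "inv' p y \<in> {x \<in> {1..n}. r (p x) = i \<and> s (p x) = j}" using py y by simp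
        then show "y \<in> p ` {x \<in> {1..n}. r (p x) = i \<and> s (p x) = j}" by (rule image_eqI[of y p, OF py[symmetric]])
      qed (use permutes_mem[OF p(1)] in auto)
      finally show ?thesis unfolding colour_matrix_def content eq .
    qed
    then have "M = colour_matrix n c' c (q \<circ> p)" by (simp add: fun_eq_iff)
    then show "M \<in> colour_matrix n c' c ` {g. g permutes {1..n}}"
      using permutes_compose[OF p(1) q(1)] by blast
  }
qed

text \<open>Mackey's formula for permutation modules: by reciprocity the intertwiners are the
  functions on the group that are invariant on the left under one stabiliser and on the right under
  the other, that is, functions of the colour matrix.\<close>

theorem hom_dim_colour_modules:
  assumes "\<And>i. card {x \<in> {1..n}. c' x = i} = (if i < k then d i else 0)"
    "\<And>j. card {x \<in> {1..n}. c x = j} = (if j < l then e j else 0)"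
  shows "hom_dim (sym_group n) (colour_module n c) (colour_module n c') = card (mats k d l e)"
proof -
  interpret linear_character "sym_group n" "colour_group n c" "\<lambda>_. 1" by (rule trivial_character)
  let ?W = "colour_module n c'" and ?S = "{g. g permutes {1..n}}"
  have "isotypic ?W = {F. (\<forall>a. a \<notin> ?S \<longrightarrow> F (a, ()) = 0) \<and>
    (\<forall>a\<in>?S. \<forall>b\<in>?S. colour_matrix n c' c a = colour_matrix n c' c b \<longrightarrow> F (a, ()) = F (b, ()))}" (is "_ = ?C")
  proof (intro subset_antisym subsetI)
    fix F assume F: "F \<in> isotypic ?W"
    then have Fs: "F \<in> space ?W" and Fr: "\<And>h. h \<in> colour_group n c \<Longrightarrow> act ?W h F = F"
      by (auto simp: isotypic_def)
    have right: "F (g \<circ> h, ()) = F (g, ())" if "g permutes {1..n}" "h \<in> colour_group n c" for g h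
      using fun_cong[OF Fr[OF that(2)], of "(g, ())"] that(1) by (simp add: colour_module_act)
    have "F (a, ()) = F (b, ())"
      if ab: "a permutes {1..n}" "b permutes {1..n}" "colour_matrix n c' c a = colour_matrix n c' c b" for a b
    proof -
      obtain k h where kh: "k \<in> colour_group n c'" "h \<in> colour_group n c" "b = k \<circ> a \<circ> h"
        using double_coset[OF ab] by blast
      have "k \<circ> a permutes {1..n}" by (rule permutes_compose[OF ab(1) colour_groupD(1)[OF kh(1)]])
      then show ?thesis using right[OF _ kh(2)] kh(1,3) Fs ab(1) by (simp add: colour_module_space)
    qed
    moreover have "\<And>a. \<not> a permutes {1..n} \<Longrightarrow> F (a, ()) = 0" using Fs by (simp add: colour_module_space)
    ultimately show "F \<in> ?C" by blast
  next
    fix F assume F: "F \<in> ?C"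
    then have cls: "F (a, ()) = F (b, ())"
      if "a permutes {1..n}" "b permutes {1..n}" "colour_matrix n c' c a = colour_matrix n c' c b" for a b
      using that by blast
    have "\<forall>a. a \<notin> ?S \<longrightarrow> F (a, ()) = 0" using CollectD[OF F] by (rule conjunct1)
    then have z: "F (a, ()) = 0" if "\<not> a permutes {1..n}" for a using that by (metis mem_Collect_eq)
    have "F (h \<circ> g, ()) = F (g, ())" if "h \<in> colour_group n c'" "g permutes {1..n}" for h g
      by (rule cls[OF permutes_compose[OF that(2) colour_groupD(1)[OF that(1)]] that(2) colour_matrix_left[OF that(2,1)]])
    moreover have r: "F (g \<circ> h, ()) = F (g, ())" if "h \<in> colour_group n c" "g permutes {1..n}" for h g
      by (rule cls[OF permutes_compose[OF colour_groupD(1)[OF that(1)] that(2)] that(2) colour_matrix_right[OF that(1)]])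
    moreover have "act ?W h F = cscale 1 F" if "h \<in> colour_group n c" for h
    proof (rule ext, clarify)
      fix a show "act ?W h F (a, ()) = cscale 1 F (a, ())"
        using r[OF that] z by (simp add: colour_module_act cscale_def)
    qed
    ultimately show "F \<in> isotypic ?W" unfolding isotypic_def colour_module_space using z by blast
  qed
  then have "cfun.dim (isotypic ?W) = cfun.dim ?C" by (rule arg_cong)
  also have "\<dots> = card (colour_matrix n c' c ` ?S)"
    by (rule dim_class_functions[OF finite_permutations[OF finite_atLeastAtMost]])
  also have "\<dots> = card (mats k d l e)"
    by (rule arg_cong[OF colour_matrix_image[OF assms]])
  finally have "cfun.dim (isotypic ?W) = card (mats k d l e)" .
  then show ?thesis
    using frobenius[OF rep_colour_module, of c'] by (simp only: colour_module_ind[of n c])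
qed

subsection \<open>Intertwiners between twisted and untwisted modules\<close>

text \<open>If two letters share both colours, their transposition acts on the right by the sign -1,
  while the same element arises from a transposition on the left, which acts trivially. So
  \<open>F\<close> would vanish at \<open>g\<close>.\<close>

lemma colours_injective:
  assumes "F \<in> space (colour_module n c')" "g permutes {1..n}" "F (g, ()) \<noteq> 0"
    "\<And>h. h \<in> colour_group n c \<Longrightarrow> F (g \<circ> h, ()) = of_int (sign h) * F (g, ())"
  shows "inj_on (\<lambda>x. (c' (g x), c x)) {1..n}"
proof (rule inj_onI, rule ccontr)
  fix x y assume x: "x \<in> {1..n}" and y: "y \<in> {1..n}" and eq: "(c' (g x), c x) = (c' (g y), c y)" and ne: "x \<noteq> y"
  let ?h = "Transposition.transpose x y" and ?k = "Transposition.transpose (g x) (g y)"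
  have h: "?h \<in> colour_group n c"
    unfolding colour_group_def using permutes_swap_id[OF x y] eq by (auto simp: Transposition.transpose_def)
  have k: "?k \<in> colour_group n c'"
    unfolding colour_group_def using permutes_swap_id[OF permutes_mem[OF assms(2) x] permutes_mem[OF assms(2) y]] eq
    by (auto simp: Transposition.transpose_def)
  have "g \<circ> ?h = ?k \<circ> g"
    using permutes_inj[OF assms(2)] by (auto simp: fun_eq_iff Transposition.transpose_def inj_eq)
  then have "F (g \<circ> ?h, ()) = F (g, ())"
    using assms(1) k assms(2) by (simp add: colour_module_space)
  moreover have "F (g \<circ> ?h, ()) = - F (g, ())" using assms(4)[OF h] ne by (simp add: sign_swap_id)
  ultimately show False using assms(3) by simp
qed

lemma twisted_hom_injective:
  assumes "hom_dim (sym_group n) (twisted_colour_module n c) (colour_module n c') > 0"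
  obtains g where "g permutes {1..n}" "inj_on (\<lambda>x. (c' (g x), c x)) {1..n}"
proof -
  interpret linear_character "sym_group n" "colour_group n c" "\<lambda>p. of_int (sign p)" by (rule sign_character)
  let ?W = "colour_module n c'"
  have fd: "fin_dim (isotypic ?W)" by (rule fin_dim_isotypic[OF rep_colour_module])
  have "cfun.dim (isotypic ?W) > 0"
    using assms unfolding twisted_colour_module_ind frobenius[OF rep_colour_module] .
  then have "isotypic ?W \<noteq> {0}" using dim_zero_iff[OF fd] by simp
  then obtain F where F: "F \<in> isotypic ?W" "F \<noteq> 0" using cfun.subspace_0[OF fin_dim_subspace[OF fd]] by blast
  then obtain g where g: "F (g, ()) \<noteq> 0" by (auto simp: fun_eq_iff)
  have Fs: "F \<in> space ?W" using F(1) by (simp add: isotypic_def)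
  then have gp: "g permutes {1..n}" using g unfolding colour_module_space by blast
  have "F (g \<circ> h, ()) = of_int (sign h) * F (g, ())" if "h \<in> colour_group n c" for h
  proof -
    have "act ?W h F = cscale (of_int (sign h)) F" using F(1) that by (simp add: isotypic_def)
    from fun_cong[OF this, of "(g, ())"] show ?thesis using gp by (simp add: colour_module_act cscale_def)
  qed
  then show ?thesis using that gp colours_injective[OF Fs gp g] by blast
qed

text \<open>By \<open>uniq\<close> and \<open>double_coset\<close> every injective \<open>g\<close>
  lies in the double coset of \<open>g0\<close>, and elsewhere isotypic functions vanish. On that
  double coset such a function is determined by its value at \<open>g0\<close>; \<open>F0\<close> is
  the one with value 1.\<close>

lemma twisted_hom_dim_one:
  assumes g0: "g0 permutes {1..n}" and inj0: "inj_on (\<lambda>x. (c' (g0 x), c x)) {1..n}"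
    and uniq: "\<And>g. g permutes {1..n} \<Longrightarrow> inj_on (\<lambda>x. (c' (g x), c x)) {1..n} \<Longrightarrow>
      colour_matrix n c' c g = colour_matrix n c' c g0"
  shows "hom_dim (sym_group n) (twisted_colour_module n c) (colour_module n c') = 1"
proof -
  interpret linear_character "sym_group n" "colour_group n c" "\<lambda>p. of_int (sign p)" by (rule sign_character)
  let ?W = "colour_module n c'" and ?H = "colour_group n c" and ?K = "colour_group n c'"
  have sgn: "sign (h \<circ> h') = sign h * sign h'" if "h \<in> ?H" "h' \<in> ?H" for h h'
    using that colour_groupD(1) permutes_imp_permutation[OF finite_atLeastAtMost] by (intro sign_compose) blast+
  \<comment> \<open>All factorisations of \<open>g\<close> through \<open>g0\<close>. Summing signs
    over them gives \<open>F0\<close>, and the invariances of \<open>F0\<close> are shifts of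
    \<open>k\<close> and of \<open>h\<close>.\<close>
  define S where "S g = {(k, h). k \<in> ?K \<and> h \<in> ?H \<and> k \<circ> g0 \<circ> h = g}" for g
  define F0 where "F0 = (\<lambda>(g, u :: unit). \<Sum>(k, h)\<in>S g. complex_of_int (sign h))"
  have F0: "F0 (g, ()) = (\<Sum>(k, h)\<in>S g. of_int (sign h))" for g by (simp add: F0_def)
  have comp_perm: "k \<circ> g0 \<circ> h permutes {1..n}" if "k \<in> ?K" "h \<in> ?H" for k h
    by (rule permutes_compose[OF colour_groupD(1)[OF that(2)] permutes_compose[OF g0 colour_groupD(1)[OF that(1)]]])
  have F0_left: "F0 (k \<circ> g, ()) = F0 (g, ())" if k: "k \<in> ?K" for k g
    unfolding F0
  proof (rule sum.reindex_bij_witness[where i = "\<lambda>(k', h). (k \<circ> k', h)" and j = "\<lambda>(k', h). (inv' k \<circ> k', h)"])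
    have kk: "inv' k \<circ> k = id" "k \<circ> inv' k = id" using permutes_inv_o[OF colour_groupD(1)[OF k]] by auto
    have c1: "inv' k \<circ> (k \<circ> f) = f" "k \<circ> (inv' k \<circ> f) = f" for f :: "nat \<Rightarrow> nat"
      using kk by (simp_all flip: comp_assoc)
    note cl = colour_group_comp[OF k] colour_group_comp[OF colour_group_inv[OF k]]
    {
      fix a assume a: "a \<in> S (k \<circ> g)"
      obtain k' h where kh: "a = (k', h)" by force
      have m: "k' \<in> ?K" "h \<in> ?H" "k' \<circ> g0 \<circ> h = k \<circ> g" using a kh by (auto simp: S_def)
      have "inv' k \<circ> k' \<circ> g0 \<circ> h = inv' k \<circ> (k' \<circ> g0 \<circ> h)" by (simp add: comp_assoc)
      also have "\<dots> = g" unfolding m(3) by (rule c1)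
      finally show "(\<lambda>(k', h). (inv' k \<circ> k', h)) a \<in> S g" using m cl(2) kh by (simp add: S_def)
      show "(\<lambda>(k', h). (k \<circ> k', h)) ((\<lambda>(k', h). (inv' k \<circ> k', h)) a) = a" by (simp add: kh c1)
      show "(case (\<lambda>(k', h). (inv' k \<circ> k', h)) a of (k, h) \<Rightarrow> complex_of_int (sign h)) = (case a of (k, h) \<Rightarrow> of_int (sign h))"
        by (simp add: kh)
    }
    {
      fix b assume b: "b \<in> S g"
      obtain k' h where kh: "b = (k', h)" by force
      have m: "k' \<in> ?K" "h \<in> ?H" "k' \<circ> g0 \<circ> h = g" using b kh by (auto simp: S_def)
      have "k \<circ> k' \<circ> g0 \<circ> h = k \<circ> (k' \<circ> g0 \<circ> h)" by (simp add: comp_assoc)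
      then show "(\<lambda>(k', h). (k \<circ> k', h)) b \<in> S (k \<circ> g)" using m cl(1) kh by (simp add: S_def)
      show "(\<lambda>(k', h). (inv' k \<circ> k', h)) ((\<lambda>(k', h). (k \<circ> k', h)) b) = b" by (simp add: kh c1)
    }
  qed
  have F0_right: "F0 (g \<circ> h, ()) = of_int (sign h) * F0 (g, ())" if h: "h \<in> ?H" for h g
    unfolding F0 sum_distrib_left
  proof (rule sum.reindex_bij_witness[where i = "\<lambda>(k, h'). (k, h' \<circ> h)" and j = "\<lambda>(k, h'). (k, h' \<circ> inv' h)"])
    have hh: "inv' h \<circ> h = id" "h \<circ> inv' h = id" using permutes_inv_o[OF colour_groupD(1)[OF h]] by auto
    have c1: "f \<circ> h \<circ> inv' h = f" "f \<circ> inv' h \<circ> h = f" for f :: "nat \<Rightarrow> nat"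
      using hh by (simp_all add: comp_assoc)
    note cl = colour_group_comp[OF _ h] colour_group_comp[OF _ colour_group_inv[OF h]]
    {
      fix a assume a: "a \<in> S (g \<circ> h)"
      obtain k h' where kh: "a = (k, h')" by force
      have m: "k \<in> ?K" "h' \<in> ?H" "k \<circ> g0 \<circ> h' = g \<circ> h" using a kh by (auto simp: S_def)
      have "k \<circ> g0 \<circ> (h' \<circ> inv' h) = (k \<circ> g0 \<circ> h') \<circ> inv' h" by (simp add: comp_assoc)
      also have "\<dots> = g" unfolding m(3) by (rule c1)
      finally show "(\<lambda>(k, h'). (k, h' \<circ> inv' h)) a \<in> S g" using m cl(2) kh by (simp add: S_def)
      show "(\<lambda>(k, h'). (k, h' \<circ> h)) ((\<lambda>(k, h'). (k, h' \<circ> inv' h)) a) = a" by (simp add: kh c1)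
      have "h' \<circ> inv' h \<circ> h = h'" by (rule c1)
      then have "sign h' = sign (h' \<circ> inv' h) * sign h" using sgn[OF cl(2)[OF m(2)] h] by simp
      then show "of_int (sign h) * (case (\<lambda>(k, h'). (k, h' \<circ> inv' h)) a of (k, h) \<Rightarrow> complex_of_int (sign h)) =
        (case a of (k, h) \<Rightarrow> of_int (sign h))"
        by (simp add: kh mult.commute)
    }
    {
      fix b assume b: "b \<in> S g"
      obtain k h' where kh: "b = (k, h')" by force
      have m: "k \<in> ?K" "h' \<in> ?H" "k \<circ> g0 \<circ> h' = g" using b kh by (auto simp: S_def)
      have "k \<circ> g0 \<circ> (h' \<circ> h) = (k \<circ> g0 \<circ> h') \<circ> h" by (simp add: comp_assoc)
      then show "(\<lambda>(k, h'). (k, h' \<circ> h)) b \<in> S (g \<circ> h)" using m cl(1) kh by (simp add: S_def)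
      show "(\<lambda>(k, h'). (k, h' \<circ> inv' h)) ((\<lambda>(k, h'). (k, h' \<circ> h)) b) = b" by (simp add: kh c1)
    }
  qed
  have F0_zero: "F0 (g, ()) = 0" if "\<not> g permutes {1..n}" for g
  proof -
    have "S g = {}" using comp_perm that by (auto simp: S_def)
    then show ?thesis by (simp add: F0)
  qed
  \<comment> \<open>A factorisation of \<open>g0\<close> makes \<open>x\<close> and
    \<open>h x\<close> share both colours, so \<open>h\<close> is the identity by injectivity, and
    then so is \<open>k\<close>. Hence there is no cancellation in \<open>F0\<close> at
    \<open>g0\<close>.\<close>
  have "S g0 = {(id, id)}"
  proof (intro subset_antisym subsetI)
    fix a assume a: "a \<in> S g0"
    obtain k h where kh: "a = (k, h)" by force
    have m: "k \<in> ?K" "h \<in> ?H" "k \<circ> g0 \<circ> h = g0" using a kh by (auto simp: S_def)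
    have "h x = x" for x
    proof (cases "x \<in> {1..n}")
      case True
      have hx: "h x \<in> {1..n}" by (rule colour_groupD(2)[OF m(2) True])
      have "c' (g0 x) = c' (k (g0 (h x)))" using fun_cong[OF m(3), of x] by simp
      also have "\<dots> = c' (g0 (h x))" by (rule colour_groupD(3)[OF m(1) permutes_mem[OF g0 hx]])
      finally have "(c' (g0 (h x)), c (h x)) = (c' (g0 x), c x)" using colour_groupD(3)[OF m(2) True] by simp
      then show ?thesis using inj_onD[OF inj0 _ hx True] by blast
    next
      case False
      then show ?thesis using permutes_not_in[OF colour_groupD(1)[OF m(2)]] by blast
    qed
    then have h: "h = id" by auto
    have "k y = y" for y
    proof -
      have "g0 (inv' g0 y) = y" by (rule permutes_inverses(1)[OF g0])
      then show ?thesis using fun_cong[OF m(3), of "inv' g0 y"] h by simp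
    qed
    then show "a \<in> {(id, id)}" using kh h by auto
  qed (auto simp: S_def colour_group_id)
  then have F0_g0: "F0 (g0, ()) = 1" by (simp add: F0)
  have F0_space: "F0 \<in> space ?W" unfolding colour_module_space using F0_zero F0_left by blast
  have F0_iso: "F0 \<in> isotypic ?W"
  proof -
    have "act ?W h F0 = cscale (of_int (sign h)) F0" if "h \<in> ?H" for h
      using F0_right[OF that] F0_zero by (auto simp: fun_eq_iff colour_module_act cscale_def)
    then show ?thesis using F0_space by (simp add: isotypic_def)
  qed
  have multiple: "F = cscale (F (g0, ())) F0" if F: "F \<in> isotypic ?W" for F
  proof (rule ext, clarify)
    fix g
    have Fs: "F \<in> space ?W" using F by (simp add: isotypic_def)
    have Fz: "F (g, ()) = 0" if "\<not> g permutes {1..n}" for g using Fs that unfolding colour_module_space by blast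
    have Fl: "F (k \<circ> g, ()) = F (g, ())" if "k \<in> ?K" "g permutes {1..n}" for k g
      using Fs that unfolding colour_module_space by blast
    have Fr: "F (g \<circ> h, ()) = of_int (sign h) * F (g, ())" if "h \<in> ?H" "g permutes {1..n}" for h g
    proof -
      have "act ?W h F = cscale (of_int (sign h)) F" using F that(1) by (simp add: isotypic_def)
      from fun_cong[OF this, of "(g, ())"] show ?thesis using that(2) by (simp add: colour_module_act cscale_def)
    qed
    show "F (g, ()) = cscale (F (g0, ())) F0 (g, ())"
    proof (cases "g permutes {1..n} \<and> inj_on (\<lambda>x. (c' (g x), c x)) {1..n}")
      case True
      then obtain k h where kh: "k \<in> ?K" "h \<in> ?H" "g = k \<circ> g0 \<circ> h"
        using double_coset[OF g0 _ uniq[symmetric], of g] by blast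
      have "k \<circ> g0 permutes {1..n}" by (rule permutes_compose[OF g0 colour_groupD(1)[OF kh(1)]])
      then have "F (g, ()) = of_int (sign h) * F (g0, ())"
        using kh Fr[OF kh(2)] Fl[OF kh(1) g0] by simp
      moreover have "F0 (g, ()) = of_int (sign h)"
        using kh F0_right[OF kh(2)] F0_left[OF kh(1)] F0_g0 by simp
      ultimately show ?thesis by (simp add: cscale_def)
    next
      case False
      have "F (g, ()) = 0"
        using False Fz colours_injective[OF Fs _ _ Fr, of g c] by blast
      moreover have "F0 (g, ()) = 0"
        using False F0_zero colours_injective[OF F0_space _ _ F0_right, of g c] by blast
      ultimately show ?thesis by (simp add: cscale_def)
    qed
  qed
  have fd: "fin_dim (isotypic ?W)" by (rule fin_dim_isotypic[OF rep_colour_module])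
  have "cfun.dim (isotypic ?W) = 1"
  proof (rule dim_one[OF fd F0_iso])
    show "F0 \<noteq> 0" using F0_g0 by (metis zero_fun_apply zero_neq_one)
    show "\<exists>a. F = cscale a F0" if "F \<in> isotypic ?W" for F using multiple[OF that] by blast
  qed
  then show ?thesis unfolding twisted_colour_module_ind frobenius[OF rep_colour_module] .
qed

subsection \<open>Young diagrams\<close>

text \<open>With \<open>m\<close> elements in \<open>A\<close>, those outside the initial segment
  are at least \<open>m\<close>, the missing numbers are at most \<open>m - 1\<close>, and there are
  equally many of both. The surplus of one for each exchanged pair gives the case of
  equality.\<close>

lemma sum_initial_segment_min:
  fixes A :: "nat set"
  assumes "finite A"
  shows "\<Sum>{..<card A} \<le> \<Sum>A" "\<Sum>A = \<Sum>{..<card A} \<Longrightarrow> A = {..<card A}"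
proof -
  define m where "m = card A"
  let ?B = "{..<m}"
  have A: "\<Sum>A = \<Sum>(A \<inter> ?B) + \<Sum>(A - ?B)" using sum.Int_Diff[OF assms] .
  have B: "\<Sum>?B = \<Sum>(A \<inter> ?B) + \<Sum>(?B - A)" using sum.Int_Diff[of ?B "\<lambda>x. x" A] by (simp add: Int_commute)
  have "card A = card (A \<inter> ?B) + card (A - ?B)" "card ?B = card (A \<inter> ?B) + card (?B - A)"
    using card_Int_Diff[OF assms, of ?B] card_Int_Diff[of ?B A] by (auto simp: Int_commute)
  then have card: "card (A - ?B) = card (?B - A)" by (simp add: m_def)
  have "m * card (A - ?B) = (\<Sum>x\<in>A - ?B. m)" by simp
  also have "\<dots> \<le> \<Sum>(A - ?B)" by (rule sum_mono) auto
  finally have 1: "m * card (A - ?B) \<le> \<Sum>(A - ?B)" .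
  have "\<Sum>(?B - A) + card (?B - A) = (\<Sum>x\<in>?B - A. Suc x)" by (simp add: sum_Suc)
  also have "\<dots> \<le> (\<Sum>x\<in>?B - A. m)" by (rule sum_mono) auto
  finally have "\<Sum>(?B - A) + card (?B - A) \<le> m * card (A - ?B)" by (simp add: card mult.commute)
  then have 2: "\<Sum>(?B - A) + card (?B - A) \<le> \<Sum>(A - ?B)" using 1 by (rule order_trans)
  show "\<Sum>{..<card A} \<le> \<Sum>A" using A B 2 unfolding m_def[symmetric] by linarith
  assume "\<Sum>A = \<Sum>{..<card A}"
  then have "card (?B - A) = 0" using A B 2 unfolding m_def[symmetric] by linarith
  then have "?B \<subseteq> A" by simp
  then have "?B = A" using card_subset_eq[OF assms, of ?B] by (simp add: m_def)
  then show "A = {..<card A}" by (simp add: m_def)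
qed

lemma column_sum:
  fixes P :: "(nat \<times> nat) set"
  assumes "finite P" "\<And>i j. (i, j) \<in> P \<Longrightarrow> j < J"
  shows "(\<Sum>b\<in>P. fst b) = (\<Sum>j<J. \<Sum>{i. (i, j) \<in> P})"
proof -
  have fin: "finite {i. (i, j) \<in> P}" for j
    by (rule finite_subset[OF _ finite_imageI[OF assms(1), of fst]]) force
  have "(\<Sum>j<J. \<Sum>{i. (i, j) \<in> P}) = (\<Sum>(j, i)\<in>(SIGMA j:{..<J}. {i. (i, j) \<in> P}). i)"
    by (rule sum.Sigma) (use fin in auto)
  also have "\<dots> = (\<Sum>b\<in>P. fst b)"
    by (rule sum.reindex_bij_witness[where i = prod.swap and j = prod.swap]) (use assms(2) in auto)
  finally show ?thesis by simp
qed

text \<open>Pushing each column to the top minimises the total row index. With the column lengths of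
  a diagram as \<open>m\<close>, this replaces an argument with the dominance order.\<close>

lemma column_sum_min:
  fixes P B :: "(nat \<times> nat) set"
  assumes "finite P" "finite B" "\<And>j. card {i. (i, j) \<in> P} = m j" "\<And>j. {i. (i, j) \<in> B} = {..<m j}"
  shows "(\<Sum>b\<in>B. fst b) \<le> (\<Sum>b\<in>P. fst b)" "(\<Sum>b\<in>P. fst b) = (\<Sum>b\<in>B. fst b) \<Longrightarrow> P = B"
proof -
  obtain J where J: "\<And>i j. (i, j) \<in> P \<union> B \<Longrightarrow> j < J"
  proof -
    have "finite (snd ` (P \<union> B))" using assms(1,2) by simp
    then obtain J where "\<forall>j\<in>snd ` (P \<union> B). j < J" using finite_nat_set_iff_bounded by blast
    then have "j < J" if "(i, j) \<in> P \<union> B" for i j using that by (metis imageI snd_conv)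
    then show ?thesis using that by blast
  qed
  have fin: "finite {i. (i, j) \<in> P}" for j
    by (rule finite_subset[OF _ finite_imageI[OF assms(1), of fst]]) force
  have P: "(\<Sum>b\<in>P. fst b) = (\<Sum>j<J. \<Sum>{i. (i, j) \<in> P})" by (rule column_sum[OF assms(1)]) (use J in blast)
  have B: "(\<Sum>b\<in>B. fst b) = (\<Sum>j<J. \<Sum>{..<m j})"
    unfolding assms(4)[symmetric] by (rule column_sum[OF assms(2)]) (use J in blast)
  have le: "\<Sum>{..<m j} \<le> \<Sum>{i. (i, j) \<in> P}" for j
    using sum_initial_segment_min(1)[OF fin[of j]] unfolding assms(3) .
  show "(\<Sum>b\<in>B. fst b) \<le> (\<Sum>b\<in>P. fst b)" unfolding P B by (rule sum_mono) (rule le)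
  assume "(\<Sum>b\<in>P. fst b) = (\<Sum>b\<in>B. fst b)"
  then have e: "\<Sum>{i. (i, j) \<in> P} = \<Sum>{..<m j}" if "j < J" for j
    using sum_mono_inv[of "\<lambda>j. \<Sum>{..<m j}" "{..<J}" "\<lambda>j. \<Sum>{i. (i, j) \<in> P}" j] le that unfolding P B by simp
  have "{i. (i, j) \<in> P} = {i. (i, j) \<in> B}" for j
  proof (cases "j < J")
    case True
    then show ?thesis using sum_initial_segment_min(2)[OF fin[of j]] e unfolding assms(3,4) by blast
  next
    case False
    then show ?thesis using J by blast
  qed
  then show "P = B" by auto
qed

section \<open>Dictionary between diagrams as lists, partitions as functions, and sets of
  boxes\<close>

lemma sum_list_row_length: "sum_list D = (\<Sum>i<length D. row_length D i)"
  by (simp add: sum_list_sum_nth row_length_def atLeast0LessThan)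

lemma young_diagram_part:
  assumes "D \<in> young_diagrams m"
  shows "row_length D \<in> parts m"
proof -
  have z: "row_length D i = 0" if "i \<ge> length D" for i using that by (simp add: row_length_def)
  have "antimono (row_length D)"
  proof (rule antimonoI)
    fix i j :: nat assume ij: "i \<le> j"
    show "row_length D j \<le> row_length D i"
      using assms ij sorted_wrt_nth_less[of "(\<ge>)" D i j]
      by (cases "i = j") (auto simp: young_diagrams_def row_length_def)
  qed
  moreover have "finite {i. row_length D i \<noteq> 0}"
    by (rule finite_subset[of _ "{..<length D}"]) (auto simp: row_length_def split: if_splits)
  moreover have "psize (row_length D) = m"
    using psize_lessThan[OF z] sum_list_row_length[of D] assms by (simp add: young_diagrams_def)
  ultimately show ?thesis by (simp add: parts_def is_part_def)
qed

lemma row_length_bij: "bij_betw row_length (young_diagrams m) (parts m)"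
  unfolding bij_betw_def
proof
  show "inj_on row_length (young_diagrams m)"
  proof (rule inj_onI)
    fix D E assume D: "D \<in> young_diagrams m" and E: "E \<in> young_diagrams m" and eq: "row_length D = row_length E"
    have pos: "row_length X i \<noteq> 0 \<longleftrightarrow> i < length X" if "X \<in> young_diagrams m" for X i
    proof (cases "i < length X")
      case True
      then have "X ! i \<noteq> 0" using that nth_mem[OF True] unfolding young_diagrams_def by (metis (mono_tags, lifting) mem_Collect_eq)
      then show ?thesis using True by (simp add: row_length_def)
    qed (simp add: row_length_def)
    have "i < length D \<longleftrightarrow> i < length E" for i using pos[OF D] pos[OF E] eq by metis
    then have len: "length D = length E" by (metis linorder_neqE_nat less_irrefl)
    have "D ! i = E ! i" if "i < length D" for i
      using fun_cong[OF eq, of i] that len by (simp add: row_length_def)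
    then show "D = E" using len by (simp add: list_eq_iff_nth_eq)
  qed
  show "row_length ` young_diagrams m = parts m"
  proof (intro subset_antisym subsetI)
    fix p assume p: "p \<in> parts m"
    have anti: "p j \<le> p i" if "i \<le> j" for i j using p that by (auto simp: parts_def is_part_def antimono_def)
    have "\<exists>l. p l = 0" using parts_vanish[OF p] by blast
    define L where "L = (LEAST l. p l = 0)"
    have pL: "p L = 0" unfolding L_def using \<open>\<exists>l. p l = 0\<close> by (rule LeastI_ex)
    have pos: "p i \<noteq> 0" if "i < L" for i using not_less_Least[of i "\<lambda>l. p l = 0"] that by (simp add: L_def)
    have z: "p i = 0" if "i \<ge> L" for i using anti[OF that] pL by simp
    define D where "D = map p [0..<L]"
    have r: "row_length D = p" using z by (auto simp: row_length_def D_def fun_eq_iff)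
    have "sum_list D = sum p {..<L}" by (simp add: D_def sum_list_distinct_conv_sum_set atLeast0LessThan)
    then have "sum_list D = m" using psize_lessThan[OF z] p by (simp add: parts_def)
    moreover have "sorted_wrt (\<ge>) D" using anti by (auto simp: D_def sorted_wrt_iff_nth_less)
    moreover have "0 \<notin> set D"
    proof
      assume "0 \<in> set D"
      then obtain i where "i < L" "p i = 0" by (auto simp: D_def)
      then show False using pos by blast
    qed
    ultimately have "D \<in> young_diagrams m" by (simp add: young_diagrams_def)
    then show "p \<in> row_length ` young_diagrams m" using r by blast
  qed (use young_diagram_part in blast)
qed

lemma finite_young_diagrams: "finite (young_diagrams m)"
  using bij_betw_finite[OF row_length_bij] finite_parts by blast

lemma row_length_inj:
  "D \<in> young_diagrams m \<Longrightarrow> E \<in> young_diagrams m \<Longrightarrow> row_length D = row_length E \<Longrightarrow> D = E"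
  using row_length_bij[of m] by (auto simp: bij_betw_def dest: inj_onD)

lemma row_length_antimono: "D \<in> young_diagrams m \<Longrightarrow> i \<le> j \<Longrightarrow> row_length D j \<le> row_length D i"
  using young_diagram_part by (auto simp: parts_def is_part_def antimono_def)

lemma boxes_Sigma: "boxes D = (SIGMA i:{..<length D}. {..<row_length D i})"
  by (auto simp: boxes_def row_length_def split: if_splits)

lemma finite_boxes: "finite (boxes D)"
  by (simp add: boxes_Sigma)

lemma column_boxes:
  assumes "D \<in> young_diagrams m"
  shows "{i. (i, j) \<in> boxes D} = {..<col_length D j}"
proof -
  let ?C = "{i. (i, j) \<in> boxes D}"
  have fin: "finite ?C"
    by (rule finite_subset[OF _ finite_imageI[OF finite_boxes, of fst]]) force
  have down: "i' \<in> ?C" if "i \<in> ?C" "i' \<le> i" for i i'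
    using that row_length_antimono[OF assms that(2)] by (simp add: boxes_def)
  have "?C = {..<card ?C}"
  proof (cases "?C = {}")
    case False
    have "?C = {..Max ?C}"
    proof (rule Set.set_eqI)
      fix i
      show "i \<in> ?C \<longleftrightarrow> i \<in> {..Max ?C}"
        unfolding atMost_iff using Max_ge[OF fin] down[OF Max_in[OF fin False]] by blast
    qed
    then obtain M where "?C = {..<Suc M}" unfolding lessThan_Suc_atMost by blast
    then show ?thesis by simp
  qed simp
  then show ?thesis by (simp add: col_length_def)
qed

lemma row_length_transpose:
  assumes "D \<in> young_diagrams m"
  shows "row_length (transpose_diagram D) = col_length D"
proof
  fix j
  have "col_length D j = 0" if "j \<ge> row_length D 0"
  proof -
    have "row_length D i \<le> j" for i using row_length_antimono[OF assms, of 0 i] that by simp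
    then have "{i. (i, j) \<in> boxes D} = {}" by (auto simp: boxes_def linorder_not_less)
    then show ?thesis by (simp add: col_length_def)
  qed
  then show "row_length (transpose_diagram D) j = col_length D j"
    by (auto simp: transpose_diagram_def row_length_def[of "map (col_length D) [0..<row_length D 0]"])
qed

lemma card_boxes: "card (boxes D) = sum_list D"
  by (simp add: boxes_Sigma sum_list_row_length)

lemma sum_list_transpose:
  assumes "D \<in> young_diagrams m"
  shows "sum_list (transpose_diagram D) = m"
proof -
  have J: "j < row_length D 0" if "(i, j) \<in> boxes D" for i j
    using that row_length_antimono[OF assms, of 0 i] by (simp add: boxes_def)
  have fin: "finite {i. (i, j) \<in> boxes D}" for j
    by (rule finite_subset[OF _ finite_imageI[OF finite_boxes, of fst]]) force
  have "sum_list (transpose_diagram D) = (\<Sum>j<row_length D 0. card {i. (i, j) \<in> boxes D})"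
    by (simp add: transpose_diagram_def sum_list_distinct_conv_sum_set atLeast0LessThan col_length_def)
  also have "\<dots> = card (SIGMA j:{..<row_length D 0}. {i. (i, j) \<in> boxes D})" using fin by simp
  also have "\<dots> = card (boxes D)"
    by (rule bij_betw_same_card[of prod.swap])
      (rule bij_betw_byWitness[where f' = prod.swap], use J in auto)
  finally show ?thesis using assms by (simp add: card_boxes young_diagrams_def)
qed

lemma nstat_boxes: "nstat (row_length D) = (\<Sum>b\<in>boxes D. fst b)"
proof -
  have "(\<Sum>b\<in>boxes D. fst b) = (\<Sum>i<length D. \<Sum>j<row_length D i. i)"
    unfolding boxes_Sigma by (subst sum.Sigma) (auto simp: split_def)
  also have "\<dots> = (\<Sum>i<length D. i * row_length D i)" by (simp add: mult.commute)
  also have "\<dots> = nstat (row_length D)"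
    by (rule nstat_lessThan[symmetric]) (simp add: row_length_def)
  finally show ?thesis by simp
qed

subsection \<open>Young modules\<close>

text \<open>The colour of a letter is the index of its block. Taking the least index passes over
  empty blocks, so parts equal to zero are harmless.\<close>

definition blk :: "nat list \<Rightarrow> nat \<Rightarrow> nat"
  where "blk D x = (LEAST i. x \<le> sum_list (take (Suc i) D))"

lemma sum_list_take_mono: "i \<le> j \<Longrightarrow> sum_list (take i D) \<le> sum_list (take j D)" for D :: "nat list"
  using take_add[of i "j - i" D] by simp

lemma blk_interval:
  assumes "x \<in> {1..sum_list D}"
  shows "blk D x < length D" "x \<in> {sum_list (take (blk D x) D) + 1..sum_list (take (Suc (blk D x)) D)}"
proof -
  have "length D \<noteq> 0" using assms by (cases D) auto
  then have e: "x \<le> sum_list (take (Suc (length D - 1)) D)" using assms by simp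
  have le: "x \<le> sum_list (take (Suc (blk D x)) D)" unfolding blk_def by (rule LeastI) (rule e)
  have "blk D x \<le> length D - 1" unfolding blk_def by (rule Least_le) (rule e)
  then show "blk D x < length D" using \<open>length D \<noteq> 0\<close> by linarith
  have "sum_list (take (blk D x) D) < x"
  proof (cases "blk D x")
    case 0
    then show ?thesis using assms by simp
  next
    case (Suc i)
    then have "i < (LEAST i. x \<le> sum_list (take (Suc i) D))" by (simp add: blk_def)
    from not_less_Least[OF this] show ?thesis using Suc by simp
  qed
  then show "x \<in> {sum_list (take (blk D x) D) + 1..sum_list (take (Suc (blk D x)) D)}" using le by simp
qed

lemma blk_eq:
  assumes "x \<in> {sum_list (take i D) + 1..sum_list (take (Suc i) D)}"
  shows "blk D x = i" "x \<in> {1..sum_list D}"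
proof -
  show "blk D x = i"
    unfolding blk_def
  proof (rule Least_equality)
    show "x \<le> sum_list (take (Suc i) D)" using assms by simp
    show "i \<le> j" if "x \<le> sum_list (take (Suc j) D)" for j
      using sum_list_take_mono[of "Suc j" i D] that assms by (cases "i \<le> j") auto
  qed
  have "sum_list (take (Suc i) D) \<le> sum_list (take (max (Suc i) (length D)) D)" by (rule sum_list_take_mono) simp
  then show "x \<in> {1..sum_list D}" using assms by simp
qed

lemma blk_fiber: "i < length D \<Longrightarrow> {x \<in> {1..sum_list D}. blk D x = i} =
    {sum_list (take i D) + 1..sum_list (take (Suc i) D)}"
  using blk_interval(2) blk_eq by blast

lemma card_blk: "card {x \<in> {1..sum_list D}. blk D x = i} = row_length D i"
proof (cases "i < length D")
  case True
  then show ?thesis unfolding blk_fiber[OF True] by (simp add: row_length_def take_Suc_conv_app_nth)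
next
  case False
  then have "{x \<in> {1..sum_list D}. blk D x = i} = {}" using blk_interval(1) by blast
  then show ?thesis using False by (simp only: row_length_def if_False card.empty)
qed

lemma young_subgroup_colour: "young_subgroup D = colour_group (sum_list D) (blk D)"
proof -
  let ?n = "sum_list D" and ?B = "\<lambda>i. {sum_list (take i D) + 1..sum_list (take (Suc i) D)}"
  have "(\<forall>i<length D. p ` ?B i = ?B i) \<longleftrightarrow> (\<forall>x\<in>{1..?n}. blk D (p x) = blk D x)" if p: "p permutes {1..?n}" for p
  proof
    assume L: "\<forall>i<length D. p ` ?B i = ?B i"
    show "\<forall>x\<in>{1..?n}. blk D (p x) = blk D x"
    proof
      fix x assume x: "x \<in> {1..?n}"
      have "p x \<in> ?B (blk D x)" using blk_interval[OF x] L by blast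
      then show "blk D (p x) = blk D x" by (rule blk_eq(1))
    qed
  next
    assume R: "\<forall>x\<in>{1..?n}. blk D (p x) = blk D x"
    show "\<forall>i<length D. p ` ?B i = ?B i"
    proof (intro allI impI)
      fix i assume i: "i < length D"
      have "p ` ?B i \<subseteq> ?B i"
        unfolding blk_fiber[OF i, symmetric] using R permutes_mem[OF p] by auto
      then show "p ` ?B i = ?B i"
        by (rule endo_inj_surj[OF finite_atLeastAtMost _ inj_on_subset[OF permutes_inj[OF p] subset_UNIV]])
    qed
  qed
  then show ?thesis unfolding young_subgroup_def colour_group_def by blast
qed

lemma young_module_colour: "young_module D = colour_module (sum_list D) (blk D)"
  and twisted_young_module_colour: "twisted_young_module D = twisted_colour_module (sum_list D) (blk D)"
  by (simp_all add: young_module_def twisted_young_module_def induced_from_young_def colour_module_def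
      twisted_colour_module_def young_subgroup_colour Let_def)

lemma rep_young_module: "sum_list D = n \<Longrightarrow> representation (sym_group n) (young_module D)"
  and rep_twisted_young_module: "sum_list D = n \<Longrightarrow> representation (sym_group n) (twisted_young_module D)"
  using rep_colour_module rep_twisted_colour_module
  by (auto simp: young_module_colour twisted_young_module_colour)

text \<open>The content is a list in any order, which is what \<open>mu @ [n - k]\<close> calls
  for.\<close>

definition kostka :: "nat list \<Rightarrow> (nat \<Rightarrow> nat) \<Rightarrow> nat"
  where "kostka mu = kos (length mu) (row_length mu)"

theorem hom_dim_young_modules:
  assumes "sum_list mu = n" "sum_list nu = n"
  shows "hom_dim (sym_group n) (young_module mu) (young_module nu) = (\<Sum>E\<in>parts n. kostka mu E * kostka nu E)"
proof -
  have "hom_dim (sym_group n) (young_module mu) (young_module nu) =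
    card (mats (length nu) (row_length nu) (length mu) (row_length mu))"
    unfolding young_module_colour assms
    by (rule hom_dim_colour_modules)
      (use card_blk[of nu] card_blk[of mu] assms in \<open>simp_all add: row_length_def\<close>)
  also have "\<dots> = (\<Sum>E\<in>parts n. kostka nu E * kostka mu E)"
    unfolding kostka_def by (rule card_mats_kos) (use assms sum_list_row_length in auto)
  finally show ?thesis by (simp add: mult.commute)
qed

lemma sum_colours:
  fixes c :: "nat \<Rightarrow> nat"
  assumes "finite A" "\<And>i. card {x \<in> A. c x = i} = d i"
  shows "(\<Sum>x\<in>A. c x) = nstat d"
proof -
  have "(\<Sum>x\<in>A. c x) = (\<Sum>i\<in>c ` A. \<Sum>x\<in>{x \<in> A. c x = i}. c x)" by (rule sum.image_gen[OF assms(1)])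
  also have "\<dots> = (\<Sum>i\<in>c ` A. i * d i)" using assms(2) by (intro sum.cong) auto
  also have "\<dots> = nstat d"
  proof (rule nstat_eq[symmetric])
    show "d i = 0" if "i \<notin> c ` A" for i
    proof -
      have "{x \<in> A. c x = i} = {}" using that by auto
      then show ?thesis using assms(2)[of i] by (metis card.empty)
    qed
  qed (use assms(1) in simp)
  finally show ?thesis .
qed

text \<open>The colour pairs form \<open>n\<close> distinct cells with the column lengths of
  \<open>D\<close>, and the sum of their row indices is the statistic of \<open>nu\<close>. Among
  such sets of cells the boxes of \<open>D\<close> have the least sum and are the only
  minimum.\<close>

lemma injective_colours_boxes:
  assumes D: "D \<in> young_diagrams n" and nu: "sum_list nu = n" and g: "g permutes {1..n}"
    and inj: "inj_on (\<lambda>x. (blk nu (g x), blk (transpose_diagram D) x)) {1..n}"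
  shows "nstat (row_length D) \<le> nstat (row_length nu)"
    "nstat (row_length nu) = nstat (row_length D) \<Longrightarrow>
      (\<lambda>x. (blk nu (g x), blk (transpose_diagram D) x)) ` {1..n} = boxes D"
proof -
  let ?f = "\<lambda>x. (blk nu (g x), blk (transpose_diagram D) x)"
  let ?P = "?f ` {1..n}"
  have "(\<Sum>b\<in>?P. fst b) = (\<Sum>x\<in>{1..n}. blk nu (g x))" using sum.reindex[OF inj, of fst] by simp
  also have "\<dots> = (\<Sum>x\<in>{1..n}. blk nu x)" using sum.permute[OF g, of "blk nu"] by (simp add: comp_def)
  also have "\<dots> = nstat (row_length nu)" by (rule sum_colours) (use card_blk[of nu] nu in auto)
  finally have s: "(\<Sum>b\<in>?P. fst b) = nstat (row_length nu)" .
  have col: "card {i. (i, j) \<in> ?P} = col_length D j" for j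
  proof -
    have "{i. (i, j) \<in> ?P} = (\<lambda>x. fst (?f x)) ` {x \<in> {1..n}. blk (transpose_diagram D) x = j}" by force
    also have "card \<dots> = card {x \<in> {1..n}. blk (transpose_diagram D) x = j}"
    proof (rule card_image, rule inj_onI)
      fix x y assume x: "x \<in> {x \<in> {1..n}. blk (transpose_diagram D) x = j}"
        and y: "y \<in> {x \<in> {1..n}. blk (transpose_diagram D) x = j}" and "fst (?f x) = fst (?f y)"
      then have "?f x = ?f y" by simp
      then show "x = y" by (rule inj_onD[OF inj]) (use x y in blast)+
    qed
    also have "\<dots> = col_length D j"
      using card_blk[of "transpose_diagram D" j] row_length_transpose[OF D] sum_list_transpose[OF D] by simp
    finally show ?thesis .
  qed
  have fin: "finite ?P" by simp
  note m = column_sum_min[OF fin finite_boxes col column_boxes[OF D]]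
  show "nstat (row_length D) \<le> nstat (row_length nu)" using m(1) s by (simp add: nstat_boxes)
  show "?P = boxes D" if "nstat (row_length nu) = nstat (row_length D)"
    using m(2) s that by (simp add: nstat_boxes)
qed

text \<open>An intertwiner yields an injective pair of colourings. If the statistics agree, its
  cells are the boxes of \<open>D\<close>, and counting them row by row recovers the parts of
  \<open>nu\<close>.\<close>

lemma twisted_young_hom:
  assumes D: "D \<in> young_diagrams n" and nu: "sum_list nu = n"
    and pos: "hom_dim (sym_group n) (twisted_young_module (transpose_diagram D)) (young_module nu) > 0"
  shows "nstat (row_length D) < nstat (row_length nu) \<or> row_length nu = row_length D"
proof -
  obtain g where g: "g permutes {1..n}" "inj_on (\<lambda>x. (blk nu (g x), blk (transpose_diagram D) x)) {1..n}"
    using twisted_hom_injective pos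
    unfolding young_module_colour twisted_young_module_colour nu sum_list_transpose[OF D] by blast
  note b = injective_colours_boxes[OF D nu g]
  have "row_length nu i = row_length D i"
    if eq: "nstat (row_length nu) = nstat (row_length D)" for i
  proof -
    let ?f = "\<lambda>x. (blk nu (g x), blk (transpose_diagram D) x)"
    have "row_length nu i = card {x \<in> {1..n}. blk nu x = i}" using card_blk[of nu i] nu by simp
    also have "{x \<in> {1..n}. blk nu x = i} = g ` {x \<in> {1..n}. blk nu (g x) = i}"
    proof (intro subset_antisym subsetI)
      fix y assume y: "y \<in> {x \<in> {1..n}. blk nu x = i}"
      have gy: "g (inv' g y) = y" by (rule permutes_inverses(1)[OF g(1)])
      have "inv' g y \<in> {1..n}" using permutes_mem[OF permutes_inv[OF g(1)], of y] y by blast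
      then have "inv' g y \<in> {x \<in> {1..n}. blk nu (g x) = i}" using gy y by simp
      then show "y \<in> g ` {x \<in> {1..n}. blk nu (g x) = i}" by (rule image_eqI[of y g, OF gy[symmetric]])
    qed (use permutes_mem[OF g(1)] in auto)
    also have "card \<dots> = card {x \<in> {1..n}. blk nu (g x) = i}"
      by (rule card_image) (rule inj_on_subset[OF permutes_inj[OF g(1)]], simp)
    also have "\<dots> = card (?f ` {x \<in> {1..n}. blk nu (g x) = i})"
      by (rule card_image[symmetric]) (rule inj_on_subset[OF g(2)], auto)
    also have "?f ` {x \<in> {1..n}. blk nu (g x) = i} = {b \<in> ?f ` {1..n}. fst b = i}" by auto
    also have "\<dots> = {b \<in> boxes D. fst b = i}" using b(2)[OF eq] by simp
    also have "\<dots> = Pair i ` {..<row_length D i}" by (auto simp: boxes_def)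
    also have "card \<dots> = row_length D i" by (subst card_image) (auto simp: inj_on_def)
    finally show ?thesis .
  qed
  then show ?thesis using b(1) by (auto simp: fun_eq_iff)
qed

text \<open>Numbering the boxes of \<open>D\<close> by the letters, and matching columns by
  \<open>p\<close> and rows by \<open>q\<close>, gives one injective pair of colourings. Any other
  also fills exactly the boxes of \<open>D\<close>, so its colour matrix is the indicator function
  of \<open>boxes D\<close> and the double coset is unique.\<close>

lemma twisted_young_hom_one:
  assumes D: "D \<in> young_diagrams n"
  shows "hom_dim (sym_group n) (twisted_young_module (transpose_diagram D)) (young_module D) = 1"
proof -
  let ?c = "blk (transpose_diagram D)" and ?c' = "blk D"
  have n: "sum_list D = n" using D by (simp add: young_diagrams_def)
  have nt: "sum_list (transpose_diagram D) = n" by (rule sum_list_transpose[OF D])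
  have "card {1..n} = card (boxes D)" by (simp add: card_boxes n)
  then obtain f where f: "bij_betw f {1..n} (boxes D)"
    using finite_same_card_bij[OF finite_atLeastAtMost finite_boxes] by blast
  have fiber: "card {x \<in> {1..n}. P (f x)} = card {b \<in> boxes D. P b}" for P
  proof (rule bij_betw_same_card[of f], unfold bij_betw_def, rule conjI)
    show "inj_on f {x \<in> {1..n}. P (f x)}" using bij_betw_imp_inj_on[OF f] by (rule inj_on_subset) blast
    have "f ` {x \<in> {1..n}. P (f x)} = {y \<in> f ` {1..n}. P y}" by blast
    then show "f ` {x \<in> {1..n}. P (f x)} = {b \<in> boxes D. P b}" by (simp only: bij_betw_imp_surj_on[OF f])
  qed
  have "card {x \<in> {1..n}. ?c x = j} = card {x \<in> {1..n}. snd (f x) = j}" for j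
  proof -
    have "{b \<in> boxes D. snd b = j} = (\<lambda>i. (i, j)) ` {i. (i, j) \<in> boxes D}" by auto
    then have "card {b \<in> boxes D. snd b = j} = card {i. (i, j) \<in> boxes D}"
      by (simp only:) (rule card_image, simp add: inj_on_def)
    then have "card {x \<in> {1..n}. snd (f x) = j} = col_length D j"
      using fiber[of "\<lambda>b. snd b = j"] by (simp only: col_length_def)
    then show ?thesis using card_blk[of "transpose_diagram D" j] nt row_length_transpose[OF D] by simp
  qed
  then obtain p where p: "p permutes {1..n}" "\<And>x. x \<in> {1..n} \<Longrightarrow> ?c x = snd (f (p x))"
    using permutation_between_colourings[OF finite_atLeastAtMost, of 1 n ?c "\<lambda>x. snd (f x)"] by blast
  have "card {x \<in> {1..n}. fst (f x) = i} = card {x \<in> {1..n}. ?c' x = i}" for i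
  proof -
    have "{b \<in> boxes D. fst b = i} = Pair i ` {..<row_length D i}" by (auto simp: boxes_def)
    then have "card {b \<in> boxes D. fst b = i} = card {..<row_length D i}"
      by (simp only:) (rule card_image, simp add: inj_on_def)
    then have "card {x \<in> {1..n}. fst (f x) = i} = row_length D i"
      using fiber[of "\<lambda>b. fst b = i"] by simp
    then show ?thesis using card_blk[of D i] n by simp
  qed
  then obtain q where q: "q permutes {1..n}" "\<And>x. x \<in> {1..n} \<Longrightarrow> fst (f x) = ?c' (q x)"
    using permutation_between_colourings[OF finite_atLeastAtMost, of 1 n "\<lambda>x. fst (f x)" ?c'] by blast
  define g0 where "g0 = q \<circ> p"
  have g0: "g0 permutes {1..n}" unfolding g0_def by (rule permutes_compose[OF p(1) q(1)])
  have w: "(?c' (g0 x), ?c x) = f (p x)" if "x \<in> {1..n}" for x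
    using p(2)[OF that] q(2)[OF permutes_mem[OF p(1) that]] by (simp add: g0_def prod_eq_iff)
  have inj0: "inj_on (\<lambda>x. (?c' (g0 x), ?c x)) {1..n}"
  proof (rule inj_onI)
    fix x y assume xy: "x \<in> {1..n}" "y \<in> {1..n}" "(?c' (g0 x), ?c x) = (?c' (g0 y), ?c y)"
    then have "f (p x) = f (p y)" using w by simp
    then have "p x = p y"
      using bij_betw_imp_inj_on[OF f] permutes_mem[OF p(1)] xy(1,2) by (meson inj_onD)
    then show "x = y" using permutes_inj[OF p(1)] by (meson injD)
  qed
  have matrix: "colour_matrix n ?c' ?c g = (\<lambda>i j. if (i, j) \<in> boxes D then 1 else 0)"
    if g: "g permutes {1..n}" and inj: "inj_on (\<lambda>x. (?c' (g x), ?c x)) {1..n}" for g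
  proof (intro ext)
    fix i j
    let ?f = "\<lambda>x. (?c' (g x), ?c x)"
    have im: "?f ` {1..n} = boxes D" by (rule injective_colours_boxes(2)[OF D n g inj refl])
    have "colour_matrix n ?c' ?c g i j = card {x \<in> {1..n}. ?f x = (i, j)}" by (simp add: colour_matrix_def)
    also have "\<dots> = card (?f ` {x \<in> {1..n}. ?f x = (i, j)})"
      by (rule card_image[symmetric]) (rule inj_on_subset[OF inj], blast)
    also have "?f ` {x \<in> {1..n}. ?f x = (i, j)} = {b \<in> ?f ` {1..n}. b = (i, j)}" by blast
    also have "\<dots> = (if (i, j) \<in> boxes D then {(i, j)} else {})" unfolding im by auto
    also have "card \<dots> = (if (i, j) \<in> boxes D then 1 else 0)" by simp
    finally show "colour_matrix n ?c' ?c g i j = (if (i, j) \<in> boxes D then 1 else 0)" .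
  qed
  have "hom_dim (sym_group n) (twisted_colour_module n ?c) (colour_module n ?c') = 1"
    by (rule twisted_hom_dim_one[OF g0 inj0]) (simp add: matrix matrix[OF g0 inj0])
  then show ?thesis by (simp add: young_module_colour twisted_young_module_colour n nt)
qed

section \<open>The irreducible representations attached to diagrams\<close>

lemma hom_dim_summand_left:
  assumes "finite (carrier G)" "representation G R" "invariant_subspace G R U" "representation G X"
  shows "hom_dim G (subrep R U) X \<le> hom_dim G R X"
proof -
  have V: "invariant_subspace G R (space R)" by (rule invariant_subspace_space[OF assms(2)])
  obtain U' where U': "invariant_subspace G R U'" "internal_sum (space R) U U'"
    using maschke[OF assms(1,2) V assms(3) invariant_subspaceD(2)[OF assms(3)]] by blast
  have "hom_dim G (subrep R (space R)) X = hom_dim G (subrep R U) X + hom_dim G (subrep R U') X"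
    using additive_hom_dim_left[OF assms(2,4)] V assms(3) U' unfolding additive_def by blast
  then show ?thesis by simp
qed

lemma hom_dim_summand_right:
  assumes "finite (carrier G)" "representation G R" "invariant_subspace G R U" "representation G X"
  shows "hom_dim G X (subrep R U) \<le> hom_dim G X R"
proof -
  have V: "invariant_subspace G R (space R)" by (rule invariant_subspace_space[OF assms(2)])
  obtain U' where U': "invariant_subspace G R U'" "internal_sum (space R) U U'"
    using maschke[OF assms(1,2) V assms(3) invariant_subspaceD(2)[OF assms(3)]] by blast
  have "hom_dim G X (subrep R (space R)) = hom_dim G X (subrep R U) + hom_dim G X (subrep R U')"
    using additive_hom_dim_right[OF assms(4,2)] V assms(3) U' unfolding additive_def by blast
  then show ?thesis by simp
qed

lemma hom_dim_occurs_left: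
  assumes "finite (carrier G)" "representation G R" "occurs_in G W R" "representation G X"
  shows "hom_dim G W X \<le> hom_dim G R X"
proof -
  obtain U where U: "invariant_subspace G R U" "rep_iso G W (subrep R U)"
    using assms(3) by (auto simp: occurs_in_def)
  have "hom_dim G W X = hom_dim G (subrep R U) X" by (rule hom_dim_iso_left[OF assms(4) U(2)])
  then show ?thesis using hom_dim_summand_left[OF assms(1,2) U(1) assms(4)] by simp
qed

lemma hom_dim_occurs_right:
  assumes "finite (carrier G)" "representation G R" "occurs_in G W R" "representation G X"
  shows "hom_dim G X W \<le> hom_dim G X R"
proof -
  obtain U where U: "invariant_subspace G R U" "rep_iso G W (subrep R U)"
    using assms(3) by (auto simp: occurs_in_def)
  have "hom_dim G X W = hom_dim G X (subrep R U)" by (rule hom_dim_iso_right[OF assms(4) U(2)])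
  then show ?thesis using hom_dim_summand_right[OF assms(1,2) U(1) assms(4)] by simp
qed

lemma irreducible_hom_dim_pos:
  assumes "irreducible_rep G W" "rep_iso G W W'"
  shows "hom_dim G W W' > 0"
proof -
  have W: "representation G W" "space W \<noteq> {0}" using assms(1) by (auto simp: irreducible_rep_def)
  obtain T where T: "representation G W'" "intertwiner G W W' T" "bij_betw T (space W) (space W')"
    using assms(2) unfolding rep_iso_alt by blast
  obtain v where v: "v \<in> space W" "v \<noteq> 0" using W cfun.subspace_0[OF rep_subspace[OF W(1)]] by blast
  have "T v \<noteq> 0"
    using v T(3) linear_on_inj_iff[OF intertwinerD(1)[OF T(2)] rep_subspace[OF W(1)]] by (auto simp: bij_betw_def)
  then show ?thesis using hom_dim_pos_iff[OF W(1) T(1)] T(2) v(1) by blast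
qed

text \<open>Decomposing first the source and then the target leaves a nonzero intertwiner between
  two irreducible summands.\<close>

lemma common_constituent:
  assumes "finite (carrier G)" "representation G R" "representation G S" "hom_dim G R S > 0"
  shows "\<exists>U. invariant_subspace G S U \<and> irreducible_rep G (subrep S U) \<and> occurs_in G (subrep S U) R"
proof -
  obtain \<W> where W: "irreducible_decomposition G R (space R) \<W>"
    using irreducible_decomposition_exists[OF assms(1,2) invariant_subspace_space[OF assms(2)]] by blast
  obtain \<V> where V: "irreducible_decomposition G S (space S) \<V>"
    using irreducible_decomposition_exists[OF assms(1,3) invariant_subspace_space[OF assms(3)]] by blast
  have "hom_dim G (subrep R (space R)) S = (\<Sum>U\<in>\<W>. hom_dim G (subrep R U) S)"
    using W additive_hom_dim_left[OF assms(2,3)] unfolding irreducible_decomposition_def by blast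
  then have "(\<Sum>U\<in>\<W>. hom_dim G (subrep R U) S) \<noteq> 0" using assms(4) by simp
  then obtain U where U: "U \<in> \<W>" "hom_dim G (subrep R U) S \<noteq> 0"
    by (rule sum.not_neutral_contains_not_neutral)
  have Ui: "invariant_subspace G R U" "irreducible_rep G (subrep R U)"
    using W U(1) unfolding irreducible_decomposition_def by blast+
  have repU: "representation G (subrep R U)" using Ui(2) by (simp add: irreducible_rep_def)
  have "hom_dim G (subrep R U) (subrep S (space S)) = (\<Sum>X\<in>\<V>. hom_dim G (subrep R U) (subrep S X))"
    using V additive_hom_dim_right[OF repU assms(3)] unfolding irreducible_decomposition_def by blast
  then have "(\<Sum>X\<in>\<V>. hom_dim G (subrep R U) (subrep S X)) \<noteq> 0" using U(2) by simp
  then obtain X where X: "X \<in> \<V>" "hom_dim G (subrep R U) (subrep S X) \<noteq> 0"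
    by (rule sum.not_neutral_contains_not_neutral)
  have Xi: "invariant_subspace G S X" "irreducible_rep G (subrep S X)"
    using V X(1) unfolding irreducible_decomposition_def by blast+
  have "rep_iso G (subrep R U) (subrep S X)" using hom_dim_schur[OF Ui(2) Xi(2)] X(2) by simp
  then have "occurs_in G (subrep S X) R" unfolding occurs_in_def using Ui(1) rep_iso_sym by blast
  then show ?thesis using Xi by blast
qed

text \<open>A constituent shared by the two modules of \<open>D\<close> justifies the choice; it is
  taken inside \<open>young_module D\<close> because that fixes the type of
  \<open>sigma D\<close>.\<close>

lemma sigma_is_sigma:
  assumes D: "D \<in> young_diagrams n"
  shows "is_sigma D (sigma D)"
proof -
  have n: "sum_list D = n" using D by (simp add: young_diagrams_def)
  note rt = rep_twisted_young_module[OF sum_list_transpose[OF D]] and ry = rep_young_module[OF n]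
  have "hom_dim (sym_group n) (twisted_young_module (transpose_diagram D)) (young_module D) > 0"
    using twisted_young_hom_one[OF D] by simp
  then obtain U where U: "invariant_subspace (sym_group n) (young_module D) U"
    "irreducible_rep (sym_group n) (subrep (young_module D) U)"
    "occurs_in (sym_group n) (subrep (young_module D) U) (twisted_young_module (transpose_diagram D))"
    using common_constituent[OF finite_sym_group rt ry] by blast
  have "rep_iso (sym_group n) (subrep (young_module D) U) (subrep (young_module D) U)"
    using U(2) by (intro rep_iso_refl) (simp add: irreducible_rep_def)
  then have "is_sigma D (subrep (young_module D) U)"
    using U unfolding is_sigma_def n occurs_in_def by blast
  then show ?thesis unfolding sigma_def by (rule someI)
qed

lemma sigma_facts:
  assumes D: "D \<in> young_diagrams n"
  shows "irreducible_rep (sym_group n) (sigma D)" "representation (sym_group n) (sigma D)"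
    "occurs_in (sym_group n) (sigma D) (twisted_young_module (transpose_diagram D))"
    "occurs_in (sym_group n) (sigma D) (young_module D)"
proof -
  have n: "sum_list D = n" using D by (simp add: young_diagrams_def)
  show irr: "irreducible_rep (sym_group n) (sigma D)"
    and "occurs_in (sym_group n) (sigma D) (twisted_young_module (transpose_diagram D))"
    "occurs_in (sym_group n) (sigma D) (young_module D)"
    using sigma_is_sigma[OF D] unfolding is_sigma_def n by blast+
  show "representation (sym_group n) (sigma D)" using irr by (simp add: irreducible_rep_def)
qed

text \<open>Both numbers are squeezed between a nonzero identity map and the line of intertwiners
  from the twisted module to \<open>young_module D\<close>.\<close>

lemma hom_dim_sigma:
  assumes D: "D \<in> young_diagrams n"
  shows "hom_dim (sym_group n) (sigma D) (sigma D) = 1" "hom_dim (sym_group n) (sigma D) (young_module D) = 1"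
proof -
  have n: "sum_list D = n" using D by (simp add: young_diagrams_def)
  note s = sigma_facts[OF D] and rt = rep_twisted_young_module[OF sum_list_transpose[OF D]] and ry = rep_young_module[OF n]
  have "hom_dim (sym_group n) (sigma D) (sigma D) > 0"
    by (rule irreducible_hom_dim_pos[OF s(1) rep_iso_refl[OF s(2)]])
  moreover have "hom_dim (sym_group n) (sigma D) (sigma D) \<le> hom_dim (sym_group n) (sigma D) (young_module D)"
    by (rule hom_dim_occurs_right[OF finite_sym_group ry s(4,2)])
  moreover have "hom_dim (sym_group n) (sigma D) (young_module D) \<le> 1"
    using hom_dim_occurs_left[OF finite_sym_group rt s(3) ry] twisted_young_hom_one[OF D] by simp
  ultimately show "hom_dim (sym_group n) (sigma D) (sigma D) = 1"
    "hom_dim (sym_group n) (sigma D) (young_module D) = 1" by linarith+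
qed

lemma hom_dim_sigma_young:
  assumes D: "D \<in> young_diagrams n" and nu: "sum_list nu = n"
    and pos: "hom_dim (sym_group n) (sigma D) (young_module nu) > 0"
  shows "nstat (row_length D) < nstat (row_length nu) \<or> row_length nu = row_length D"
proof (rule twisted_young_hom[OF D nu])
  show "hom_dim (sym_group n) (twisted_young_module (transpose_diagram D)) (young_module nu) > 0"
    using hom_dim_occurs_left[OF finite_sym_group rep_twisted_young_module[OF sum_list_transpose[OF D]]
        sigma_facts(3)[OF D] rep_young_module[OF nu]] pos by simp
qed

text \<open>Each of the two would occur in the Young module of the other diagram; the strict
  inequalities between statistics exclude each other, so the row lengths agree.\<close>

lemma sigma_iso_imp_eq:
  assumes D: "D \<in> young_diagrams n" and E: "E \<in> young_diagrams n"
    and iso: "rep_iso (sym_group n) (sigma D) (sigma E)"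
  shows "D = E"
proof -
  have n: "sum_list D = n" "sum_list E = n" using D E by (simp_all add: young_diagrams_def)
  have "hom_dim (sym_group n) (sigma D) (young_module E) = 1" "hom_dim (sym_group n) (sigma E) (young_module D) = 1"
    using hom_dim_iso_left[OF rep_young_module[OF n(2)] iso] hom_dim_iso_left[OF rep_young_module[OF n(1)] iso]
      hom_dim_sigma(2)[OF D] hom_dim_sigma(2)[OF E] by simp_all
  then have "row_length D = row_length E"
    using hom_dim_sigma_young[OF D n(2)] hom_dim_sigma_young[OF E n(1)] by fastforce
  then show ?thesis using row_length_inj[OF D E] by blast
qed

section \<open>Young's rule\<close>

abbreviation hdim :: "nat \<Rightarrow> (nat \<Rightarrow> nat, 'x) crep \<Rightarrow> (nat \<Rightarrow> nat, 'y) crep \<Rightarrow> nat"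
  where "hdim n \<equiv> hom_dim (sym_group n)"

lemma hdim_sigma_irreducible:
  assumes "E \<in> young_diagrams n" "irreducible_rep (sym_group n) X"
  shows "hdim n (sigma E) X = (if rep_iso (sym_group n) X (sigma E) then 1 else 0)"
proof (cases "rep_iso (sym_group n) X (sigma E)")
  case True
  then show ?thesis
    using hom_dim_iso_right[OF sigma_facts(2)[OF assms(1)] True] hom_dim_sigma(1)[OF assms(1)] by simp
next
  case False
  then have "\<not> rep_iso (sym_group n) (sigma E) X" using rep_iso_sym by blast
  then show ?thesis using hom_dim_schur[OF sigma_facts(1)[OF assms(1)] assms(2)] False by auto
qed

section \<open>Multiplicities of the \<open>sigma E\<close> in a decomposition\<close>

lemma decomposition_hdim:
  assumes "irreducible_decomposition (sym_group n) R (space R) \<W>"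
    "representation (sym_group n) R" "representation (sym_group n) X"
  shows "hdim n X R = (\<Sum>U\<in>\<W>. hdim n X (subrep R U))" "hdim n R X = (\<Sum>U\<in>\<W>. hdim n (subrep R U) X)"
proof -
  have *: "\<phi> (space R) = (\<Sum>U\<in>\<W>. \<phi> U)" if "additive (sym_group n) R \<phi>" for \<phi>
    using assms(1) that unfolding irreducible_decomposition_def by blast
  show "hdim n X R = (\<Sum>U\<in>\<W>. hdim n X (subrep R U))"
    using *[OF additive_hom_dim_right[OF assms(3,2)]] by simp
  show "hdim n R X = (\<Sum>U\<in>\<W>. hdim n (subrep R U) X)"
    using *[OF additive_hom_dim_left[OF assms(2,3)]] by simp
qed

lemma decomposition_member:
  assumes "irreducible_decomposition G R V \<W>" "U \<in> \<W>"
  shows "invariant_subspace G R U" "irreducible_rep G (subrep R U)" "representation G (subrep R U)"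
  using assms unfolding irreducible_decomposition_def irreducible_rep_def by blast+

lemma card_sigma_summands:
  assumes W: "irreducible_decomposition (sym_group n) R (space R) \<W>"
    and R: "representation (sym_group n) R" and E: "E \<in> young_diagrams n"
  shows "card {U \<in> \<W>. rep_iso (sym_group n) (subrep R U) (sigma E)} = hdim n (sigma E) R"
proof -
  have fin: "finite \<W>" using W by (simp add: irreducible_decomposition_def)
  have "hdim n (sigma E) R = (\<Sum>U\<in>\<W>. hdim n (sigma E) (subrep R U))"
    by (rule decomposition_hdim(1)[OF W R sigma_facts(2)[OF E]])
  also have "\<dots> = (\<Sum>U\<in>\<W>. if rep_iso (sym_group n) (subrep R U) (sigma E) then 1 else 0)"
    by (rule sum.cong[OF refl]) (rule hdim_sigma_irreducible[OF E decomposition_member(2)[OF W]])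
  also have "\<dots> = card {U \<in> \<W>. rep_iso (sym_group n) (subrep R U) (sigma E)}"
    using fin by (simp flip: sum.inter_filter)
  finally show ?thesis by simp
qed

text \<open>Summands are grouped by isomorphism type, \<open>\<psi> E\<close> being the common value
  of \<open>\<phi>\<close> on type \<open>E\<close>. The second sum collects summands of none of
  these types, which cannot be excluded until norms have been compared.\<close>

lemma additive_sigma_expansion:
  fixes \<phi> :: "('x \<Rightarrow> complex) set \<Rightarrow> nat"
  assumes W: "irreducible_decomposition (sym_group n) R (space R) \<W>"
    and R: "representation (sym_group n) R" and add: "additive (sym_group n) R \<phi>"
    and psi: "\<And>U E. E \<in> young_diagrams n \<Longrightarrow> invariant_subspace (sym_group n) R U \<Longrightarrow>
      rep_iso (sym_group n) (subrep R U) (sigma E) \<Longrightarrow> \<phi> U = \<psi> E"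
  shows "\<phi> (space R) = (\<Sum>E\<in>young_diagrams n. hdim n (sigma E) R * \<psi> E) +
    (\<Sum>U | U \<in> \<W> \<and> (\<forall>E\<in>young_diagrams n. \<not> rep_iso (sym_group n) (subrep R U) (sigma E)). \<phi> U)"
proof -
  let ?Y = "young_diagrams n" and ?iso = "\<lambda>U E. rep_iso (sym_group n) (subrep R U) (sigma E)"
  let ?C = "\<lambda>E. {U \<in> \<W>. ?iso U E}"
  let ?W0 = "{U \<in> \<W>. \<forall>E\<in>?Y. \<not> ?iso U E}"
  have fin: "finite \<W>" and sum: "\<phi> (space R) = (\<Sum>U\<in>\<W>. \<phi> U)"
    using W add unfolding irreducible_decomposition_def by blast+
  have disj: "?C E \<inter> ?C E' = {}" if E: "E \<in> ?Y" "E' \<in> ?Y" "E \<noteq> E'" for E E'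
  proof (rule ccontr)
    assume "?C E \<inter> ?C E' \<noteq> {}"
    then obtain U where "?iso U E" "?iso U E'" by blast
    then have "rep_iso (sym_group n) (sigma E) (sigma E')" using rep_iso_sym rep_iso_trans by blast
    then show False using sigma_iso_imp_eq E by blast
  qed
  have "\<W> = (\<Union>E\<in>?Y. ?C E) \<union> ?W0" by blast
  then have "(\<Sum>U\<in>\<W>. \<phi> U) = (\<Sum>U\<in>(\<Union>E\<in>?Y. ?C E) \<union> ?W0. \<phi> U)" by simp
  also have "\<dots> = (\<Sum>U\<in>(\<Union>E\<in>?Y. ?C E). \<phi> U) + (\<Sum>U\<in>?W0. \<phi> U)"
    by (rule sum.union_disjoint) (use fin finite_young_diagrams in auto)
  also have "(\<Sum>U\<in>(\<Union>E\<in>?Y. ?C E). \<phi> U) = (\<Sum>E\<in>?Y. \<Sum>U\<in>?C E. \<phi> U)"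
    by (rule sum.UNION_disjoint) (use fin finite_young_diagrams disj in auto)
  also have "\<dots> = (\<Sum>E\<in>?Y. hdim n (sigma E) R * \<psi> E)"
  proof (rule sum.cong[OF refl])
    fix E assume E: "E \<in> ?Y"
    have "(\<Sum>U\<in>?C E. \<phi> U) = (\<Sum>U\<in>?C E. \<psi> E)"
      by (rule sum.cong[OF refl]) (use psi[OF E] decomposition_member(1)[OF W] in blast)
    then show "(\<Sum>U\<in>?C E. \<phi> U) = hdim n (sigma E) R * \<psi> E"
      using card_sigma_summands[OF W R E] by simp
  qed
  finally show ?thesis using sum by simp
qed

text \<open>The property that removes the second sum of \<open>additive_sigma_expansion\<close>. It
  is established for Young modules, and it then identifies every irreducible constituent of such a
  module.\<close>

definition sigma_type :: "nat \<Rightarrow> (nat \<Rightarrow> nat, 'x) crep \<Rightarrow> bool"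
  where "sigma_type n R \<longleftrightarrow> representation (sym_group n) R \<and>
    (\<exists>\<W>. irreducible_decomposition (sym_group n) R (space R) \<W> \<and>
      (\<forall>U\<in>\<W>. \<exists>E\<in>young_diagrams n. rep_iso (sym_group n) (subrep R U) (sigma E)))"

lemma sigma_type_expansion:
  fixes \<phi> :: "('x \<Rightarrow> complex) set \<Rightarrow> nat"
  assumes "sigma_type n R" "additive (sym_group n) R \<phi>"
    "\<And>U E. E \<in> young_diagrams n \<Longrightarrow> invariant_subspace (sym_group n) R U \<Longrightarrow>
      rep_iso (sym_group n) (subrep R U) (sigma E) \<Longrightarrow> \<phi> U = \<psi> E"
  shows "\<phi> (space R) = (\<Sum>E\<in>young_diagrams n. hdim n (sigma E) R * \<psi> E)"
proof -
  obtain \<W> where R: "representation (sym_group n) R"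
    and W: "irreducible_decomposition (sym_group n) R (space R) \<W>"
    and all: "\<forall>U\<in>\<W>. \<exists>E\<in>young_diagrams n. rep_iso (sym_group n) (subrep R U) (sigma E)"
    using assms(1) by (auto simp: sigma_type_def)
  have "{U. U \<in> \<W> \<and> (\<forall>E\<in>young_diagrams n. \<not> rep_iso (sym_group n) (subrep R U) (sigma E))} = {}"
    using all by blast
  then show ?thesis using additive_sigma_expansion[OF W R assms(2,3)] by (simp only: sum.empty add_0_right)
qed

lemma sigma_type_constituent:
  assumes "sigma_type n R" "irreducible_rep (sym_group n) X" "hdim n X R > 0"
  shows "\<exists>E\<in>young_diagrams n. rep_iso (sym_group n) X (sigma E)"
proof -
  obtain \<W> where R: "representation (sym_group n) R"
    and W: "irreducible_decomposition (sym_group n) R (space R) \<W>"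
    and all: "\<forall>U\<in>\<W>. \<exists>E\<in>young_diagrams n. rep_iso (sym_group n) (subrep R U) (sigma E)"
    using assms(1) by (auto simp: sigma_type_def)
  have X: "representation (sym_group n) X" using assms(2) by (simp add: irreducible_rep_def)
  have "(\<Sum>U\<in>\<W>. hdim n X (subrep R U)) \<noteq> 0" using decomposition_hdim(1)[OF W R X] assms(3) by simp
  then obtain U where U: "U \<in> \<W>" "hdim n X (subrep R U) \<noteq> 0"
    by (rule sum.not_neutral_contains_not_neutral)
  then have "rep_iso (sym_group n) X (subrep R U)"
    using hom_dim_schur[OF assms(2) decomposition_member(2)[OF W U(1)]] by simp
  then show ?thesis using all U(1) rep_iso_trans by blast
qed

section \<open>Inversion of the Kostka matrix and the induction proving Young's rule\<close>

lemma sum_young_parts: "(\<Sum>E\<in>parts n. f E) = (\<Sum>D\<in>young_diagrams n. f (row_length D))"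
  by (rule sum.reindex_bij_betw[OF row_length_bij, symmetric])

lemma kostka_triangular:
  assumes "sum_list mu = n" "D \<in> young_diagrams n" "kostka mu (row_length D) \<noteq> 0"
  shows "nstat (row_length D) < nstat (row_length mu) \<or> row_length mu = row_length D"
proof -
  have k: "kos (length mu) (row_length mu) (row_length D) \<noteq> 0" using assms(3) by (simp add: kostka_def)
  have s: "nstat (row_length mu) = (\<Sum>i<length mu. i * row_length mu i)"
    by (rule nstat_lessThan) (simp add: row_length_def)
  have "row_length mu = row_length D" if "nstat (row_length D) = nstat (row_length mu)"
  proof
    fix i
    show "row_length mu i = row_length D i"
      using kos_triangular(2)[OF k] kos_vanish[OF k, of i] that s
      by (cases "i < length mu") (auto simp: row_length_def[of mu])
  qed
  then show ?thesis using kos_triangular(1)[OF k] s by fastforce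
qed

lemma kostka_diagonal:
  assumes "D \<in> young_diagrams n"
  shows "kostka D (row_length D) = 1"
proof -
  have "antimono (row_length D)" using row_length_antimono[OF assms] by (auto intro: antimonoI)
  moreover have "(\<lambda>i. if i < length D then row_length D i else 0) = row_length D"
    by (auto simp: row_length_def fun_eq_iff)
  ultimately show ?thesis using kos_diagonal[of "row_length D" "length D"] by (simp add: kostka_def)
qed

text \<open>In the equation for \<open>E\<close> a diagram \<open>F\<close> different from
  \<open>E\<close> has a nonzero coefficient only if its statistic is smaller, and the coefficient
  of \<open>E\<close> is one. The threshold \<open>t\<close> makes the inversion available in the
  middle of an induction, when only the equations below \<open>t\<close> are known.\<close>

lemma kostka_inversion:
  fixes a b :: "nat list \<Rightarrow> nat"
  assumes "\<And>E. E \<in> young_diagrams n \<Longrightarrow> nstat (row_length E) < t \<Longrightarrow>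
      (\<Sum>F\<in>young_diagrams n. kostka E (row_length F) * a F) = (\<Sum>F\<in>young_diagrams n. kostka E (row_length F) * b F)"
    "E \<in> young_diagrams n" "nstat (row_length E) < t"
  shows "a E = b E"
  using assms(2,3)
proof (induction "nstat (row_length E)" arbitrary: E rule: less_induct)
  case less
  let ?Y = "young_diagrams n" and ?K = "\<lambda>F. kostka E (row_length F)"
  have n: "sum_list E = n" using less.prems(1) by (simp add: young_diagrams_def)
  have split: "(\<Sum>F\<in>?Y. ?K F * f F) = f E + (\<Sum>F\<in>?Y - {E}. ?K F * f F)" for f :: "nat list \<Rightarrow> nat"
    using sum.remove[OF finite_young_diagrams less.prems(1), of "\<lambda>F. ?K F * f F"]
    by (simp add: kostka_diagonal[OF less.prems(1)])
  have "(\<Sum>F\<in>?Y - {E}. ?K F * a F) = (\<Sum>F\<in>?Y - {E}. ?K F * b F)"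
  proof (rule sum.cong[OF refl])
    fix F assume F: "F \<in> ?Y - {E}"
    show "?K F * a F = ?K F * b F"
    proof (cases "?K F = 0")
      case False
      have "row_length E \<noteq> row_length F" using row_length_inj[OF less.prems(1), of F] F by blast
      then have "nstat (row_length F) < nstat (row_length E)"
        using kostka_triangular[OF n _ False] F by blast
      then show ?thesis using less.hyps[of F] F less.prems(2) by simp
    qed simp
  qed
  then show ?case using assms(1)[OF less.prems] split[of a] split[of b] by simp
qed

lemma hdim_young_expansion:
  assumes "sigma_type n (young_module mu)" "representation (sym_group n) X"
  shows "hdim n (young_module mu) X = (\<Sum>E\<in>young_diagrams n. hdim n (sigma E) (young_module mu) * hdim n (sigma E) X)"
proof -
  have R: "representation (sym_group n) (young_module mu)" using assms(1) by (simp add: sigma_type_def)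
  have "hdim n (subrep (young_module mu) (space (young_module mu))) X =
      (\<Sum>E\<in>young_diagrams n. hdim n (sigma E) (young_module mu) * hdim n (sigma E) X)"
    by (rule sigma_type_expansion[OF assms(1) additive_hom_dim_left[OF R assms(2)]])
      (rule hom_dim_iso_left[OF assms(2)])
  then show ?thesis by simp
qed

text \<open>The known multiplicities already account for the whole norm of the Young module, the sum
  of the squared Kostka numbers. A summand of another type would embed into the module and add at
  least one.\<close>

lemma young_module_sigma_type:
  assumes mu: "sum_list mu = n"
    and mult: "\<And>E. E \<in> young_diagrams n \<Longrightarrow> hdim n (sigma E) (young_module mu) = kostka mu (row_length E)"
  shows "sigma_type n (young_module mu)"
proof -
  let ?R = "young_module mu" and ?Y = "young_diagrams n"
  have R: "representation (sym_group n) ?R" by (rule rep_young_module[OF mu])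
  obtain \<W> where W: "irreducible_decomposition (sym_group n) ?R (space ?R) \<W>"
    using irreducible_decomposition_exists[OF finite_sym_group R invariant_subspace_space[OF R]] by blast
  have fin: "finite \<W>" using W by (simp add: irreducible_decomposition_def)
  let ?W0 = "{U. U \<in> \<W> \<and> (\<forall>E\<in>?Y. \<not> rep_iso (sym_group n) (subrep ?R U) (sigma E))}"
  have "hdim n (subrep ?R (space ?R)) ?R = (\<Sum>E\<in>?Y. hdim n (sigma E) ?R * hdim n (sigma E) ?R) +
      (\<Sum>U\<in>?W0. hdim n (subrep ?R U) ?R)"
    by (rule additive_sigma_expansion[OF W R additive_hom_dim_left[OF R R]]) (rule hom_dim_iso_left[OF R])
  moreover have "hdim n ?R ?R = (\<Sum>E\<in>?Y. hdim n (sigma E) ?R * hdim n (sigma E) ?R)"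
    using hom_dim_young_modules[OF mu mu] mult by (simp add: sum_young_parts)
  ultimately have z: "(\<Sum>U\<in>?W0. hdim n (subrep ?R U) ?R) = 0" by simp
  have "\<exists>E\<in>?Y. rep_iso (sym_group n) (subrep ?R U) (sigma E)" if U: "U \<in> \<W>" for U
  proof (rule ccontr)
    assume "\<not> ?thesis"
    then have "U \<in> ?W0" using U by blast
    then have "hdim n (subrep ?R U) ?R = 0" using z fin by (simp add: sum_eq_0_iff)
    moreover have "hdim n (subrep ?R U) (subrep ?R U) > 0"
      by (rule irreducible_hom_dim_pos[OF decomposition_member(2)[OF W U] rep_iso_refl[OF decomposition_member(3)[OF W U]]])
    moreover have "hdim n (subrep ?R U) (subrep ?R U) \<le> hdim n (subrep ?R U) ?R"
      by (rule hom_dim_summand_right[OF finite_sym_group R decomposition_member(1,3)[OF W U]])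
    ultimately show False by simp
  qed
  then show ?thesis using R W unfolding sigma_type_def by blast
qed

text \<open>For each diagram \<open>E\<close> below \<open>t\<close> the intertwiners from
  \<open>young_module E\<close> to \<open>young_module mu\<close> are counted twice: by the Gram
  matrix, and by expanding the module of \<open>E\<close>, whose constituents the induction
  hypothesis determines. Both counts are the same unitriangular system for the unknown
  multiplicities in \<open>mu\<close>.\<close>

lemma hdim_sigma_young_below:
  assumes mu: "sum_list mu = n"
    and IH: "\<And>E. E \<in> young_diagrams n \<Longrightarrow> nstat (row_length E) < t \<Longrightarrow>
      \<forall>F\<in>young_diagrams n. hdim n (sigma F) (young_module E) = kostka E (row_length F)"
    and E: "E \<in> young_diagrams n" "nstat (row_length E) < t"
  shows "hdim n (sigma E) (young_module mu) = kostka mu (row_length E)"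
proof (rule kostka_inversion[OF _ E])
  fix E assume E: "E \<in> young_diagrams n" "nstat (row_length E) < t"
  have n: "sum_list E = n" using E by (simp add: young_diagrams_def)
  have "sigma_type n (young_module E)" by (rule young_module_sigma_type[OF n]) (use IH[OF E] in blast)
  from hdim_young_expansion[OF this rep_young_module[OF mu]]
  show "(\<Sum>F\<in>young_diagrams n. kostka E (row_length F) * hdim n (sigma F) (young_module mu)) =
    (\<Sum>F\<in>young_diagrams n. kostka E (row_length F) * kostka mu (row_length F))"
    using hom_dim_young_modules[OF n mu] IH[OF E] by (simp add: sum_young_parts)
qed

text \<open>The Gram matrix handles the \<open>E\<close> of smaller statistic. For the others no
  equation is at hand yet, but triangularity on both sides gives one for \<open>E = D\<close> and
  zero otherwise.\<close>

lemma young_rule_diagram: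
  assumes "D \<in> young_diagrams n" "E \<in> young_diagrams n"
  shows "hdim n (sigma E) (young_module D) = kostka D (row_length E)"
  using assms
proof (induction "nstat (row_length D)" arbitrary: D E rule: less_induct)
  case less
  have n: "sum_list D = n" using less.prems(1) by (simp add: young_diagrams_def)
  consider "nstat (row_length E) < nstat (row_length D)" | "E = D"
    | "\<not> nstat (row_length E) < nstat (row_length D)" "E \<noteq> D" by blast
  then show ?case
  proof cases
    case 1
    show ?thesis
      by (rule hdim_sigma_young_below[OF n _ less.prems(2) 1]) (use less.hyps in blast)
  next
    case 2
    then show ?thesis using hom_dim_sigma(2)[OF less.prems(1)] kostka_diagonal[OF less.prems(1)] by simp
  next
    case 3
    have ne: "row_length D \<noteq> row_length E" using row_length_inj[OF less.prems] 3(2) by blast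
    have "hdim n (sigma E) (young_module D) = 0"
      using hom_dim_sigma_young[OF less.prems(2) n] 3(1) ne by blast
    moreover have "kostka D (row_length E) = 0"
      using kostka_triangular[OF n less.prems(2)] 3(1) ne by blast
    ultimately show ?thesis by simp
  qed
qed

text \<open>Once all diagrams are settled, the threshold can be put above any \<open>E\<close>,
  which covers compositions in any order.\<close>

theorem young_rule:
  assumes "sum_list mu = n"
  shows "E \<in> young_diagrams n \<Longrightarrow> hdim n (sigma E) (young_module mu) = kostka mu (row_length E)"
    "sigma_type n (young_module mu)"
proof -
  show *: "hdim n (sigma E) (young_module mu) = kostka mu (row_length E)" if "E \<in> young_diagrams n" for E
    by (rule hdim_sigma_young_below[OF assms _ that lessI]) (use young_rule_diagram in blast)
  show "sigma_type n (young_module mu)" by (rule young_module_sigma_type[OF assms *])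
qed

section \<open>Induction with the trivial representation\<close>

text \<open>The \<open>unit\<close> coordinate stems from the tensor factor with the trivial
  representation; slices hide it, so that elements of \<open>induced_trivial k n R\<close> read as
  functions from the group to the space of \<open>R\<close>.\<close>

definition slice :: "('g \<times> 'x \<times> unit \<Rightarrow> complex) \<Rightarrow> 'g \<Rightarrow> 'x \<Rightarrow> complex"
  where "slice F g = (\<lambda>x. F (g, x, ()))"

lemma slice_ext: "(\<And>g. slice F g = slice F' g) \<Longrightarrow> F = F'"
  by (auto simp: slice_def fun_eq_iff)

lemma slice_simps: "slice (F + F') g = slice F g + slice F' g" "slice (cscale c F) g = cscale c (slice F g)"
  "slice 0 g = 0"
  by (auto simp: slice_def cscale_def fun_eq_iff)

text \<open>Tensoring with a line creates no sums: every element of the span is itself the pure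
  tensor of its slice with the constant 1.\<close>

lemma outer_tensor_trivial_space:
  fixes R :: "('g, 'x) crep"
  assumes "cfun.subspace (space R)"
  shows "F \<in> space (outer_tensor R (trivial_rep :: ('h, unit) crep)) \<longleftrightarrow> (\<lambda>x. F (x, ())) \<in> space R"
proof -
  let ?P = "{\<lambda>(x, y). v x * w y | v w. v \<in> space R \<and> w \<in> space (trivial_rep :: ('h, unit) crep)} :: ('x \<times> unit \<Rightarrow> complex) set"
  have "cfun.span ?P \<subseteq> {F. (\<lambda>x. F (x, ())) \<in> space R}"
  proof (rule cfun.span_minimal)
    show "?P \<subseteq> {F. (\<lambda>x. F (x, ())) \<in> space R}"
    proof
      fix F assume "F \<in> ?P"
      then obtain v w where F: "F = (\<lambda>(x, y). v x * w y)" "v \<in> space R" by blast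
      have "(\<lambda>x. F (x, ())) = cscale (w ()) v" by (simp add: F(1) cscale_def mult.commute)
      then show "F \<in> {F. (\<lambda>x. F (x, ())) \<in> space R}" using cfun.subspace_scale[OF assms F(2)] by simp
    qed
    show "cfun.subspace {F :: 'x \<times> unit \<Rightarrow> complex. (\<lambda>x. F (x, ())) \<in> space R}"
      using cfun.subspace_0[OF assms] cfun.subspace_add[OF assms] cfun.subspace_scale[OF assms]
      by (auto simp: cfun.subspace_def cscale_def zero_fun_def plus_fun_def)
  qed
  moreover have "F \<in> cfun.span ?P" if "(\<lambda>x. F (x, ())) \<in> space R"
  proof (rule cfun.span_base)
    define v w where "v = (\<lambda>x. F (x, ()))" and "w = (\<lambda>_ :: unit. 1 :: complex)"
    have "F = (\<lambda>(x, y). v x * w y)" by (auto simp: v_def w_def)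
    moreover have "v \<in> space R" "w \<in> space (trivial_rep :: ('h, unit) crep)"
      using that by (simp_all add: v_def trivial_rep_def)
    ultimately show "F \<in> ?P" by blast
  qed
  ultimately show ?thesis by (auto simp: outer_tensor_def)
qed

lemma outer_tensor_trivial_act:
  "act (outer_tensor R trivial_rep) (p, q) F (x, u) = act R p (\<lambda>x. F (x, ())) x"
  by (simp add: outer_tensor_def trivial_rep_def)

lemma sym_group_last_simps: "q \<in> carrier (sym_group_last k n) \<longleftrightarrow> q permutes {k + 1..n}"
  by (simp add: sym_group_last_def)

lemma young_product_permutes:
  fixes k n :: nat
  assumes "k \<le> n" "p permutes {1..k}" "q permutes {k + 1..n}"
  shows "p \<circ> q permutes {1..n}"
  by (rule permutes_compose[OF permutes_subset[OF assms(3)] permutes_subset[OF assms(2)]]) (use assms(1) in auto)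

lemma induced_trivial_space:
  assumes "cfun.subspace (space R)"
  shows "F \<in> space (induced_trivial k n R) \<longleftrightarrow>
    (\<forall>g. g permutes {1..n} \<longrightarrow> slice F g \<in> space R) \<and> (\<forall>g. \<not> g permutes {1..n} \<longrightarrow> slice F g = 0) \<and>
    (\<forall>p q g. p permutes {1..k} \<longrightarrow> q permutes {k + 1..n} \<longrightarrow> g permutes {1..n} \<longrightarrow>
      slice F (p \<circ> q \<circ> g) = act R p (slice F g))"
proof -
  have "(\<lambda>x. F (p \<circ> q \<circ> g, x)) = act (outer_tensor R trivial_rep) (p, q) (\<lambda>x. F (g, x)) \<longleftrightarrow>
    slice F (p \<circ> q \<circ> g) = act R p (slice F g)" for p q g
    by (auto simp: fun_eq_iff outer_tensor_trivial_act slice_def)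
  then show ?thesis
    unfolding induced_trivial_def induced_space_iff
    by (auto simp: outer_tensor_trivial_space[OF assms] sym_group_last_simps DirProd_def slice_def fun_eq_iff
        simp del: One_nat_def)
qed

lemma induced_trivial_act:
  "slice (act (induced_trivial k n R) h F) g = (if g permutes {1..n} then slice F (g \<circ> h) else 0)"
  by (auto simp: induced_trivial_def induced_act slice_def fun_eq_iff)

lemma representation_induced_trivial:
  assumes "k \<le> n" "representation (sym_group k) R"
  shows "representation (sym_group n) (induced_trivial k n R)"
  unfolding induced_trivial_def
proof (rule representation_induced[OF sym_group_is_group finite_sym_group])
  note sR = rep_subspace[OF assms(2)]
  let ?O = "outer_tensor R trivial_rep" and ?f = "\<lambda>F x. F (x, ())"
  have sub: "cfun.subspace (space ?O)" by (simp add: outer_tensor_def cfun.subspace_span)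
  have lin: "linear_on (space ?O) ?f" by (auto simp: linear_on_def cscale_def fun_eq_iff)
  have "inj_on ?f (space ?O)" by (auto simp: inj_on_def fun_eq_iff)
  then show "fin_dim (space ?O)"
    using fin_dim_inj(1)[OF sub lin _ _ rep_fin_dim[OF assms(2)]] outer_tensor_trivial_space[OF sR] by blast
  fix h assume h: "h \<in> carrier (sym_group k \<times>\<times> sym_group_last k n)"
  then obtain p q where pq: "h = (p, q)" "p permutes {1..k}" "q permutes {k + 1..n}"
    by (auto simp: DirProd_def sym_group_last_simps)
  then have p: "p \<in> carrier (sym_group k)" by simp
  show "linear_on (space ?O) (act ?O h)"
    unfolding linear_on_def
  proof (intro conjI ballI allI)
    fix F F' assume F: "F \<in> space ?O" "F' \<in> space ?O"
    have 1: "act R p (?f F + ?f F') = act R p (?f F) + act R p (?f F')"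
      using linear_on_add[OF rep_linear[OF assms(2) p]] F unfolding outer_tensor_trivial_space[OF sR] by blast
    have 2: "?f (F + F') = ?f F + ?f F'" by auto
    show "act ?O h (F + F') = act ?O h F + act ?O h F'"
    proof (rule ext, clarify)
      fix x
      have "act ?O h (F + F') (x, ()) = (act R p (?f F) + act R p (?f F')) x"
        by (simp only: pq(1) outer_tensor_trivial_act 1 2)
      then show "act ?O h (F + F') (x, ()) = (act ?O h F + act ?O h F') (x, ())"
        by (simp only: plus_fun_apply pq(1) outer_tensor_trivial_act)
    qed
  next
    fix c F assume F: "F \<in> space ?O"
    have 1: "act R p (cscale c (?f F)) = cscale c (act R p (?f F))"
      using linear_on_scale[OF rep_linear[OF assms(2) p]] F unfolding outer_tensor_trivial_space[OF sR] by blast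
    have 2: "?f (cscale c F) = cscale c (?f F)" by (simp add: cscale_def)
    show "act ?O h (cscale c F) = cscale c (act ?O h F)"
    proof (rule ext, clarify)
      fix x
      have "act ?O h (cscale c F) (x, ()) = cscale c (act R p (?f F)) x"
        by (simp only: pq(1) outer_tensor_trivial_act 1 2)
      then show "act ?O h (cscale c F) (x, ()) = cscale c (act ?O h F) (x, ())"
        by (simp only: cscale_def pq(1) outer_tensor_trivial_act)
    qed
  qed
  show "(\<lambda>(p, q). p \<circ> q) h \<in> carrier (sym_group n)"
    using young_product_permutes[OF assms(1) pq(2,3)] by (simp add: pq(1))
qed

section \<open>Functoriality of inducing with the trivial representation\<close>

definition lift_map :: "nat \<Rightarrow> (('x \<Rightarrow> complex) \<Rightarrow> 'y \<Rightarrow> complex) \<Rightarrow>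
    ((nat \<Rightarrow> nat) \<times> 'x \<times> unit \<Rightarrow> complex) \<Rightarrow> (nat \<Rightarrow> nat) \<times> 'y \<times> unit \<Rightarrow> complex"
  where "lift_map n f F = (\<lambda>(g, x, u). if g permutes {1..n} then f (slice F g) x else 0)"

lemma slice_lift_map: "slice (lift_map n f F) g = (if g permutes {1..n} then f (slice F g) else 0)"
  by (auto simp: lift_map_def slice_def fun_eq_iff)

lemma lift_map_intertwiner:
  assumes "k \<le> n" "representation (sym_group k) R" "representation (sym_group k) R'"
    "intertwiner (sym_group k) R R' f"
  shows "intertwiner (sym_group n) (induced_trivial k n R) (induced_trivial k n R') (lift_map n f)"
proof -
  note sp = induced_trivial_space[OF rep_subspace[OF assms(2)]] induced_trivial_space[OF rep_subspace[OF assms(3)]]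
  note fD = intertwinerD[OF assms(4)]
  let ?T = "induced_trivial k n R" and ?T' = "induced_trivial k n R'"
  have sl: "slice F g \<in> space R" if "F \<in> space ?T" "g permutes {1..n}" for F g using that unfolding sp by blast
  have "linear_on (space ?T) (lift_map n f)"
    unfolding linear_on_def
  proof (intro conjI ballI allI)
    fix F F' assume F: "F \<in> space ?T" "F' \<in> space ?T"
    show "lift_map n f (F + F') = lift_map n f F + lift_map n f F'"
      by (rule slice_ext) (use linear_on_add[OF fD(1)] sl F in \<open>simp add: slice_lift_map slice_simps\<close>)
  next
    fix c F assume F: "F \<in> space ?T"
    show "lift_map n f (cscale c F) = cscale c (lift_map n f F)"
      by (rule slice_ext) (use linear_on_scale[OF fD(1)] sl F in \<open>simp add: slice_lift_map slice_simps\<close>)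
  qed
  moreover have "lift_map n f F \<in> space ?T'" if F: "F \<in> space ?T" for F
    unfolding sp(2)
  proof (intro conjI allI impI)
    show "slice (lift_map n f F) g \<in> space R'" if "g permutes {1..n}" for g
      using fD(2) sl[OF F that] that by (simp add: slice_lift_map)
    show "slice (lift_map n f F) g = 0" if "\<not> g permutes {1..n}" for g using that by (simp add: slice_lift_map)
    fix p q g assume pqg: "p permutes {1..k}" "q permutes {k + 1..n}" "g permutes {1..n}"
    have "p \<circ> q \<circ> g permutes {1..n}"
      by (rule permutes_compose[OF pqg(3) young_product_permutes[OF assms(1) pqg(1,2)]])
    moreover have "slice F (p \<circ> q \<circ> g) = act R p (slice F g)" using F pqg unfolding sp by blast
    moreover have "f (act R p (slice F g)) = act R' p (f (slice F g))"
      using fD(3)[of p "slice F g"] pqg(1) sl[OF F pqg(3)] by simp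
    ultimately show "slice (lift_map n f F) (p \<circ> q \<circ> g) = act R' p (slice (lift_map n f F) g)"
      using pqg(3) by (simp add: slice_lift_map)
  qed
  moreover have "lift_map n f (act ?T h F) = act ?T' h (lift_map n f F)"
    if h: "h permutes {1..n}" for h F
  proof (rule slice_ext)
    fix g
    show "slice (lift_map n f (act ?T h F)) g = slice (act ?T' h (lift_map n f F)) g"
      using permutes_compose[OF h, of g] by (simp add: slice_lift_map induced_trivial_act)
  qed
  ultimately show ?thesis unfolding intertwiner_def by auto
qed

lemma induced_trivial_iso:
  assumes "k \<le> n" "rep_iso (sym_group k) R R'"
  shows "rep_iso (sym_group n) (induced_trivial k n R) (induced_trivial k n R')"
proof -
  obtain f where R: "representation (sym_group k) R" "representation (sym_group k) R'"
    and f: "intertwiner (sym_group k) R R' f" "bij_betw f (space R) (space R')"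
    using assms(2) unfolding rep_iso_alt by blast
  note sp = induced_trivial_space[OF rep_subspace[OF R(1)]] induced_trivial_space[OF rep_subspace[OF R(2)]]
  let ?T = "induced_trivial k n R" and ?T' = "induced_trivial k n R'" and ?f' = "inv_into (space R) f"
  note int = lift_map_intertwiner[OF assms(1) R f(1)]
  have eq: "f (?f' w) = w" "?f' w \<in> space R" if "w \<in> space R'" for w
    using f(2) that by (auto simp: bij_betw_def inv_into_into f_inv_into_f)
  have eq': "?f' (f v) = v" if "v \<in> space R" for v using f(2) that by (simp add: bij_betw_def)
  have act': "?f' (act R' p w) = act R p (?f' w)" if "p permutes {1..k}" "w \<in> space R'" for p w
  proof -
    have p: "p \<in> carrier (sym_group k)" using that(1) by simp
    have "act R' p w = f (act R p (?f' w))" using intertwinerD(3)[OF f(1) p eq(2)[OF that(2)]] eq(1)[OF that(2)] by simp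
    then show ?thesis using eq'[OF rep_closed[OF R(1) p eq(2)[OF that(2)]]] by simp
  qed
  have inv: "intertwiner (sym_group k) R' R ?f'"
    unfolding intertwiner_def using linear_on_inv_into[OF intertwinerD(1)[OF f(1)] rep_subspace[OF R(1)] f(2)] eq(2) act' by auto
  have "bij_betw (lift_map n f) (space ?T) (space ?T')"
  proof (rule bij_betw_byWitness[where f' = "lift_map n ?f'"])
    show "\<forall>F\<in>space ?T. lift_map n ?f' (lift_map n f F) = F"
    proof
      fix F assume F: "F \<in> space ?T"
      show "lift_map n ?f' (lift_map n f F) = F"
        by (rule slice_ext) (use F eq' in \<open>auto simp: slice_lift_map sp\<close>)
    qed
    show "\<forall>F\<in>space ?T'. lift_map n f (lift_map n ?f' F) = F"
    proof
      fix F assume F: "F \<in> space ?T'"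
      show "lift_map n f (lift_map n ?f' F) = F"
        by (rule slice_ext) (use F eq in \<open>auto simp: slice_lift_map sp\<close>)
    qed
    show "lift_map n f ` space ?T \<subseteq> space ?T'" using intertwinerD(2)[OF int] by blast
    show "lift_map n ?f' ` space ?T' \<subseteq> space ?T"
      using intertwinerD(2)[OF lift_map_intertwiner[OF assms(1) R(2,1) inv]] by blast
  qed
  then show ?thesis
    unfolding rep_iso_alt
    using int representation_induced_trivial[OF assms(1) R(1)] representation_induced_trivial[OF assms(1) R(2)]
    by (intro conjI exI)
qed

text \<open>Right translation never consults the action of \<open>R\<close>, so inducing a
  subrepresentation gives the same record as restricting the induced representation to a subspace.
  Submodules of \<open>R\<close> thus become submodules of the induced module.\<close>

lemma induced_trivial_subrep:
  "subrep (induced_trivial k n R) (space (induced_trivial k n (subrep R U))) = induced_trivial k n (subrep R U)"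
  by (simp add: subrep_def induced_trivial_def induced_def)

lemma induced_trivial_invariant:
  assumes "k \<le> n" "representation (sym_group k) R" "invariant_subspace (sym_group k) R U"
  shows "invariant_subspace (sym_group n) (induced_trivial k n R) (space (induced_trivial k n (subrep R U)))"
proof -
  have U: "representation (sym_group k) (subrep R U)" by (rule representation_subrep[OF assms(2,3)])
  have "space (induced_trivial k n (subrep R U)) \<subseteq> space (induced_trivial k n R)"
    using invariant_subspaceD(2)[OF assms(3)]
    unfolding subset_iff induced_trivial_space[OF rep_subspace[OF U]] induced_trivial_space[OF rep_subspace[OF assms(2)]]
      subrep_simps by blast
  moreover have "act (induced_trivial k n R) = act (induced_trivial k n (subrep R U))"
    using arg_cong[OF induced_trivial_subrep[of k n R U], of act] by simp
  ultimately show ?thesis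
    using invariant_subspace_space[OF representation_induced_trivial[OF assms(1) U]]
    by (simp add: invariant_subspace_def)
qed

text \<open>The lifted projections split each function slice by slice.\<close>

lemma induced_trivial_internal_sum:
  assumes "k \<le> n" "representation (sym_group k) R" "invariant_subspace (sym_group k) R V"
    "invariant_subspace (sym_group k) R A" "invariant_subspace (sym_group k) R B" "internal_sum V A B"
  shows "internal_sum (space (induced_trivial k n (subrep R V)))
    (space (induced_trivial k n (subrep R A))) (space (induced_trivial k n (subrep R B)))"
proof -
  let ?T = "\<lambda>U. space (induced_trivial k n (subrep R U))"
  note rep = representation_subrep[OF assms(2,3)] representation_subrep[OF assms(2,4)] representation_subrep[OF assms(2,5)]
  note sp = rep[THEN rep_subspace, THEN induced_trivial_space]
  note dec = internal_sum_decompose[OF assms(6) invariant_subspaceD(1)[OF assms(4)] invariant_subspaceD(1)[OF assms(5)]]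
  have AB: "A \<inter> B = {0}" using assms(6) by (simp add: internal_sum_def)
  obtain p q where pq: "intertwiner (sym_group k) (subrep R V) (subrep R A) p"
    "intertwiner (sym_group k) (subrep R V) (subrep R B) q" "\<And>v. v \<in> V \<Longrightarrow> v = p v + q v"
    using projections_exist[OF assms(2,4,5,6)] by auto
  have sub: "?T A \<subseteq> ?T V" "?T B \<subseteq> ?T V" using dec(1,2) unfolding subset_iff sp subrep_simps by blast+
  have zero: "0 \<in> ?T A" "0 \<in> ?T B"
    using cfun.subspace_0[OF rep_subspace[OF representation_induced_trivial[OF assms(1)]]] rep(2,3) by blast+
  show ?thesis
    unfolding internal_sum_def
  proof (intro conjI subset_antisym subsetI)
    fix F assume F: "F \<in> ?T A \<inter> ?T B"
    have "slice F g = 0" for g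
    proof (cases "g permutes {1..n}")
      case True
      then have "slice F g \<in> A" "slice F g \<in> B" using F by (auto simp: sp)
      then show ?thesis using AB by blast
    qed (use F in \<open>simp add: sp\<close>)
    then show "F \<in> {0}" using slice_ext[of F 0] by (simp add: slice_simps)
  next
    fix F :: "(nat \<Rightarrow> nat) \<times> 'a \<times> unit \<Rightarrow> complex" assume "F \<in> {0}"
    then show "F \<in> ?T A \<inter> ?T B" using zero by blast
  next
    fix F assume F: "F \<in> ?T V"
    have "lift_map n p F \<in> ?T A" "lift_map n q F \<in> ?T B"
      using intertwinerD(2)[OF lift_map_intertwiner[OF assms(1) rep(1,2) pq(1)] F]
        intertwinerD(2)[OF lift_map_intertwiner[OF assms(1) rep(1,3) pq(2)] F] .
    moreover have "F = lift_map n p F + lift_map n q F"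
    proof (rule slice_ext)
      fix g
      show "slice F g = slice (lift_map n p F + lift_map n q F) g"
        using F pq(3)[of "slice F g"] by (auto simp: slice_simps slice_lift_map sp)
    qed
    ultimately show "F \<in> {a + b |a b. a \<in> ?T A \<and> b \<in> ?T B}" by blast
  next
    fix F assume "F \<in> {a + b |a b. a \<in> ?T A \<and> b \<in> ?T B}"
    then obtain a b where "F = a + b" "a \<in> ?T V" "b \<in> ?T V" using sub by blast
    then show "F \<in> ?T V"
      using cfun.subspace_add[OF rep_subspace[OF representation_induced_trivial[OF assms(1) rep(1)]]] by blast
  qed
qed

text \<open>Makes the multiplicity in the induced module an additive number of the submodules of
  \<open>R\<close>, to which the expansion over the \<open>sigma F\<close> applies.\<close>

lemma additive_induced_trivial:
  assumes "k \<le> n" "representation (sym_group k) R" "representation (sym_group n) X"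
  shows "additive (sym_group k) R (\<lambda>U. hdim n X (induced_trivial k n (subrep R U)))"
proof -
  note T = representation_induced_trivial[OF assms(1,2)]
  show ?thesis
    unfolding additive_def
  proof (intro allI impI)
    fix V A B assume inv: "invariant_subspace (sym_group k) R V" "invariant_subspace (sym_group k) R A"
      "invariant_subspace (sym_group k) R B" and s: "internal_sum V A B"
    note inv' = inv[THEN induced_trivial_invariant[OF assms(1,2)]]
    show "hdim n X (induced_trivial k n (subrep R V)) =
      hdim n X (induced_trivial k n (subrep R A)) + hdim n X (induced_trivial k n (subrep R B))"
      using additive_hom_dim_right[OF assms(3) T, unfolded additive_def, rule_format, OF inv'
          induced_trivial_internal_sum[OF assms(1,2) inv s]]
      by (simp only: induced_trivial_subrep)
  qed
qed

section \<open>Inducing a Young module appends a part\<close>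

lemma blk_append:
  assumes "sum_list mu = k"
  shows "x \<in> {1..k} \<Longrightarrow> blk (mu @ [m]) x = blk mu x"
    "x \<in> {k + 1..k + m} \<Longrightarrow> blk (mu @ [m]) x = length mu"
proof -
  show "blk (mu @ [m]) x = blk mu x" if "x \<in> {1..k}"
    by (rule blk_eq(1)) (use blk_interval[of x mu] that assms in simp)
  show "blk (mu @ [m]) x = length mu" if "x \<in> {k + 1..k + m}"
    by (rule blk_eq(1)) (use that assms in simp)
qed

text \<open>The last block has the colour \<open>length mu\<close>, which no letter up to
  \<open>k\<close> has, so a stabilising permutation preserves both ranges of letters and is the
  product of its two restrictions.\<close>

lemma young_subgroup_append:
  assumes mu: "sum_list mu = k" and n: "n = k + m"
  shows "w \<in> colour_group n (blk (mu @ [m])) \<longleftrightarrow>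
    (\<exists>p q. p \<in> colour_group k (blk mu) \<and> q permutes {k + 1..n} \<and> w = p \<circ> q)"
proof
  let ?b = "blk (mu @ [m])"
  have lo: "?b x = blk mu x" "?b x < length mu" if "x \<in> {1..k}" for x
    using blk_append(1)[OF mu that] blk_interval(1)[of x mu] that mu by simp_all
  have hi: "?b x = length mu" if "x \<in> {k + 1..n}" for x using blk_append(2)[OF mu] that n by simp
  {
    assume w: "w \<in> colour_group n ?b"
    note wD = colour_groupD[OF w]
    have w1: "w x \<in> {1..k}" if x: "x \<in> {1..k}" for x
    proof (rule ccontr)
      assume "w x \<notin> {1..k}"
      moreover have xn: "x \<in> {1..n}" using x n by simp
      ultimately have "w x \<in> {k + 1..n}" using wD(2)[OF xn] by auto
      then show False using hi[of "w x"] wD(3)[OF xn] lo(2)[OF x] by simp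
    qed
    have w2: "w x \<in> {k + 1..n}" if x: "x \<in> {k + 1..n}" for x
    proof (rule ccontr)
      assume "w x \<notin> {k + 1..n}"
      moreover have xn: "x \<in> {1..n}" using x by simp
      ultimately have "w x \<in> {1..k}" using wD(2)[OF xn] by auto
      then show False using hi[OF x] wD(3)[OF xn] lo(2)[of "w x"] by simp
    qed
    define p q where "p = (\<lambda>x. if x \<in> {1..k} then w x else x)" and "q = (\<lambda>x. if x \<in> {k + 1..n} then w x else x)"
    have bij: "bij_betw w S S" if "finite S" "\<And>x. x \<in> S \<Longrightarrow> w x \<in> S" for S
    proof -
      have inj: "inj_on w S" by (rule inj_on_subset[OF permutes_inj[OF wD(1)] subset_UNIV])
      have "w ` S = S" by (rule endo_inj_surj[OF that(1) _ inj]) (use that(2) in blast)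
      then show ?thesis using inj by (simp add: bij_betw_def)
    qed
    have p: "p permutes {1..k}"
    proof (rule bij_imp_permutes)
      have "bij_betw w {1..k} {1..k}" by (rule bij[OF finite_atLeastAtMost w1])
      then show "bij_betw p {1..k} {1..k}"
        by (rule bij_betw_cong[THEN iffD1, rotated]) (simp add: p_def)
    qed (simp only: p_def if_False)
    have q: "q permutes {k + 1..n}"
    proof (rule bij_imp_permutes)
      have "bij_betw w {k + 1..n} {k + 1..n}" by (rule bij[OF finite_atLeastAtMost w2])
      then show "bij_betw q {k + 1..n} {k + 1..n}"
        by (rule bij_betw_cong[THEN iffD1, rotated]) (simp add: q_def)
    qed (simp only: q_def if_False)
    have "blk mu (p x) = blk mu x" if x: "x \<in> {1..k}" for x
    proof -
      have "x \<in> {1..n}" using x n by simp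
      then have "?b (w x) = ?b x" by (rule wD(3))
      then show ?thesis using lo(1)[OF x] lo(1)[OF w1[OF x]] x by (simp only: p_def if_True)
    qed
    then have "p \<in> colour_group k (blk mu)" using p by (simp add: colour_group_def)
    moreover have "w = p \<circ> q"
    proof
      fix x
      consider "x \<in> {1..k}" | "x \<in> {k + 1..n}" | "x \<notin> {1..n}" by force
      then show "w x = (p \<circ> q) x"
      proof cases
        case 1
        then show ?thesis by (simp add: p_def q_def)
      next
        case 2
        then show ?thesis using w2[OF 2] by (simp add: p_def q_def)
      next
        case 3
        then show ?thesis using permutes_not_in[OF wD(1) 3] n by (auto simp: p_def q_def)
      qed
    qed
    ultimately show "\<exists>p q. p \<in> colour_group k (blk mu) \<and> q permutes {k + 1..n} \<and> w = p \<circ> q" using q by blast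
  }
  assume "\<exists>p q. p \<in> colour_group k (blk mu) \<and> q permutes {k + 1..n} \<and> w = p \<circ> q"
  then obtain p q where p: "p \<in> colour_group k (blk mu)" and q: "q permutes {k + 1..n}" and w: "w = p \<circ> q" by blast
  note pD = colour_groupD[OF p]
  have "?b (w x) = ?b x" if "x \<in> {1..n}" for x
  proof (cases "x \<in> {1..k}")
    case True
    then have "q x = x" using permutes_not_in[OF q] by simp
    then show ?thesis using pD(2,3)[OF True] lo(1)[OF True] lo(1)[OF pD(2)[OF True]] by (simp add: w)
  next
    case False
    then have x: "x \<in> {k + 1..n}" using that by auto
    have qx: "q x \<in> {k + 1..n}" using x by (simp only: permutes_in_image[OF q])
    then have "q x \<notin> {1..k}" by simp
    then have "p (q x) = q x" by (rule permutes_not_in[OF pD(1)])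
    then show ?thesis using hi[OF x] hi[OF qx] by (simp add: w)
  qed
  then show "w \<in> colour_group n ?b"
    using young_product_permutes[OF _ pD(1) q] n by (simp add: w colour_group_def)
qed

text \<open>Transitivity of induction: an element assigns to each \<open>g\<close> a function on the
  smaller symmetric group, and its value at the identity, as a function of \<open>g\<close>, is the
  corresponding element of the larger Young module.\<close>

lemma induced_trivial_young:
  assumes mu: "sum_list mu = k" and kn: "k \<le> n"
  shows "rep_iso (sym_group n) (induced_trivial k n (young_module mu)) (young_module (mu @ [n - k]))"
proof -
  define m where "m = n - k"
  have n: "n = k + m" using kn by (simp add: m_def)
  let ?Y = "young_module mu" and ?Y' = "young_module (mu @ [m])"
  let ?T = "induced_trivial k n ?Y" and ?C = "colour_group k (blk mu)"
  have Y: "?Y = colour_module k (blk mu)" "?Y' = colour_module n (blk (mu @ [m]))"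
    using mu n by (simp_all add: young_module_colour)
  have repY: "representation (sym_group k) ?Y" by (rule rep_young_module[OF mu])
  have repY': "representation (sym_group n) ?Y'" by (rule rep_young_module) (simp add: mu n)
  have repT: "representation (sym_group n) ?T" by (rule representation_induced_trivial[OF kn repY])
  note spT = induced_trivial_space[OF rep_subspace[OF repY], of _ k n]
  define \<Psi> where "\<Psi> F = (\<lambda>(g, u :: unit). slice F g (id, ()))" for F :: "(nat \<Rightarrow> nat) \<times> ((nat \<Rightarrow> nat) \<times> unit) \<times> unit \<Rightarrow> complex"
  have slice_formula: "slice F g (a, ()) = (if a permutes {1..k} then \<Psi> F (a \<circ> g, ()) else 0)"
    if F: "F \<in> space ?T" and g: "g permutes {1..n}" for F g a
  proof (cases "a permutes {1..k}")
    case True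
    have "slice F (a \<circ> id \<circ> g) = act ?Y a (slice F g)"
      using F True g permutes_id[of "{k + 1..n}"] unfolding spT by blast
    then have "\<Psi> F (a \<circ> g, ()) = act ?Y a (slice F g) (id, ())" by (simp add: \<Psi>_def)
    also have "\<dots> = slice F g (a, ())" using permutes_id by (simp add: Y(1) colour_module_act)
    finally show ?thesis using True by simp
  next
    case False
    have "slice F g \<in> space ?Y" using F g unfolding spT by blast
    then show ?thesis using False unfolding Y(1) colour_module_space by simp
  qed
  have lin: "linear_on (space ?T) \<Psi>"
    unfolding linear_on_def \<Psi>_def slice_simps by (auto simp: cscale_def fun_eq_iff)
  have im: "\<Psi> F \<in> space ?Y'" if F: "F \<in> space ?T" for F
    unfolding Y(2) colour_module_space
  proof (intro conjI allI ballI impI)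
    show "\<Psi> F (g, ()) = 0" if "\<not> g permutes {1..n}" for g
      using F that unfolding spT by (simp add: \<Psi>_def)
    fix w g assume w: "w \<in> colour_group n (blk (mu @ [m]))" and g: "g permutes {1..n}"
    obtain p q where p: "p \<in> ?C" and q: "q permutes {k + 1..n}" and weq: "w = p \<circ> q"
      using w unfolding young_subgroup_append[OF mu n] by blast
    have pp: "p permutes {1..k}" by (rule colour_groupD(1)[OF p])
    have "slice F (p \<circ> q \<circ> g) = act ?Y p (slice F g)" using F pp q g unfolding spT by blast
    then have "\<Psi> F (w \<circ> g, ()) = slice F g (p, ())"
      using permutes_id by (simp add: \<Psi>_def weq Y(1) colour_module_act)
    also have "\<dots> = slice F g (p \<circ> id, ())" by simp
    also have "\<dots> = slice F g (id, ())"
    proof -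
      have "slice F g \<in> space ?Y" using F g unfolding spT by blast
      then show ?thesis using p permutes_id[of "{1..k}"] unfolding Y(1) colour_module_space by blast
    qed
    finally show "\<Psi> F (w \<circ> g, ()) = \<Psi> F (g, ())" by (simp add: \<Psi>_def)
  qed
  have inj: "inj_on \<Psi> (space ?T)"
  proof (rule inj_onI)
    fix F F' assume F: "F \<in> space ?T" "F' \<in> space ?T" "\<Psi> F = \<Psi> F'"
    have "slice F g = slice F' g" for g
    proof (cases "g permutes {1..n}")
      case True
      show ?thesis
        using slice_formula[OF F(1) True] slice_formula[OF F(2) True] F(3) by (auto simp: fun_eq_iff)
    next
      case False
      then show ?thesis using F(1,2) unfolding spT by simp
    qed
    then show "F = F'" by (rule slice_ext)
  qed
  have surj: "F' \<in> \<Psi> ` space ?T" if F': "F' \<in> space ?Y'" for F'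
  proof -
    \<comment> \<open>The only candidate for a preimage, by \<open>slice_formula\<close>.\<close>
    define F where "F = (\<lambda>(g, (a, u :: unit), v :: unit). if g permutes {1..n} \<and> a permutes {1..k} then F' (a \<circ> g, ()) else 0)"
    have sl: "slice F g (a, ()) = (if g permutes {1..n} \<and> a permutes {1..k} then F' (a \<circ> g, ()) else 0)" for g a
      by (simp add: F_def slice_def)
    have F'inv: "F' (p \<circ> q \<circ> g, ()) = F' (g, ())"
      if "p \<in> ?C" "q permutes {k + 1..n}" "g permutes {1..n}" for p q g
    proof -
      have "p \<circ> q \<in> colour_group n (blk (mu @ [m]))" unfolding young_subgroup_append[OF mu n] using that by blast
      then show ?thesis using F' that(3) unfolding Y(2) colour_module_space by blast
    qed
    have comp: "a \<circ> g permutes {1..n}" if "a permutes {1..k}" "g permutes {1..n}" for a g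
      using permutes_compose[OF that(2) young_product_permutes[OF kn that(1) permutes_id]] by simp
    have "F \<in> space ?T"
      unfolding spT
    proof (intro conjI allI impI)
      show "slice F g = 0" if "\<not> g permutes {1..n}" for g using that sl by (auto simp: fun_eq_iff)
      show "slice F g \<in> space ?Y" if g: "g permutes {1..n}" for g
        unfolding Y(1) colour_module_space
      proof (intro conjI allI ballI impI)
        show "slice F g (a, ()) = 0" if "\<not> a permutes {1..k}" for a using that by (simp add: sl)
        fix h a assume h: "h \<in> ?C" and a: "a permutes {1..k}"
        have "F' (h \<circ> id \<circ> (a \<circ> g), ()) = F' (a \<circ> g, ())" by (rule F'inv[OF h permutes_id comp[OF a g]])
        then show "slice F g (h \<circ> a, ()) = slice F g (a, ())"
          using g a permutes_compose[OF a colour_groupD(1)[OF h]] by (simp add: sl comp_assoc)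
      qed
      fix p q g assume p: "p permutes {1..k}" and q: "q permutes {k + 1..n}" and g: "g permutes {1..n}"
      have pqg: "p \<circ> q \<circ> g permutes {1..n}" by (rule permutes_compose[OF g young_product_permutes[OF kn p q]])
      show "slice F (p \<circ> q \<circ> g) = act ?Y p (slice F g)"
      proof (rule ext, clarify)
        fix a
        show "slice F (p \<circ> q \<circ> g) (a, ()) = act ?Y p (slice F g) (a, ())"
        proof (cases "a permutes {1..k}")
          case True
          have ap: "a \<circ> p permutes {1..k}" by (rule permutes_compose[OF p True])
          \<comment> \<open>The two permutations move disjoint sets of letters. Once
            \<open>q\<close> stands leftmost, the left invariance of \<open>F'\<close> absorbs
            it.\<close>
          have commute: "(a \<circ> p) \<circ> q = q \<circ> (a \<circ> p)"
          proof
            fix x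
            consider "x \<in> {1..k}" | "x \<in> {k + 1..n}" | "x \<notin> {1..k}" "x \<notin> {k + 1..n}" by blast
            then show "((a \<circ> p) \<circ> q) x = (q \<circ> (a \<circ> p)) x"
            proof cases
              case 1
              then have "(a \<circ> p) x \<in> {1..k}" by (simp only: permutes_in_image[OF ap])
              then have "q x = x" "q ((a \<circ> p) x) = (a \<circ> p) x" using 1 by (intro permutes_not_in[OF q]; simp)+
              then show ?thesis by simp
            next
              case 2
              then have "q x \<in> {k + 1..n}" by (simp only: permutes_in_image[OF q])
              then have "(a \<circ> p) x = x" "(a \<circ> p) (q x) = q x" using 2 by (intro permutes_not_in[OF ap]; simp)+
              then show ?thesis by simp
            next
              case 3
              then have "(a \<circ> p) x = x" "q x = x" using permutes_not_in[OF ap] permutes_not_in[OF q] by blast+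
              then show ?thesis by simp
            qed
          qed
          have "F' (id \<circ> q \<circ> ((a \<circ> p) \<circ> g), ()) = F' ((a \<circ> p) \<circ> g, ())"
            by (rule F'inv[OF colour_group_id q comp[OF ap g]])
          moreover have "a \<circ> (p \<circ> q \<circ> g) = q \<circ> ((a \<circ> p) \<circ> g)"
            using arg_cong[OF commute, of "\<lambda>f. f \<circ> g"] by (simp add: comp_assoc)
          ultimately show ?thesis using True pqg g ap by (simp add: sl Y(1) colour_module_act)
        next
          case False
          then show ?thesis by (simp add: sl Y(1) colour_module_act)
        qed
      qed
    qed
    moreover have "\<Psi> F = F'"
    proof (rule ext, clarify)
      fix g
      show "\<Psi> F (g, ()) = F' (g, ())"
        using F' permutes_id[of "{1..k}"] unfolding Y(2) colour_module_space by (auto simp: \<Psi>_def sl)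
    qed
    ultimately show ?thesis by blast
  qed
  have "\<Psi> (act ?T h F) = act ?Y' h (\<Psi> F)" for h F
    by (auto simp: \<Psi>_def induced_trivial_act Y(2) colour_module_act fun_eq_iff)
  then have "intertwiner (sym_group n) ?T ?Y' \<Psi>" unfolding intertwiner_def using lin im by blast
  moreover have "bij_betw \<Psi> (space ?T) (space ?Y')" using inj surj im by (auto simp: bij_betw_def)
  ultimately show ?thesis unfolding rep_iso_alt m_def[symmetric] using repT repY' by blast
qed

section \<open>The Pieri rule\<close>

text \<open>Both conditions are translated through \<open>col\<close>: a box can be tested by its
  row or by its column. The number of boxes of the difference is then automatic from
  containment.\<close>

lemma strip_diagrams_iff:
  assumes D: "D \<in> young_diagrams k" and E: "E \<in> young_diagrams n" and kn: "k \<le> n"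
  shows "diagram_contained D E \<and> horizontal_strip (n - k) E D \<longleftrightarrow> strip (n - k) (row_length D) (row_length E)"
proof -
  have col: "i < col_length X j \<longleftrightarrow> j < row_length X i" if "X \<in> young_diagrams m" for X m i j
    using column_boxes[OF that, of j] by (auto simp: boxes_def)
  have size: "psize (row_length D) = k" "psize (row_length E) = n"
    using young_diagram_part[OF D] young_diagram_part[OF E] by (simp_all add: parts_def)
  have boxes: "card (boxes E - boxes D) = n - k" if c: "diagram_contained D E"
  proof -
    have "boxes D \<subseteq> boxes E"
    proof (rule subrelI)
      fix i j assume "(i, j) \<in> boxes D"
      moreover have "row_length D i \<le> row_length E i" using c by (simp add: diagram_contained_def)
      ultimately show "(i, j) \<in> boxes E" by (simp add: boxes_def)
    qed
    then show ?thesis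
      using D E by (simp add: card_Diff_subset finite_boxes card_boxes young_diagrams_def)
  qed
  have "(\<forall>j. col_length E j \<le> col_length D j + 1) \<longleftrightarrow> (\<forall>i. row_length E (Suc i) \<le> row_length D i)"
  proof (intro iffI allI)
    fix i assume *: "\<forall>j. col_length E j \<le> col_length D j + 1"
    show "row_length E (Suc i) \<le> row_length D i"
    proof (rule ccontr)
      \<comment> \<open>The column with index \<open>row_length D i\<close> is the witness, being
        the first that misses row \<open>i\<close> of \<open>D\<close>: there \<open>D\<close> has
        at most \<open>i\<close> boxes, while \<open>E\<close> has more than
        \<open>i + 1\<close>.\<close>
      assume "\<not> row_length E (Suc i) \<le> row_length D i"
      then have "Suc i < col_length E (row_length D i)" by (simp add: col[OF E])
      moreover have "\<not> i < col_length D (row_length D i)" by (simp add: col[OF D])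
      ultimately show False using *[rule_format, of "row_length D i"] by linarith
    qed
  next
    fix j assume *: "\<forall>i. row_length E (Suc i) \<le> row_length D i"
    show "col_length E j \<le> col_length D j + 1"
    proof (rule ccontr)
      assume "\<not> ?thesis"
      \<comment> \<open>The row with index \<open>col_length D j\<close> is the first row of
        \<open>D\<close> that does not reach column \<open>j\<close>, but the next row of
        \<open>E\<close> does.\<close>
      then have "Suc (col_length D j) < col_length E j" by simp
      then have "j < row_length E (Suc (col_length D j))" by (simp add: col[OF E])
      then have "j < row_length D (col_length D j)" using * le_trans not_le by metis
      then show False using col[OF D, of "col_length D j" j] by simp
    qed
  qed
  then show ?thesis
    unfolding horizontal_strip_def strip_def interlace_def size using boxes kn
    by (auto simp: diagram_contained_def)
qed

text \<open>The recursion for \<open>kos\<close> removes the strip of the last content entry, here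
  \<open>n - k\<close>, and leaves a tableau of content \<open>mu\<close> on a shape
  \<open>F\<close>.\<close>

lemma kostka_append:
  assumes E: "E \<in> young_diagrams n" and kn: "k \<le> n" and mu: "sum_list mu = k"
  shows "kostka (mu @ [n - k]) (row_length E) =
    (\<Sum>F\<in>young_diagrams k. kostka mu (row_length F) * of_bool (strip (n - k) (row_length F) (row_length E)))"
proof -
  let ?m = "n - k"
  have r: "row_length (mu @ [?m]) j = row_length mu j" if "j < length mu" for j
    using that by (simp add: row_length_def nth_append)
  have E': "is_part (row_length E)" "psize (row_length E) = n"
    using young_diagram_part[OF E] by (simp_all add: parts_def)
  have "row_length (mu @ [?m]) (length mu) = ?m" by (simp add: row_length_def)
  then have "kostka (mu @ [?m]) (row_length E) =
    (\<Sum>D | strip ?m D (row_length E) \<and> is_part (row_length E). kos (length mu) (row_length (mu @ [?m])) D)"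
    by (simp add: kostka_def)
  also have "\<dots> = (\<Sum>D | strip ?m D (row_length E) \<and> is_part (row_length E). kostka mu D)"
    unfolding kostka_def by (rule sum.cong[OF refl]) (rule kos_cong, rule r)
  also have "{D. strip ?m D (row_length E) \<and> is_part (row_length E)} = {D \<in> parts k. strip ?m D (row_length E)}"
    using interlace_is_part E' kn by (auto simp: parts_def strip_def)
  also have "(\<Sum>D\<in>{D \<in> parts k. strip ?m D (row_length E)}. kostka mu D) =
    (\<Sum>D\<in>parts k. kostka mu D * of_bool (strip ?m D (row_length E)))"
    by (simp add: sum.inter_filter[OF finite_parts] of_bool_def if_distrib cong: if_cong)
  also have "\<dots> = (\<Sum>F\<in>young_diagrams k. kostka mu (row_length F) * of_bool (strip ?m (row_length F) (row_length E)))"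
    by (rule sum_young_parts)
  finally show ?thesis .
qed

text \<open>The induced Young module is again a Young module on one side; on the other it is induced
  constituent by constituent, with multiplicities from Young's rule for \<open>mu\<close>.\<close>

lemma hdim_induced_young:
  assumes kn: "k \<le> n" and mu: "sum_list mu = k" and X: "representation (sym_group n) X"
  shows "hdim n X (young_module (mu @ [n - k])) =
    (\<Sum>F\<in>young_diagrams k. kostka mu (row_length F) * hdim n X (induced_trivial k n (sigma F)))"
proof -
  have R: "representation (sym_group k) (young_module mu)" by (rule rep_young_module[OF mu])
  have "hdim n X (induced_trivial k n (subrep (young_module mu) (space (young_module mu)))) =
    (\<Sum>F\<in>young_diagrams k. hdim k (sigma F) (young_module mu) * hdim n X (induced_trivial k n (sigma F)))"
    by (rule sigma_type_expansion[OF young_rule(2)[OF mu] additive_induced_trivial[OF kn R X]])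
      (rule hom_dim_iso_right[OF X induced_trivial_iso[OF kn]])
  then have "hdim n X (induced_trivial k n (young_module mu)) =
    (\<Sum>F\<in>young_diagrams k. kostka mu (row_length F) * hdim n X (induced_trivial k n (sigma F)))"
    by (simp add: young_rule(1)[OF mu])
  then show ?thesis using hom_dim_iso_right[OF X induced_trivial_young[OF mu kn]] by simp
qed

text \<open>With \<open>E\<close> fixed, both sides are functions of \<open>D\<close>. Summed
  against the Kostka numbers of a diagram \<open>F\<close> of size \<open>k\<close>, both give the
  Kostka number of \<open>F @ [n - k]\<close> at \<open>E\<close>, so unitriangularity makes them
  equal.\<close>

lemma hdim_sigma_induced:
  assumes kn: "k \<le> n" and D: "D \<in> young_diagrams k" and E: "E \<in> young_diagrams n"
  shows "hdim n (sigma E) (induced_trivial k n (sigma D)) = of_bool (strip (n - k) (row_length D) (row_length E))"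
proof (rule kostka_inversion[OF _ D lessI])
  fix F assume "F \<in> young_diagrams k"
  then have F: "sum_list F = k" by (simp add: young_diagrams_def)
  then have F': "sum_list (F @ [n - k]) = n" using kn by simp
  show "(\<Sum>D\<in>young_diagrams k. kostka F (row_length D) * hdim n (sigma E) (induced_trivial k n (sigma D))) =
    (\<Sum>D\<in>young_diagrams k. kostka F (row_length D) * of_bool (strip (n - k) (row_length D) (row_length E)))"
    using hdim_induced_young[OF kn F sigma_facts(2)[OF E]] young_rule(1)[OF F' E] kostka_append[OF E kn F] by simp
qed

text \<open>As the diagonal Kostka number is one, a constituent of the module induced from
  \<open>sigma D\<close> also occurs in the Young module of \<open>D @ [n - k]\<close>, whose
  constituents are known.\<close>

lemma constituent_of_induced:
  assumes kn: "k \<le> n" and D: "D \<in> young_diagrams k"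
    and X: "irreducible_rep (sym_group n) X" "hdim n X (induced_trivial k n (sigma D)) > 0"
  shows "\<exists>E\<in>young_diagrams n. rep_iso (sym_group n) X (sigma E)"
proof -
  have d: "sum_list D = k" using D by (simp add: young_diagrams_def)
  have repX: "representation (sym_group n) X" using X(1) by (simp add: irreducible_rep_def)
  let ?f = "\<lambda>F. kostka D (row_length F) * hdim n X (induced_trivial k n (sigma F))"
  have "?f D \<le> (\<Sum>F\<in>young_diagrams k. ?f F)"
    by (rule member_le_sum[OF D _ finite_young_diagrams]) simp
  then have "hdim n X (young_module (D @ [n - k])) > 0"
    using hdim_induced_young[OF kn d repX] kostka_diagonal[OF D] X(2) by simp
  moreover have "sigma_type n (young_module (D @ [n - k]))" by (rule young_rule(2)) (use d kn in simp)
  ultimately show ?thesis using sigma_type_constituent[OF _ X(1)] by blast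
qed

text \<open>Multiplicities zero and one turn the choice of a summand of type \<open>sigma E\<close>
  into a bijection from the admissible diagrams to the summands. Both claims are then the same
  direct sum, indexed once by the diagrams and once by the summands.\<close>

theorem theorem4p4p1:
  fixes k n :: nat and D :: "nat list"
  assumes "k < n" and "D \<in> young_diagrams k"
  shows "multiplicity_free (sym_group n) (induced_trivial k n (sigma D)) \<and>
    rep_iso (sym_group n) (induced_trivial k n (sigma D))
      (direct_sum
        {E \<in> young_diagrams n. diagram_contained D E \<and> horizontal_strip (n - k) E D}
        sigma)"
proof -
  have kn: "k \<le> n" using assms(1) by simp
  let ?G = "sym_group n" and ?R = "induced_trivial k n (sigma D)"
  let ?I = "{E \<in> young_diagrams n. diagram_contained D E \<and> horizontal_strip (n - k) E D}"
  let ?iso = "\<lambda>U E. rep_iso (sym_group n) (subrep (induced_trivial k n (sigma D)) U) (sigma E)"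
  have R: "representation ?G ?R"
    by (rule representation_induced_trivial[OF kn sigma_facts(2)[OF assms(2)]])
  obtain \<W> where W: "irreducible_decomposition ?G ?R (space ?R) \<W>"
    using irreducible_decomposition_exists[OF finite_sym_group R invariant_subspace_space[OF R]] by blast
  note mem = decomposition_member[OF W]
  have fin: "finite \<W>" using W by (simp add: irreducible_decomposition_def)
  have card: "card {U \<in> \<W>. ?iso U E} = of_bool (E \<in> ?I)" if E: "E \<in> young_diagrams n" for E
    using card_sigma_summands[OF W R E] hdim_sigma_induced[OF kn assms(2) E]
      strip_diagrams_iff[OF assms(2) E kn] E by simp
  \<comment> \<open>The multiplicities of the \<open>sigma E\<close> alone would leave room for
    summands of other types; this excludes them.\<close>
  have ex: "\<exists>E\<in>young_diagrams n. ?iso U E" if U: "U \<in> \<W>" for U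
  proof (rule constituent_of_induced[OF kn assms(2) mem(2)[OF U]])
    have "hdim n (subrep ?R U) (subrep ?R U) > 0"
      by (rule irreducible_hom_dim_pos[OF mem(2)[OF U] rep_iso_refl[OF mem(3)[OF U]]])
    then show "hdim n (subrep ?R U) ?R > 0"
      using hom_dim_summand_right[OF finite_sym_group R mem(1,3)[OF U]] by linarith
  qed
  have unique: "U = U'" if U: "U \<in> \<W>" "U' \<in> \<W>" "?iso U E" "?iso U' E" "E \<in> young_diagrams n" for U U' E
  proof -
    have "card {U \<in> \<W>. ?iso U E} \<le> Suc 0" using card[OF U(5)] by simp
    then show ?thesis using U(1-4) fin by (simp add: card_le_Suc0_iff_eq)
  qed
  have "\<exists>U\<in>\<W>. ?iso U E" if "E \<in> ?I" for E
  proof -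
    have "card {U \<in> \<W>. ?iso U E} \<noteq> 0" using card that by simp
    then have "{U \<in> \<W>. ?iso U E} \<noteq> {}" by (metis card.empty)
    then show ?thesis by blast
  qed
  then have "\<forall>E\<in>?I. \<exists>U. U \<in> \<W> \<and> ?iso U E" by blast
  then obtain e where "\<forall>E\<in>?I. e E \<in> \<W> \<and> ?iso (e E) E" by (rule bchoice[THEN exE])
  then have e: "e E \<in> \<W> \<and> ?iso (e E) E" if "E \<in> ?I" for E using that by (rule bspec)
  have bij: "bij_betw e ?I \<W>"
    unfolding bij_betw_def
  proof
    show "inj_on e ?I"
    proof (rule inj_onI)
      fix E E' assume E: "E \<in> ?I" "E' \<in> ?I" "e E = e E'"
      have "?iso (e E) E" using e[OF E(1)] by blast
      moreover have "?iso (e E) E'" using e[OF E(2)] unfolding E(3) by blast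
      ultimately have "rep_iso ?G (sigma E) (sigma E')" using rep_iso_sym rep_iso_trans by blast
      then show "E = E'" using sigma_iso_imp_eq E by blast
    qed
    show "e ` ?I = \<W>"
    proof (intro subset_antisym subsetI)
      fix U assume U: "U \<in> \<W>"
      then obtain E where E: "E \<in> young_diagrams n" "?iso U E" using ex by blast
      then have "card {U \<in> \<W>. ?iso U E} \<noteq> 0" using U fin by auto
      \<comment> \<open>A summand of type \<open>sigma E\<close> makes the multiplicity of
        \<open>E\<close> nonzero, and this multiplicity is the indicator of admissibility.\<close>
      then have EI: "E \<in> ?I" using card[OF E(1)] by (simp split: if_splits)
      then have "e E = U" using unique e E U by blast
      then show "U \<in> e ` ?I" using EI by blast
    qed (use e in blast)
  qed
  have "rep_iso ?G ?R (direct_sum ?I sigma)"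
    by (rule irreducible_decomposition_direct_sum[OF R W bij]) (use e rep_iso_sym in blast)
  moreover have "multiplicity_free ?G ?R"
    unfolding multiplicity_free_def
  proof (intro exI[of _ \<W>] conjI ballI impI)
    show "finite \<W>" by (rule fin)
    show "invariant_subspace ?G ?R U" "irreducible_rep ?G (subrep ?R U)" if "U \<in> \<W>" for U
      using mem(1,2)[OF that] .
    show "U = U'" if U: "U \<in> \<W>" "U' \<in> \<W>" "rep_iso ?G (subrep ?R U) (subrep ?R U')" for U U'
    proof -
      obtain E where E: "E \<in> young_diagrams n" "?iso U' E" using ex[OF U(2)] by blast
      then show ?thesis using unique[OF U(1,2) rep_iso_trans[OF U(3) E(2)] E(2,1)] by blast
    qed
    show "rep_iso ?G ?R (direct_sum \<W> (subrep ?R))"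
      by (rule irreducible_decomposition_direct_sum[OF R W bij_betw_id[of \<W>]])
        (use rep_iso_refl[OF mem(3)] in simp)
  qed
  ultimately show ?thesis by blast
qed

end
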